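(* Let $\lambda,\mu\in\mathbb{C}$ with $|\lambda|\ge|\mu|>1$ and $\lambda\neq\mu$, let $\varphi\in \mathrm{Diff}^{\infty}([0,\infty))$ satisfy $\varphi(x)>x$ for all $x>0$ and be tangent to the identity to infinite order at $0$, and let $(R,\mathcal{F},J)$ be the $5$-dimensional LC Reeb component $R=\tilde R/T^{\mathbb{Z}}$ with $T(z_1,z_2,x)=(\lambda z_1,\mu z_2,\varphi(x))$ (i.e. $\tau=0$), with boundary Hopf surface $H$. Then the group $\mathrm{Aut}(R,H)$ admits the following sequence of extension $$0\to\mathcal{K}\to\mathrm{Aut}(R,H)\to Z_\varphi\to1,$$ where $\mathcal{K}$ is as follows. 1) If $\lambda=\mu^p$ for some $p\ge2$, then $\mathcal{K}$ admits a sequence of extension $$0\to\mathcal{Z}_{\varphi,\mu^p}\times\mathcal{Z}_{\varphi,\mu^{p-1}}\times\cdots\times\mathcal{Z}_{\varphi,\mu}\to\mathcal{K}\to\mathcal{Z}_{\varphi,\mu}\to0.$$ 2) If $\lambda\neq\mu^m$ for all $m\ge1$, then $\mathcal{K}$ admits a sequence of extension $$0\to\mathcal{Z}_{\varphi,\lambda}\times\mathcal{Z}_{\varphi,\lambda\mu^{-1}}\times\cdots\times\mathcal{Z}_{\varphi,\lambda\mu^{-p}}\to\mathcal{K}\to\mathcal{Z}_{\varphi,\mu}\to0,$$ where $p=\left[\frac{\log|\lambda|}{\log|\mu|}\right]\in\mathbb{N}$ and $[\,\cdot\,]$ is the greatest integer function.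
   Context: Setting. $\tilde R=(\mathbb{C}^2\times[0,\infty))\setminus\{(O,0)\}$ carries the foliation $\tilde{\mathcal F}$ with leaves $\mathbb{C}^2\times\{x\}$ ($x>0$) and $\tilde H=(\mathbb{C}^2\setminus\{O\})\times\{0\}$, with the standard complex structure on leaves. With $G(z_1,z_2)=(\lambda z_1,\mu z_2)$ (the case $\tau=0$ of the general normal form $G(z_1,z_2)=(\lambda z_1+\tau z_2^p,\mu z_2)$ of primary Hopf surfaces), put $T=G\times\varphi$. The quotient $R=\tilde R/T^{\mathbb{Z}}$ with the induced foliation $\mathcal F$ and leafwise complex structure $J$ is called an LC Reeb component; its boundary leaf $H=(\mathbb{C}^2\setminus\{O\})/G^{\mathbb{Z}}$ is a primary Hopf surface. A leafwise holomorphic smooth automorphism is a smooth diffeomorphism preserving the foliation and mapping leaves biholomorphically to leaves; $\mathrm{Aut}\,R$ is the group of these for $(R,\mathcal F,J)$, and $\mathrm{Aut}(R,H)$ is the kernel of the restriction map $\mathrm{Aut}\,R\to\mathrm{Aut}\,H$, where $\mathrm{Aut}\,H$ is the group of holomorphic automorphisms of $H$. Each $f\in\mathrm{Aut}(R,H)$ has a unique lift to a leafwise holomorphic smooth automorphism of $\tilde R$ commuting with $T$ and equal to the identity on $\tilde H$; this lift has the form $(\xi_1(z_1,z_2,x),\xi_2(z_1,z_2,x),\eta(x))$. The map $\mathrm{Aut}(R,H)\to Z_\varphi$ sends $f$ to $\eta$, and $\mathcal{K}$ is its kernel. Here $Z_\varphi$ is the centralizer of $\varphi$ in $\mathrm{Diff}^\infty([0,\infty))$.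 For $\nu\in\mathbb{C}$ with $|\nu|>1$, $\mathcal{Z}_{\varphi,\nu}$ is the vector space of solutions $\beta\in C^\infty((0,\infty);\mathbb{C})$ of the functional equation $\beta(\varphi(x))=\nu\beta(x)$ on $(0,\infty)$; every such solution extends to a smooth function on $[0,\infty)$ that is flat at $0$.
   Formalization: In case 2 with |λ|=|μ|^p, the last factor Z_{φ,λμ^{-p}} has |ν|=1, where Z_{φ,ν} is not defined in the text; there it is taken to be the solutions extending smoothly to [0,∞) and flat at 0, which makes this factor trivial. *)

theory Defs
  imports "HOL-Analysis.Analysis" "HOL-Algebra.Bij" "HOL-Algebra.Coset"
    "HOL-Algebra.Product_Groups"
begin

section \<open>Smooth and holomorphic maps\<close>

primrec C_diff_on :: "nat \<Rightarrow> ('a::euclidean_space \<Rightarrow> 'b::euclidean_space) \<Rightarrow> 'a set \<Rightarrow> bool" where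
  "C_diff_on 0 f U \<longleftrightarrow> continuous_on U f"
| "C_diff_on (Suc n) f U \<longleftrightarrow> (\<forall>x\<in>U. f differentiable (at x)) \<and>
     (\<forall>v. C_diff_on n (\<lambda>x. frechet_derivative f (at x) v) U)"

text \<open>Smoothness on an arbitrary set, in particular on sets that contain boundary points of a
  half-space: near every point of the set there is a smooth extension to an open set of the
  ambient space.\<close>

definition smooth_on :: "'a::euclidean_space set \<Rightarrow> ('a \<Rightarrow> 'b::euclidean_space) \<Rightarrow> bool" where
  "smooth_on S f \<longleftrightarrow> (\<forall>p\<in>S. \<exists>U g. open U \<and> p \<in> U \<and> (\<forall>n. C_diff_on n g U) \<and>
     (\<forall>q\<in>S \<inter> U. f q = g q))"

text \<open>Holomorphic maps between open sets of \<open>\<complex>\<^sup>2\<close>: the real derivative exists and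
  is complex linear at every point.\<close>

definition cscale :: "complex \<Rightarrow> complex \<times> complex \<Rightarrow> complex \<times> complex" where
  "cscale c v = (c * fst v, c * snd v)"

definition holomorphic2_on ::
  "(complex \<times> complex \<Rightarrow> complex \<times> complex) \<Rightarrow> (complex \<times> complex) set \<Rightarrow> bool" where
  "holomorphic2_on F W \<longleftrightarrow> (\<forall>w\<in>W. \<exists>D. (F has_derivative D) (at w) \<and>
     (\<forall>c v. D (cscale c v) = cscale c (D v)))"

definition flat_at_0 :: "(real \<Rightarrow> 'a::real_normed_vector) \<Rightarrow> bool" where
  "flat_at_0 g \<longleftrightarrow> (\<forall>n::nat. ((\<lambda>x. g x /\<^sub>R x ^ n) \<longlongrightarrow> 0) (at_right 0))"


section \<open>Diffeomorphisms of the half line and solutions of the functional equation\<close>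

text \<open>Maps of a set to itself are represented, as in \<^const>\<open>BijGroup\<close>, by functions that are
  \<^const>\<open>undefined\<close> outside the set; the product is composition.\<close>

definition Diff_half :: "(real \<Rightarrow> real) monoid" where
  "Diff_half = (BijGroup {0..})\<lparr>carrier :=
     {h \<in> Bij {0..}. smooth_on {0..} h \<and> smooth_on {0..} (inv_into {0..} h)}\<rparr>"

definition centralizer_Diff :: "(real \<Rightarrow> real) \<Rightarrow> (real \<Rightarrow> real) monoid" where
  "centralizer_Diff \<phi> = Diff_half\<lparr>carrier :=
     {h \<in> carrier Diff_half. h \<otimes>\<^bsub>Diff_half\<^esub> \<phi> = \<phi> \<otimes>\<^bsub>Diff_half\<^esub> h}\<rparr>"

text \<open>The additive group of smooth solutions on \<open>(0,\<infinity>)\<close> of \<open>\<beta>(\<phi>(x)) = \<nu> \<beta>(x)\<close>.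
  For \<open>\<bar>\<nu>\<bar> > 1\<close> no further condition is imposed (every solution then extends smoothly
  to \<open>[0,\<infinity>)\<close>, flat at \<open>0\<close>). For \<open>\<bar>\<nu>\<bar> \<le> 1\<close>, where this extension property is not
  automatic, it is required. That range matters only for \<open>\<nu> = \<lambda>\<mu>\<^sup>-\<^sup>p\<close> with
  \<open>\<bar>\<lambda>\<bar> = \<bar>\<mu>\<bar>\<^sup>p\<close>, where \<open>\<bar>\<nu>\<bar> = 1\<close>.\<close>

definition Z_sol :: "(real \<Rightarrow> real) \<Rightarrow> complex \<Rightarrow> (real \<Rightarrow> complex) monoid" where
  "Z_sol \<phi> \<nu> =
     \<lparr>carrier = {\<beta> \<in> extensional {0<..}. smooth_on {0<..} \<beta> \<and>
         (\<forall>x>0. \<beta> (\<phi> x) = \<nu> * \<beta> x) \<and>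
         (cmod \<nu> \<le> 1 \<longrightarrow>
            (\<exists>g. smooth_on {0..} g \<and> flat_at_0 g \<and> (\<forall>x>0. g x = \<beta> x)))},
      mult = (\<lambda>\<beta> \<gamma>. \<lambda>x\<in>{0<..}. \<beta> x + \<gamma> x),
      one = (\<lambda>x\<in>{0<..}. 0)\<rparr>"


section \<open>The foliated covering space of the Reeb component\<close>

type_synonym pt = "complex \<times> complex \<times> real"

definition Rt :: "pt set" where
  "Rt = {(z1, z2, x). 0 \<le> x} - {(0, 0, 0)}"

definition height :: "pt \<Rightarrow> real" where
  "height p = snd (snd p)"

definition leaf_t :: "real \<Rightarrow> pt set" where
  "leaf_t x = {p \<in> Rt. height p = x}"

definition at_level :: "real \<Rightarrow> complex \<times> complex \<Rightarrow> pt" where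
  "at_level x w = (fst w, snd w, x)"

definition proj_C2 :: "pt \<Rightarrow> complex \<times> complex" where
  "proj_C2 p = (fst p, fst (snd p))"

definition leaf_holomorphic_t :: "(pt \<Rightarrow> pt) \<Rightarrow> real \<Rightarrow> bool" where
  "leaf_holomorphic_t F x \<longleftrightarrow>
     holomorphic2_on (\<lambda>w. proj_C2 (F (at_level x w))) {w. at_level x w \<in> Rt}"

definition Aut_Rt :: "(pt \<Rightarrow> pt) monoid" where
  "Aut_Rt = (BijGroup Rt)\<lparr>carrier :=
     {F \<in> Bij Rt. smooth_on Rt F \<and> smooth_on Rt (inv_into Rt F) \<and>
        (\<forall>x\<ge>0. \<exists>y\<ge>0. bij_betw F (leaf_t x) (leaf_t y) \<and>
           leaf_holomorphic_t F x \<and> leaf_holomorphic_t (inv_into Rt F) y)}\<rparr>"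


section \<open>The Reeb component and its automorphism groups\<close>

definition T_map :: "complex \<Rightarrow> complex \<Rightarrow> (real \<Rightarrow> real) \<Rightarrow> pt \<Rightarrow> pt" where
  "T_map lam mu \<phi> = (\<lambda>(z1, z2, x). (lam * z1, mu * z2, \<phi> x))"

text \<open>The orbit of \<open>p\<close> under the group generated by the bijection \<open>T\<close> of \<^const>\<open>Rt\<close>.\<close>

definition proj_R :: "complex \<Rightarrow> complex \<Rightarrow> (real \<Rightarrow> real) \<Rightarrow> pt \<Rightarrow> pt set" where
  "proj_R lam mu \<phi> p = {q \<in> Rt. \<exists>n::nat. q = (T_map lam mu \<phi> ^^ n) p \<or> p = (T_map lam mu \<phi> ^^ n) q}"

definition Reeb :: "complex \<Rightarrow> complex \<Rightarrow> (real \<Rightarrow> real) \<Rightarrow> pt set set" where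
  "Reeb lam mu \<phi> = proj_R lam mu \<phi> ` Rt"

definition leaf_R :: "complex \<Rightarrow> complex \<Rightarrow> (real \<Rightarrow> real) \<Rightarrow> real \<Rightarrow> pt set set" where
  "leaf_R lam mu \<phi> x = proj_R lam mu \<phi> ` leaf_t x"

abbreviation Hopf :: "complex \<Rightarrow> complex \<Rightarrow> (real \<Rightarrow> real) \<Rightarrow> pt set set" where
  "Hopf lam mu \<phi> \<equiv> leaf_R lam mu \<phi> 0"

text \<open>The smooth structure on the quotient is the one for which the projection from
  \<^const>\<open>Rt\<close> is a local diffeomorphism, so a self-map of the quotient is smooth iff it has
  smooth local lifts. Likewise for the complex structures on the leaves.\<close>

definition smooth_R ::
  "complex \<Rightarrow> complex \<Rightarrow> (real \<Rightarrow> real) \<Rightarrow> (pt set \<Rightarrow> pt set) \<Rightarrow> bool" where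
  "smooth_R lam mu \<phi> f \<longleftrightarrow> (\<forall>p\<in>Rt. \<exists>U F. open U \<and> p \<in> U \<and> smooth_on (U \<inter> Rt) F \<and>
     (\<forall>q\<in>U \<inter> Rt. F q \<in> Rt \<and> f (proj_R lam mu \<phi> q) = proj_R lam mu \<phi> (F q)))"

text \<open>Holomorphy of \<open>f\<close> as a map from the leaf through height \<open>x\<close> to the leaf through
  height \<open>y\<close>.\<close>

definition leaf_holomorphic_R ::
  "complex \<Rightarrow> complex \<Rightarrow> (real \<Rightarrow> real) \<Rightarrow> (pt set \<Rightarrow> pt set) \<Rightarrow> real \<Rightarrow> real \<Rightarrow> bool" where
  "leaf_holomorphic_R lam mu \<phi> f x y \<longleftrightarrow> (\<forall>w. at_level x w \<in> Rt \<longrightarrow>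
     (\<exists>W F. open W \<and> w \<in> W \<and> holomorphic2_on F W \<and>
        (\<forall>v\<in>W. at_level x v \<in> Rt \<and> at_level y (F v) \<in> Rt \<and>
           f (proj_R lam mu \<phi> (at_level x v)) = proj_R lam mu \<phi> (at_level y (F v)))))"

definition Aut_R ::
  "complex \<Rightarrow> complex \<Rightarrow> (real \<Rightarrow> real) \<Rightarrow> (pt set \<Rightarrow> pt set) monoid" where
  "Aut_R lam mu \<phi> = (BijGroup (Reeb lam mu \<phi>))\<lparr>carrier :=
     {f \<in> Bij (Reeb lam mu \<phi>).
        smooth_R lam mu \<phi> f \<and> smooth_R lam mu \<phi> (inv_into (Reeb lam mu \<phi>) f) \<and>
        (\<forall>x\<ge>0. \<exists>y\<ge>0. bij_betw f (leaf_R lam mu \<phi> x) (leaf_R lam mu \<phi> y) \<and>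
           leaf_holomorphic_R lam mu \<phi> f x y \<and>
           leaf_holomorphic_R lam mu \<phi> (inv_into (Reeb lam mu \<phi>) f) y x)}\<rparr>"

definition Aut_H ::
  "complex \<Rightarrow> complex \<Rightarrow> (real \<Rightarrow> real) \<Rightarrow> (pt set \<Rightarrow> pt set) monoid" where
  "Aut_H lam mu \<phi> = (BijGroup (Hopf lam mu \<phi>))\<lparr>carrier :=
     {h \<in> Bij (Hopf lam mu \<phi>). leaf_holomorphic_R lam mu \<phi> h 0 0 \<and>
        leaf_holomorphic_R lam mu \<phi> (inv_into (Hopf lam mu \<phi>) h) 0 0}\<rparr>"

definition Aut_RH ::
  "complex \<Rightarrow> complex \<Rightarrow> (real \<Rightarrow> real) \<Rightarrow> (pt set \<Rightarrow> pt set) monoid" where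
  "Aut_RH lam mu \<phi> = (Aut_R lam mu \<phi>)\<lparr>carrier :=
     kernel (Aut_R lam mu \<phi>) (Aut_H lam mu \<phi>) (\<lambda>f. restrict f (Hopf lam mu \<phi>))\<rparr>"

definition lift_R ::
  "complex \<Rightarrow> complex \<Rightarrow> (real \<Rightarrow> real) \<Rightarrow> (pt set \<Rightarrow> pt set) \<Rightarrow> pt \<Rightarrow> pt" where
  "lift_R lam mu \<phi> f = (THE F. F \<in> carrier Aut_Rt \<and>
     (\<forall>p\<in>Rt. proj_R lam mu \<phi> (F p) = f (proj_R lam mu \<phi> p)) \<and>
     (\<forall>p\<in>Rt. F (T_map lam mu \<phi> p) = T_map lam mu \<phi> (F p)) \<and>
     (\<forall>p\<in>leaf_t 0. F p = p))"

text \<open>The function \<open>\<eta>\<close> in the form \<open>(\<xi>\<^sub>1(z\<^sub>1,z\<^sub>2,x), \<xi>\<^sub>2(z\<^sub>1,z\<^sub>2,x), \<eta>(x))\<close> of the lift.\<close>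

definition transverse ::
  "complex \<Rightarrow> complex \<Rightarrow> (real \<Rightarrow> real) \<Rightarrow> (pt set \<Rightarrow> pt set) \<Rightarrow> real \<Rightarrow> real" where
  "transverse lam mu \<phi> f = (THE \<eta>. \<eta> \<in> extensional {0..} \<and>
     (\<forall>p\<in>Rt. height (lift_R lam mu \<phi> f p) = \<eta> (height p)))"

definition K_group ::
  "complex \<Rightarrow> complex \<Rightarrow> (real \<Rightarrow> real) \<Rightarrow> (pt set \<Rightarrow> pt set) monoid" where
  "K_group lam mu \<phi> = (Aut_RH lam mu \<phi>)\<lparr>carrier :=
     kernel (Aut_RH lam mu \<phi>) (centralizer_Diff \<phi>) (transverse lam mu \<phi>)\<rparr>"


section \<open>Group extensions\<close>

text \<open>The predicate for exact sequences in HOL-Algebra would force all groups to have the same element type.\<close>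

definition group_extension ::
  "('a, 'k) monoid_scheme \<Rightarrow> ('a \<Rightarrow> 'b) \<Rightarrow> ('b, 'l) monoid_scheme \<Rightarrow> ('b \<Rightarrow> 'c) \<Rightarrow>
     ('c, 'm) monoid_scheme \<Rightarrow> bool" where
  "group_extension A i B q C \<longleftrightarrow> group A \<and> group B \<and> group C \<and>
     i \<in> mon A B \<and> q \<in> epi B C \<and> i ` carrier A = kernel B C q"

end

theory Submission
  imports Defs "HOL-Complex_Analysis.Complex_Analysis"
begin

text \<open>
  An automorphism that fixes the boundary leaf pointwise is studied through its lift. The covering
  space is a retract of a punctured Euclidean space, hence simply connected, and the graph of the
  relation ``\<open>f\<close> maps the class of \<open>p\<close> to the class of \<open>q\<close>'' is a covering of it
  (\<open>covering_space_relation\<close>). A section through a boundary point is a lift; since the deck group acts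
  properly discontinuously, lifts are determined by one value, which makes this one equal to the
  identity over the boundary, commuting with \<open>T\<close>, smooth and leafwise holomorphic
  (\<open>equivariant_lift_exists\<close>). So the automorphism group is isomorphic to a group of maps of the
  covering space (\<open>desc_surj\<close>, \<open>lift_R_desc\<close>). The height component of a lift commutes with \<open>\<phi>\<close>, and
  \<open>(z\<^sub>1, z\<^sub>2, x) \<mapsto> (z\<^sub>1, z\<^sub>2, \<eta> x)\<close> realises every element of the centralizer.

  A lift that preserves heights has the form \<open>(z\<^sub>1 + h\<^sub>1, z\<^sub>2 + h\<^sub>2, x)\<close>, where \<open>h\<^sub>1\<close> and \<open>h\<^sub>2\<close> vanish at
  height \<open>0\<close>, are entire on each other leaf, and are multiplied by \<open>\<lambda>\<close> and \<open>\<mu>\<close> under \<open>T\<close>. Going backwards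
  along \<open>T\<close>, the coefficient of \<open>z\<^sub>1\<^sup>i z\<^sub>2\<^sup>j\<close> in a function with multiplier \<open>\<kappa>\<close> is multiplied by
  \<open>\<kappa>\<^sup>-\<^sup>1 \<lambda>\<^sup>i \<mu>\<^sup>j\<close>, whereas the Cauchy estimate forces it to tend to \<open>0\<close>. Hence it vanishes unless
  \<open>\<bar>\<lambda>\<^sup>i \<mu>\<^sup>j\<bar> < \<bar>\<kappa>\<bar>\<close> (\<open>rescaled_coefficient_vanishes\<close>). This leaves \<open>h\<^sub>2 = b(x)\<close> and
  \<open>h\<^sub>1 = \<Sum> a\<^sub>j(x) z\<^sub>2\<^sup>j\<close> with \<open>\<bar>\<mu>\<bar>\<^sup>j < \<bar>\<lambda>\<bar>\<close>, and the coefficients solve the functional equations with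
  factors \<open>\<mu>\<close> and \<open>\<lambda> / \<mu>\<^sup>j\<close>. Taking \<open>b\<close> is a homomorphism, and on its kernel composition adds the \<open>a\<^sub>j\<close>.

  Conversely, every choice of solutions occurs, because a solution for a factor of modulus greater
  than \<open>1\<close> extends smoothly by \<open>0\<close> (\<open>solution_extends_by_zero\<close>): \<open>\<phi>'\<close> is near \<open>1\<close> at \<open>0\<close>, so the
  differentiated equation contracts each derivative along backward orbits. Both parts about the kernel
  are instances of \<open>kernel_extension\<close>, which allows any finite list of exponents containing those
  with \<open>\<bar>\<mu>\<bar>\<^sup>j < \<bar>\<lambda>\<bar>\<close> and none with \<open>\<bar>\<mu>\<bar>\<^sup>j > \<bar>\<lambda>\<bar>\<close>.
\<close>

section \<open>Calculus of smooth maps\<close>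

lemma C_diff_on_cong:
  assumes "open U" "\<And>x. x \<in> U \<Longrightarrow> f x = g x" "C_diff_on n f U"
  shows "C_diff_on n g U"
  using assms(2,3)
proof (induction n arbitrary: f g)
  case 0
  then show ?case by (simp cong: continuous_on_cong)
next
  case (Suc n)
  have d: "(f has_derivative frechet_derivative f (at x)) (at x)" if "x \<in> U" for x
    using Suc.prems(2) that by (simp flip: frechet_derivative_works)
  have dg: "(g has_derivative frechet_derivative f (at x)) (at x)" if "x \<in> U" for x
    using has_derivative_transform_within_open[OF d[OF that] assms(1) that] Suc.prems(1) by auto
  have eq: "frechet_derivative f (at x) = frechet_derivative g (at x)" if "x \<in> U" for x
    using frechet_derivative_at[OF dg[OF that]] .
  have "C_diff_on n (\<lambda>x. frechet_derivative g (at x) v) U" for v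
    by (rule Suc.IH[of "\<lambda>x. frechet_derivative f (at x) v"])
      (use eq Suc.prems(2) in \<open>auto\<close>)
  then show ?case
    using dg by (auto simp: differentiable_def)
qed

lemma C_diff_on_subset: "C_diff_on n f U \<Longrightarrow> V \<subseteq> U \<Longrightarrow> C_diff_on n f V"
  by (induction n arbitrary: f) (auto intro: continuous_on_subset)

lemma C_diff_on_SucI:
  assumes "open U" "\<And>x. x \<in> U \<Longrightarrow> (f has_derivative f' x) (at x)"
    "\<And>v. C_diff_on n (\<lambda>x. f' x v) U"
  shows "C_diff_on (Suc n) f U"
proof -
  have "f' x = frechet_derivative f (at x)" if "x \<in> U" for x
    using frechet_derivative_at[OF assms(2)[OF that]] .
  then show ?thesis
    using assms C_diff_on_cong[OF assms(1) _ assms(3)] by (auto simp: differentiable_def)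
qed

lemma C_diff_on_SucD:
  assumes "C_diff_on (Suc n) f U"
  shows "\<And>x. x \<in> U \<Longrightarrow> (f has_derivative frechet_derivative f (at x)) (at x)"
    "\<And>v. C_diff_on n (\<lambda>x. frechet_derivative f (at x) v) U"
  using assms by (auto simp flip: frechet_derivative_works)

lemma C_diff_on_Suc_imp: "C_diff_on (Suc n) f U \<Longrightarrow> C_diff_on n f U"
proof (induction n arbitrary: f)
  case 0
  then show ?case
    by (simp add: differentiable_imp_continuous_on differentiable_at_imp_differentiable_on)
next
  case (Suc n)
  then show ?case by (simp only: C_diff_on.simps) blast
qed

lemma C_diff_on_0: "open U \<Longrightarrow> C_diff_on n (\<lambda>x. 0) U"
  by (induction n) (auto intro!: C_diff_on_SucI[where f' = "\<lambda>x v. 0"] simp del: C_diff_on.simps(2))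

lemma C_diff_on_const: "open U \<Longrightarrow> C_diff_on n (\<lambda>x. c) U"
  by (cases n) (auto intro!: C_diff_on_SucI[where f' = "\<lambda>x v. 0"] C_diff_on_0
      simp del: C_diff_on.simps(2))

lemma C_diff_on_linear:
  assumes "bounded_linear f" "open U"
  shows "C_diff_on n f U"
proof (cases n)
  case 0
  then show ?thesis using assms by (simp add: linear_continuous_on)
next
  case (Suc m)
  show ?thesis unfolding Suc
    by (rule C_diff_on_SucI[where f' = "\<lambda>x v. f v"])
      (use assms in \<open>auto intro: bounded_linear.has_derivative C_diff_on_const
        bounded_linear_imp_has_derivative\<close>)
qed

lemma C_diff_on_add:
  "open U \<Longrightarrow> C_diff_on n f U \<Longrightarrow> C_diff_on n g U \<Longrightarrow> C_diff_on n (\<lambda>x. f x + g x) U"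
proof (induction n arbitrary: f g)
  case 0
  then show ?case by (auto intro: continuous_on_add)
next
  case (Suc n)
  note D = C_diff_on_SucD[OF Suc.prems(2)] C_diff_on_SucD[OF Suc.prems(3)]
  show ?case
    by (rule C_diff_on_SucI[OF Suc.prems(1)])
      (auto intro!: has_derivative_add D Suc.IH Suc.prems)
qed

lemma C_diff_on_bilinear:
  assumes "bounded_bilinear b" "open U"
  shows "C_diff_on n f U \<Longrightarrow> C_diff_on n g U \<Longrightarrow> C_diff_on n (\<lambda>x. b (f x) (g x)) U"
proof (induction n arbitrary: f g)
  case 0
  then show ?case by (auto intro: bounded_bilinear.continuous_on[OF assms(1)])
next
  case (Suc n)
  note D = C_diff_on_SucD[OF Suc.prems(1)] C_diff_on_SucD[OF Suc.prems(2)]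
  show ?case
    by (rule C_diff_on_SucI[OF assms(2)], rule bounded_bilinear.FDERIV[OF assms(1)])
      (auto intro!: D Suc.IH C_diff_on_add assms(2) C_diff_on_Suc_imp[OF Suc.prems(1)]
        C_diff_on_Suc_imp[OF Suc.prems(2)])
qed

lemma C_diff_on_sum:
  assumes "open U" "finite I" "\<And>i. i \<in> I \<Longrightarrow> C_diff_on n (f i) U"
  shows "C_diff_on n (\<lambda>x. \<Sum>i\<in>I. f i x) U"
  using assms(2,3) by (induction I) (auto intro: C_diff_on_add C_diff_on_0 assms(1))

text \<open>The chain rule expresses a directional derivative of the composition through the
  directional derivatives of the outer map along basis vectors, which keeps the induction on the
  order of differentiability within maps between the same spaces.\<close>

lemma C_diff_on_compose:
  assumes "open U" "open V" "f ` U \<subseteq> V"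
  shows "C_diff_on n f U \<Longrightarrow> C_diff_on n g V \<Longrightarrow> C_diff_on n (\<lambda>x. g (f x)) U"
proof (induction n arbitrary: g)
  case 0
  then show ?case using assms by (auto intro: continuous_on_compose2)
next
  case (Suc n)
  note Df = C_diff_on_SucD[OF Suc.prems(1)] and Dg = C_diff_on_SucD[OF Suc.prems(2)]
  define h where "h = (\<lambda>x v. \<Sum>e\<in>Basis. (frechet_derivative f (at x) v \<bullet> e) *\<^sub>R
    frechet_derivative g (at (f x)) e)"
  show ?case
  proof (rule C_diff_on_SucI[OF assms(1), where f' = h])
    fix x assume x: "x \<in> U"
    then have fx: "f x \<in> V" using assms(3) by auto
    interpret L: linear "frechet_derivative g (at (f x))"
      using Dg(1)[OF fx] by (simp add: has_derivative_linear)
    have "h x = frechet_derivative g (at (f x)) \<circ> frechet_derivative f (at x)"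
    proof
      fix v
      have "frechet_derivative g (at (f x)) (frechet_derivative f (at x) v) =
        frechet_derivative g (at (f x))
          (\<Sum>e\<in>Basis. (frechet_derivative f (at x) v \<bullet> e) *\<^sub>R e)"
        by (simp add: euclidean_representation)
      then show "h x v = (frechet_derivative g (at (f x)) \<circ> frechet_derivative f (at x)) v"
        by (simp add: L.sum L.scale h_def)
    qed
    then show "((\<lambda>x. g (f x)) has_derivative h x) (at x)"
      using diff_chain_at[OF Df(1)[OF x] Dg(1)[OF fx]] by (simp add: o_def)
  next
    fix v
    show "C_diff_on n (\<lambda>x. h x v) U"
      unfolding h_def
      by (intro C_diff_on_sum assms(1) finite_Basis
          C_diff_on_bilinear[OF bounded_bilinear_scaleR] Suc.IH Dg
          C_diff_on_bilinear[OF bounded_bilinear_inner] Df C_diff_on_const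
          C_diff_on_Suc_imp[OF Suc.prems(1)])
  qed
qed

lemma smooth_onE:
  assumes "smooth_on S f" "p \<in> S"
  obtains U g where "open U" "p \<in> U" "\<And>n. C_diff_on n g U" "\<And>q. q \<in> S \<inter> U \<Longrightarrow> f q = g q"
  using assms unfolding smooth_on_def by metis

lemma smooth_on_open:
  assumes "open U" "\<And>n. C_diff_on n f U"
  shows "smooth_on U f"
  unfolding smooth_on_def using assms by blast

lemma smooth_on_subset:
  assumes "smooth_on S f" "T \<subseteq> S"
  shows "smooth_on T f"
  unfolding smooth_on_def
proof
  fix p assume "p \<in> T"
  then have "p \<in> S" using assms(2) by auto
  then obtain U g where "open U" "p \<in> U" "\<forall>n. C_diff_on n g U" "\<And>q. q \<in> S \<inter> U \<Longrightarrow> f q = g q"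
    using assms(1) unfolding smooth_on_def by metis
  then show "\<exists>U g. open U \<and> p \<in> U \<and> (\<forall>n. C_diff_on n g U) \<and> (\<forall>q\<in>T \<inter> U. f q = g q)"
    using assms(2) by (intro exI[of _ U] exI[of _ g]) auto
qed

lemma smooth_on_cong:
  assumes "smooth_on S f" "\<And>x. x \<in> S \<Longrightarrow> f x = g x"
  shows "smooth_on S g"
  using assms unfolding smooth_on_def by (metis Int_iff)

lemma smooth_on_local:
  assumes "\<And>p. p \<in> S \<Longrightarrow> \<exists>U. open U \<and> p \<in> U \<and> smooth_on (S \<inter> U) f"
  shows "smooth_on S f"
  unfolding smooth_on_def
proof
  fix p assume p: "p \<in> S"
  then obtain U where U: "open U" "p \<in> U" "smooth_on (S \<inter> U) f" using assms by blast
  then obtain V g where V: "open V" "p \<in> V" "\<And>n. C_diff_on n g V" "\<And>q. q \<in> S \<inter> U \<inter> V \<Longrightarrow> f q = g q"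
    using p unfolding smooth_on_def by (metis IntI)
  have "\<forall>n. C_diff_on n g (U \<inter> V)" using V(3) by (auto intro: C_diff_on_subset)
  then show "\<exists>U g. open U \<and> p \<in> U \<and> (\<forall>n. C_diff_on n g U) \<and> (\<forall>q\<in>S \<inter> U. f q = g q)"
    using U V by (intro exI[of _ "U \<inter> V"] exI[of _ g]) auto
qed

lemma smooth_on_imp_continuous_on:
  assumes "smooth_on S f" shows "continuous_on S f"
  unfolding continuous_on_eq_continuous_within
proof
  fix p assume p: "p \<in> S"
  then obtain U g where U: "open U" "p \<in> U" "\<And>n. C_diff_on n g U" "\<And>q. q \<in> S \<inter> U \<Longrightarrow> f q = g q"
    using assms unfolding smooth_on_def by metis
  have "continuous_on U g" using U(3)[of 0] by simp
  then have "continuous (at p within S) g"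
    using U by (simp add: continuous_on_eq_continuous_at continuous_at_imp_continuous_at_within)
  moreover have "eventually (\<lambda>q. g q = f q) (at p within S)"
    unfolding eventually_at_topological using U by (intro exI[of _ U]) auto
  ultimately show "continuous (at p within S) f"
    using U(2,4) p by (force simp: continuous_within elim: Lim_transform_eventually)
qed

lemma smooth_on_compose:
  assumes f: "smooth_on S f" and g: "smooth_on T g" and im: "\<And>x. x \<in> S \<Longrightarrow> f x \<in> T"
  shows "smooth_on S (\<lambda>x. g (f x))"
  unfolding smooth_on_def
proof
  fix p assume p: "p \<in> S"
  obtain U F where U: "open U" "p \<in> U" "\<And>n. C_diff_on n F U" "\<And>q. q \<in> S \<inter> U \<Longrightarrow> f q = F q"
    by (rule smooth_onE[OF f p]) blast
  obtain V G where V: "open V" "f p \<in> V" "\<And>n. C_diff_on n G V" "\<And>q. q \<in> T \<inter> V \<Longrightarrow> g q = G q"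
    by (rule smooth_onE[OF g im[OF p]]) blast
  let ?W = "U \<inter> F -` V"
  have op: "open ?W"
    using continuous_open_preimage[of U F V] U(1) U(3)[of 0] V(1) by simp
  have "C_diff_on n (\<lambda>x. G (F x)) ?W" for n
    by (rule C_diff_on_compose[OF op V(1)]) (auto intro: C_diff_on_subset U V)
  moreover have "p \<in> ?W" using U V p by auto
  moreover have "g (f q) = G (F q)" if "q \<in> S \<inter> ?W" for q
    using U(4)[of q] V(4)[of "f q"] im[of q] that by auto
  ultimately show "\<exists>U h. open U \<and> p \<in> U \<and> (\<forall>n. C_diff_on n h U) \<and> (\<forall>q\<in>S \<inter> U. g (f q) = h q)"
    using op by blast
qed

lemma smooth_on_linear: "bounded_linear f \<Longrightarrow> smooth_on S f"
  by (rule smooth_on_subset[OF smooth_on_open[of UNIV]]) (auto intro: C_diff_on_linear)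

lemma smooth_on_const: "smooth_on S (\<lambda>x. c)"
  by (rule smooth_on_subset[OF smooth_on_open[of UNIV]]) (auto intro: C_diff_on_const)

lemma smooth_on_id: "smooth_on S (\<lambda>x. x)"
  by (rule smooth_on_linear) (rule bounded_linear_ident)

lemma smooth_on_combine:
  fixes f :: "'a::euclidean_space \<Rightarrow> 'b::euclidean_space" and g :: "'a \<Rightarrow> 'c::euclidean_space"
    and b :: "'b \<Rightarrow> 'c \<Rightarrow> 'd::euclidean_space"
  assumes b: "\<And>n (U :: 'a set) F G. open U \<Longrightarrow> C_diff_on n F U \<Longrightarrow> C_diff_on n G U \<Longrightarrow>
      C_diff_on n (\<lambda>x. b (F x) (G x)) U"
    and "smooth_on S f" "smooth_on S g"
  shows "smooth_on S (\<lambda>x. b (f x) (g x))"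
  unfolding smooth_on_def
proof
  fix p assume p: "p \<in> S"
  obtain U F where U: "open U" "p \<in> U" "\<And>n. C_diff_on n F U" "\<And>q. q \<in> S \<inter> U \<Longrightarrow> f q = F q"
    by (rule smooth_onE[OF assms(2) p]) blast
  obtain V G where V: "open V" "p \<in> V" "\<And>n. C_diff_on n G V" "\<And>q. q \<in> S \<inter> V \<Longrightarrow> g q = G q"
    by (rule smooth_onE[OF assms(3) p]) blast
  have "C_diff_on n (\<lambda>x. b (F x) (G x)) (U \<inter> V)" for n
    by (intro b open_Int U(1) V(1) C_diff_on_subset[OF U(3)] C_diff_on_subset[OF V(3)]) auto
  then show "\<exists>U h. open U \<and> p \<in> U \<and> (\<forall>n. C_diff_on n h U) \<and> (\<forall>q\<in>S \<inter> U. b (f q) (g q) = h q)"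
    using U V by (intro exI[of _ "U \<inter> V"] exI[of _ "\<lambda>x. b (F x) (G x)"]) auto
qed

lemma smooth_on_add: "smooth_on S f \<Longrightarrow> smooth_on S g \<Longrightarrow> smooth_on S (\<lambda>x. f x + g x)"
  by (rule smooth_on_combine[OF C_diff_on_add])

lemma smooth_on_mult:
  fixes f g :: "'a::euclidean_space \<Rightarrow> complex"
  shows "smooth_on S f \<Longrightarrow> smooth_on S g \<Longrightarrow> smooth_on S (\<lambda>x. f x * g x)"
  by (rule smooth_on_combine[OF C_diff_on_bilinear[OF bounded_bilinear_mult]])

lemma smooth_on_linear_compose:
  assumes "bounded_linear L" "smooth_on S f"
  shows "smooth_on S (\<lambda>x. L (f x))"
  by (rule smooth_on_compose[OF assms(2) smooth_on_linear[OF assms(1), of UNIV]]) auto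

lemma smooth_on_uminus: "smooth_on S f \<Longrightarrow> smooth_on S (\<lambda>x. - f x)"
  by (rule smooth_on_linear_compose[OF bounded_linear_minus[OF bounded_linear_ident]])

lemma smooth_on_diff: "smooth_on S f \<Longrightarrow> smooth_on S g \<Longrightarrow> smooth_on S (\<lambda>x. f x - g x)"
  using smooth_on_add[OF _ smooth_on_uminus] by fastforce

lemma smooth_on_sum:
  assumes "\<And>i. i \<in> I \<Longrightarrow> smooth_on S (f i)"
  shows "smooth_on S (\<lambda>x. \<Sum>i\<in>I. f i x)"
  using assms
  by (induction I rule: infinite_finite_induct) (auto intro: smooth_on_add smooth_on_const)

lemma smooth_on_power:
  fixes f :: "'a::euclidean_space \<Rightarrow> complex"
  shows "smooth_on S f \<Longrightarrow> smooth_on S (\<lambda>x. f x ^ n)"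
  by (induction n) (auto intro: smooth_on_mult smooth_on_const)

lemma smooth_on_Pair:
  assumes "smooth_on S f" "smooth_on S g"
  shows "smooth_on S (\<lambda>x. (f x, g x))"
proof -
  have "smooth_on S (\<lambda>x. (f x, 0) + (0, g x))"
    by (intro smooth_on_add smooth_on_linear_compose[OF _ assms(1)]
        smooth_on_linear_compose[OF _ assms(2)] bounded_linear_Pair bounded_linear_ident
        bounded_linear_zero)
  then show ?thesis by simp
qed

lemma smooth_on_fst: "smooth_on S f \<Longrightarrow> smooth_on S (\<lambda>x. fst (f x))"
  by (rule smooth_on_linear_compose[OF bounded_linear_fst])

lemma smooth_on_snd: "smooth_on S f \<Longrightarrow> smooth_on S (\<lambda>x. snd (f x))"
  by (rule smooth_on_linear_compose[OF bounded_linear_snd])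

lemmas smooth_on_intros = smooth_on_Pair smooth_on_fst smooth_on_snd smooth_on_mult smooth_on_add
  smooth_on_diff smooth_on_const smooth_on_id smooth_on_sum smooth_on_power smooth_on_uminus

lemma C_diff_on_local:
  assumes "\<And>p. p \<in> S \<Longrightarrow> \<exists>U. open U \<and> p \<in> U \<and> C_diff_on n f U"
  shows "C_diff_on n f S"
  using assms
proof (induction n arbitrary: f)
  case 0
  show ?case unfolding C_diff_on.simps
  proof (rule continuous_at_imp_continuous_on, rule)
    fix p assume "p \<in> S"
    then obtain U where "open U" "p \<in> U" "continuous_on U f" using 0 by auto
    then show "isCont f p" by (simp add: continuous_on_eq_continuous_at)
  qed
next
  case (Suc n)
  have "f differentiable at p" if "p \<in> S" for p using Suc.prems[OF that] by auto
  moreover have "C_diff_on n (\<lambda>x. frechet_derivative f (at x) v) S" for v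
  proof (rule Suc.IH)
    fix p assume "p \<in> S"
    from Suc.prems[OF this]
    show "\<exists>U. open U \<and> p \<in> U \<and> C_diff_on n (\<lambda>x. frechet_derivative f (at x) v) U" by auto
  qed
  ultimately show ?case by simp
qed

lemma smooth_on_open_iff:
  assumes "open S" shows "smooth_on S f \<longleftrightarrow> (\<forall>n. C_diff_on n f S)"
proof
  assume f: "smooth_on S f"
  show "\<forall>n. C_diff_on n f S"
  proof (rule allI, rule C_diff_on_local)
    fix n p assume "p \<in> S"
    then obtain U g where U: "open U" "p \<in> U" "\<And>n. C_diff_on n g U" "\<And>q. q \<in> S \<inter> U \<Longrightarrow> f q = g q"
      using f unfolding smooth_on_def by metis
    have "C_diff_on n f (S \<inter> U)"
      by (rule C_diff_on_cong[of _ g]) (use U assms in \<open>auto intro: C_diff_on_subset\<close>)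
    then show "\<exists>U. open U \<and> p \<in> U \<and> C_diff_on n f U"
      using assms U \<open>p \<in> S\<close> by (intro exI[of _ "S \<inter> U"]) auto
  qed
qed (use assms smooth_on_open in blast)


section \<open>Smooth curves and extension by zero\<close>

lemma has_vector_derivative_frechet:
  fixes f :: "real \<Rightarrow> 'b::real_normed_vector"
  assumes "f differentiable (at x)"
  shows "(f has_vector_derivative frechet_derivative f (at x) 1) (at x)"
proof -
  have d: "(f has_derivative frechet_derivative f (at x)) (at x)"
    using assms by (simp flip: frechet_derivative_works)
  interpret linear "frechet_derivative f (at x)" using d by (rule has_derivative_linear)
  have "frechet_derivative f (at x) = (\<lambda>v. v *\<^sub>R frechet_derivative f (at x) 1)"
  proof
    fix v :: real
    show "frechet_derivative f (at x) v = v *\<^sub>R frechet_derivative f (at x) 1"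
      using scale[of v 1] by simp
  qed
  with d show ?thesis unfolding has_vector_derivative_def by (rule back_subst)
qed

lemma C_diff_on_real_derivative:
  "C_diff_on (Suc n) f U \<Longrightarrow> C_diff_on n (\<lambda>x::real. frechet_derivative f (at x) 1) U"
  by simp

text \<open>Along the real line smoothness means the existence of an infinite tower of derivatives,
  which is the form in which derivatives are estimated below.\<close>

lemma C_diff_on_real_iff:
  fixes f :: "real \<Rightarrow> 'b::euclidean_space"
  assumes "open U"
  shows "(\<forall>n. C_diff_on n f U) \<longleftrightarrow>
    (\<exists>D. D 0 = f \<and> (\<forall>k. \<forall>x\<in>U. (D k has_vector_derivative D (Suc k) x) (at x)))"
proof
  assume f: "\<forall>n. C_diff_on n f U"
  define D where "D k = ((\<lambda>g x. frechet_derivative g (at x) 1) ^^ k) f" for k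
  have C: "C_diff_on n (D k) U" for n k
  proof (induction k arbitrary: n)
    case 0
    then show ?case using f by (simp add: D_def)
  next
    case (Suc k)
    show ?case using Suc[of "Suc n"] by (simp add: D_def)
  qed
  have "(D k has_vector_derivative D (Suc k) x) (at x)" if "x \<in> U" for k x
    using C[of 1 k] has_vector_derivative_frechet[of "D k" x] that by (simp add: D_def)
  then show "\<exists>D. D 0 = f \<and> (\<forall>k. \<forall>x\<in>U. (D k has_vector_derivative D (Suc k) x) (at x))"
    by (intro exI[of _ D]) (auto simp: D_def)
next
  assume "\<exists>D. D 0 = f \<and> (\<forall>k. \<forall>x\<in>U. (D k has_vector_derivative D (Suc k) x) (at x))"
  then obtain D where D: "D 0 = f"
    "\<And>k x. x \<in> U \<Longrightarrow> (D k has_vector_derivative D (Suc k) x) (at x)" by blast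
  have "C_diff_on n (\<lambda>x. c *\<^sub>R D k x) U" for n k c
  proof (induction n arbitrary: k c)
    case 0
    have "continuous_on U (D k)"
      using D(2) by (meson continuous_at_imp_continuous_on has_vector_derivative_continuous)
    then show ?case by (simp add: continuous_on_scaleR)
  next
    case (Suc n)
    show ?case
    proof (rule C_diff_on_SucI[OF assms])
      fix x assume "x \<in> U"
      show "((\<lambda>x. c *\<^sub>R D k x) has_derivative (\<lambda>v. (v * c) *\<^sub>R D (Suc k) x)) (at x)"
        using has_derivative_scaleR_right[OF D(2)[OF \<open>x \<in> U\<close>, of k, unfolded has_vector_derivative_def], of c]
        by (simp add: mult.commute)
    next
      show "C_diff_on n (\<lambda>x. (v * c) *\<^sub>R D (Suc k) x) U" for v by (rule Suc.IH)
    qed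
  qed
  note * = this
  show "\<forall>n. C_diff_on n f U"
  proof
    fix n show "C_diff_on n f U" using *[of n 1 0] D(1) by simp
  qed
qed

text \<open>A limit of the derivative at an end point is a one-sided derivative there. Hence a smooth
  function all of whose derivatives tend to \<open>0\<close> at the end of a half line continues smoothly by
  the constant \<open>0\<close>.\<close>

lemma smooth_extension_by_zero:
  fixes D :: "nat \<Rightarrow> real \<Rightarrow> 'b::euclidean_space"
  assumes D: "\<And>k x. x > 0 \<Longrightarrow> (D k has_vector_derivative D (Suc k) x) (at x)"
    and lim: "\<And>k. (D k \<longlongrightarrow> 0) (at_right 0)"
  shows "smooth_on UNIV (\<lambda>x. if x > 0 then D 0 x else 0)"
proof -
  define E where "E k x = (if x > 0 then D k x else 0)" for k x
  have pos: "(E k has_vector_derivative E (Suc k) x) (at x)" if "x > 0" for k x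
    by (rule has_vector_derivative_transform_within_open[of "D k" _ _ "{0<..}"])
      (use D that in \<open>auto simp: E_def\<close>)
  have neg: "(E k has_vector_derivative E (Suc k) x) (at x)" if "x < 0" for k x
    by (rule has_vector_derivative_transform_within_open[of "\<lambda>_. 0" _ _ "{..<0}"])
      (use that in \<open>auto simp: E_def\<close>)
  have zero: "(E k has_vector_derivative E (Suc k) 0) (at 0)" for k
    unfolding has_vector_derivative_def has_derivative_at_alt
  proof (intro conjI allI impI)
    fix e :: real assume e: "e > 0"
    have "eventually (\<lambda>x. norm (D (Suc k) x) < e) (at_right 0)"
      using lim[of "Suc k"] e by (simp add: tendsto_iff)
    then obtain d where d: "d > 0" "\<And>x. 0 < x \<Longrightarrow> x < d \<Longrightarrow> norm (D (Suc k) x) < e"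
      by (auto simp: eventually_at_right_field)
    have "norm (D k x) \<le> e * x" if x: "0 < x" "x < d" for x
    proof -
      have "norm (D k x - D k s) \<le> e * (x - s)" if s: "0 < s" "s < x" for s
      proof -
        have "norm (D k x - D k s) \<le> e * norm (x - s)"
        proof (rule differentiable_bound[of "{s..x}" "D k" "\<lambda>x h. h *\<^sub>R D (Suc k) x"])
          fix y assume y: "y \<in> {s..x}"
          show "(D k has_derivative (\<lambda>h. h *\<^sub>R D (Suc k) y)) (at y within {s..x})"
            using D[of y k] y s unfolding has_vector_derivative_def
            by (auto intro: has_derivative_at_withinI)
          have "norm (D (Suc k) y) \<le> e" using d(2)[of y] y s x by auto
          then show "onorm (\<lambda>h. h *\<^sub>R D (Suc k) y) \<le> e"
            by (intro onorm_le) (simp add: mult_left_mono mult.commute[of e])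
        qed (use s in auto)
        then show ?thesis using s by simp
      qed
      then have "eventually (\<lambda>s. norm (D k x - D k s) \<le> e * (x - s)) (at_right 0)"
        using x by (auto simp: eventually_at_right_field)
      moreover have "((\<lambda>s. norm (D k x - D k s)) \<longlongrightarrow> norm (D k x - 0)) (at_right 0)"
        by (intro tendsto_intros lim)
      moreover have "((\<lambda>s. e * (x - s)) \<longlongrightarrow> e * (x - 0)) (at_right 0)"
        by (intro tendsto_intros)
      ultimately have "norm (D k x - 0) \<le> e * (x - 0)"
        by (intro tendsto_le[OF trivial_limit_at_right_real])
      then show ?thesis by simp
    qed
    note bound = this
    have "norm (E k y) \<le> e * \<bar>y\<bar>" if "\<bar>y\<bar> < d" for y
    proof (cases "y > 0")
      case True
      then show ?thesis using bound[of y] that by (simp add: E_def)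
    next
      case False
      then have "E k y = 0" by (simp add: E_def)
      moreover have "0 \<le> e * \<bar>y\<bar>" by (rule mult_nonneg_nonneg) (use e in linarith)+
      ultimately show ?thesis by (simp only: norm_zero)
    qed
    then show "\<exists>d>0. \<forall>y. norm (y - 0) < d \<longrightarrow>
        norm (E k y - E k 0 - (y - 0) *\<^sub>R E (Suc k) 0) \<le> e * norm (y - 0)"
      using d(1) by (intro exI[of _ d]) (simp add: E_def)
  qed (rule bounded_linear_scaleR_left)
  have "(E k has_vector_derivative E (Suc k) x) (at x)" for k x
    using pos neg zero by (metis linorder_neqE_linordered_idom)
  then have "\<exists>D. D 0 = E 0 \<and> (\<forall>k. \<forall>x\<in>UNIV. (D k has_vector_derivative D (Suc k) x) (at x))"
    by (intro exI[of _ E]) simp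
  then have "\<forall>n. C_diff_on n (E 0) UNIV" by (rule C_diff_on_real_iff[OF open_UNIV, THEN iffD2])
  then have "smooth_on UNIV (E 0)" using smooth_on_open[OF open_UNIV] by blast
  moreover have "E 0 = (\<lambda>x. if x > 0 then D 0 x else 0)" by (rule ext) (rule E_def)
  ultimately show ?thesis by simp
qed


section \<open>Expanding diffeomorphisms of the half line\<close>

locale expanding_half =
  fixes \<phi> :: "real \<Rightarrow> real"
  assumes phi_diff: "\<phi> \<in> carrier Diff_half"
    and phi_gt: "\<And>x. x > 0 \<Longrightarrow> \<phi> x > x"
    and phi_flat: "flat_at_0 (\<lambda>x. \<phi> x - x)"
begin

definition \<psi> :: "real \<Rightarrow> real" where "\<psi> = inv_into {0..} \<phi>"

lemma phi_bij: "bij_betw \<phi> {0..} {0..}"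
  using phi_diff by (simp add: Diff_half_def Bij_def)

lemma phi_smooth: "smooth_on {0..} \<phi>" and psi_smooth: "smooth_on {0..} \<psi>"
  using phi_diff by (simp_all add: Diff_half_def \<psi>_def)

lemma phi_nonneg: "x \<ge> 0 \<Longrightarrow> \<phi> x \<ge> 0"
  using phi_bij bij_betwE by fastforce

lemma psi_nonneg: "x \<ge> 0 \<Longrightarrow> \<psi> x \<ge> 0"
  using bij_betwE[OF bij_betw_inv_into[OF phi_bij]] by (simp add: \<psi>_def)

lemma psi_phi: "x \<ge> 0 \<Longrightarrow> \<psi> (\<phi> x) = x"
  using bij_betw_inv_into_left[OF phi_bij] by (simp add: \<psi>_def)

lemma phi_psi: "x \<ge> 0 \<Longrightarrow> \<phi> (\<psi> x) = x"
  using bij_betw_inv_into_right[OF phi_bij] by (simp add: \<psi>_def)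

text \<open>The preimage of \<open>0\<close> cannot be positive, as positive points move up.\<close>

lemma phi_0: "\<phi> 0 = 0"
proof -
  have "\<psi> 0 = 0" using phi_gt[of "\<psi> 0"] phi_psi[of 0] psi_nonneg[of 0] by fastforce
  then show ?thesis using phi_psi[of 0] by simp
qed

lemma psi_0: "\<psi> 0 = 0" using psi_phi[of 0] phi_0 by simp

lemma phi_pos: "x > 0 \<Longrightarrow> \<phi> x > 0" using phi_gt by fastforce

lemma psi_pos: "x > 0 \<Longrightarrow> \<psi> x > 0"
  using psi_nonneg[of x] phi_psi[of x] phi_0 by (cases "\<psi> x = 0") auto

lemma psi_less: "x > 0 \<Longrightarrow> \<psi> x < x"
  using phi_gt[OF psi_pos[of x]] phi_psi[of x] by simp

lemma psi_le: "x \<ge> 0 \<Longrightarrow> \<psi> x \<le> x"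
  using psi_less[of x] psi_0 by (cases "x = 0") auto

lemma phi_cont: "continuous_on {0..} \<phi>" and psi_cont: "continuous_on {0..} \<psi>"
  using phi_smooth psi_smooth smooth_on_imp_continuous_on by auto

text \<open>An injective continuous function is monotone, and \<open>\<phi>\<close> starts at its minimum.\<close>

lemma phi_mono: assumes "0 \<le> x" "x < y" shows "\<phi> x < \<phi> y"
proof (cases "x = 0")
  case True
  then show ?thesis using phi_0 phi_pos assms by simp
next
  case False
  have "inj_on \<phi> {0..y}" using phi_bij by (auto simp: bij_betw_def inj_on_def)
  moreover have "continuous_on {0..y} \<phi>" using phi_cont by (rule continuous_on_subset) auto
  ultimately have "\<phi> 0 < \<phi> x \<and> \<phi> x < \<phi> y \<or> \<phi> y < \<phi> x \<and> \<phi> x < \<phi> 0"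
    using False assms by (intro continuous_inj_imp_mono) auto
  then show ?thesis using phi_0 phi_nonneg[of x] assms by auto
qed

lemma phi_less_iff: "0 \<le> x \<Longrightarrow> 0 \<le> y \<Longrightarrow> \<phi> x < \<phi> y \<longleftrightarrow> x < y"
  using phi_mono[of x y] phi_mono[of y x] by (cases x y rule: linorder_cases) auto

lemma psi_pow_nonneg: "x \<ge> 0 \<Longrightarrow> (\<psi> ^^ n) x \<ge> 0"
  by (induction n) (auto intro: psi_nonneg)

lemma phi_pow_nonneg: "x \<ge> 0 \<Longrightarrow> (\<phi> ^^ n) x \<ge> 0"
  by (induction n) (auto intro: phi_nonneg)

lemma psi_pow_pos: "x > 0 \<Longrightarrow> (\<psi> ^^ n) x > 0"
  by (induction n) (auto intro: psi_pos)

lemma phi_pow_pos: "x > 0 \<Longrightarrow> (\<phi> ^^ n) x > 0"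
  by (induction n) (auto intro: phi_pos)

lemma phi_pow_less_iff: "0 \<le> x \<Longrightarrow> 0 \<le> y \<Longrightarrow> (\<phi> ^^ n) x < (\<phi> ^^ n) y \<longleftrightarrow> x < y"
  by (induction n) (auto simp: phi_less_iff phi_pow_nonneg)

lemma phi_psi_pow: "x \<ge> 0 \<Longrightarrow> (\<phi> ^^ n) ((\<psi> ^^ n) x) = x"
proof (induction n arbitrary: x)
  case (Suc n)
  have "(\<phi> ^^ Suc n) ((\<psi> ^^ Suc n) x) = (\<phi> ^^ n) (\<phi> (\<psi> ((\<psi> ^^ n) x)))"
    by (simp add: funpow_swap1)
  then show ?case using Suc by (simp add: phi_psi psi_pow_nonneg)
qed simp

text \<open>The backward orbits decrease, and their limit is a fixed point.\<close>

lemma psi_pow_tendsto_0: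
  assumes "x \<ge> 0" shows "(\<lambda>n. (\<psi> ^^ n) x) \<longlonglongrightarrow> 0"
proof -
  have "decseq (\<lambda>n. (\<psi> ^^ n) x)"
    by (rule decseq_SucI) (simp add: psi_le psi_pow_nonneg assms)
  then obtain L where L: "(\<lambda>n. (\<psi> ^^ n) x) \<longlonglongrightarrow> L" "\<forall>n. L \<le> (\<psi> ^^ n) x"
    using decseq_convergent[of "\<lambda>n. (\<psi> ^^ n) x" 0] psi_pow_nonneg[OF assms] by metis
  have L0: "L \<ge> 0" using L(1) psi_pow_nonneg[OF assms] LIMSEQ_le_const by blast
  have "(\<lambda>n. \<psi> ((\<psi> ^^ n) x)) \<longlonglongrightarrow> \<psi> L"
    using continuous_on_tendsto_compose[OF psi_cont L(1)] L0 psi_pow_nonneg[OF assms] by simp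
  moreover have "(\<lambda>n. \<psi> ((\<psi> ^^ n) x)) \<longlonglongrightarrow> L"
    using LIMSEQ_Suc[OF L(1)] by simp
  ultimately have "\<psi> L = L" using LIMSEQ_unique by blast
  then have "L = 0" using psi_less[of L] L0 by fastforce
  then show ?thesis using L(1) by simp
qed

lemma phi_at_right: "filterlim \<phi> (at_right 0) (at_right 0)"
proof -
  have "(\<phi> \<longlongrightarrow> \<phi> 0) (at 0 within {0..})" using phi_cont by (simp add: continuous_on)
  then have "(\<phi> \<longlongrightarrow> 0) (at_right 0)" 
    unfolding phi_0 by (rule tendsto_within_subset) auto
  then show ?thesis
    unfolding filterlim_at
    by (force simp: eventually_at_right_field intro!: exI[of _ 1] dest: phi_pos)
qed

text \<open>Small points reach the fundamental interval \<open>[c, \<phi> c]\<close> only after many forward steps, each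
  of which contracts \<open>u\<close> up to the error.\<close>

lemma contraction_tendsto_0:
  fixes u e :: "real \<Rightarrow> real"
  assumes cont: "continuous_on {0<..} u" and nn: "\<And>x. x > 0 \<Longrightarrow> u x \<ge> 0"
    and q: "0 \<le> q" "q < 1" and "d > 0"
    and ineq: "\<And>x. 0 < x \<Longrightarrow> x < d \<Longrightarrow> u x \<le> q * u (\<phi> x) + e x"
    and e: "(e \<longlongrightarrow> 0) (at_right 0)"
  shows "(u \<longlongrightarrow> 0) (at_right 0)"
proof (rule tendstoI)
  fix \<epsilon> :: real assume "\<epsilon> > 0"
  define r where "r = \<epsilon> / 3"
  have r: "r > 0" using \<open>\<epsilon> > 0\<close> by (simp add: r_def)
  have "eventually (\<lambda>x. e x < r * (1 - q)) (at_right 0)"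
    using e r q by (intro order_tendstoD) auto
  then obtain d' where d': "d' > 0" "\<And>x. 0 < x \<Longrightarrow> x < d' \<Longrightarrow> e x < r * (1 - q)"
    by (auto simp: eventually_at_right_field)
  define c where "c = min d d' / 2"
  have c: "c > 0" "c < d" "c < d'" using d' \<open>d > 0\<close> by (auto simp: c_def min_def)
  \<comment> \<open>The shift by \<open>r\<close> absorbs the error term, which is at most \<open>r (1 - q)\<close> below \<open>c\<close>.\<close>
  define v where "v x = u x - r" for x
  have v: "v x \<le> q * v (\<phi> x)" if "0 < x" "x < c" for x
    using ineq[of x] d'(2)[of x] that c by (simp add: v_def algebra_simps)
  have vpow: "v x \<le> q ^ n * v ((\<phi> ^^ n) x)" if "0 < x" "\<And>j. j < n \<Longrightarrow> (\<phi> ^^ j) x < c" for x n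
    using that(2)
  proof (induction n)
    case (Suc n)
    have "v ((\<phi> ^^ n) x) \<le> q * v (\<phi> ((\<phi> ^^ n) x))"
      by (rule v) (use Suc.prems that(1) phi_pow_pos in auto)
    then have "q ^ n * v ((\<phi> ^^ n) x) \<le> q ^ n * (q * v (\<phi> ((\<phi> ^^ n) x)))"
      using q by (intro mult_left_mono) auto
    moreover have "v x \<le> q ^ n * v ((\<phi> ^^ n) x)" using Suc by simp
    ultimately show ?case by (simp add: mult.assoc mult.left_commute)
  qed simp
  have "compact (v ` {c..\<phi> c})"
    by (intro compact_continuous_image)
      (auto simp: v_def intro!: continuous_intros continuous_on_subset[OF cont] c less_le_trans[OF c(1)])
  then obtain M where M: "\<And>x. x \<in> {c..\<phi> c} \<Longrightarrow> \<bar>v x\<bar> \<le> M"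
    by (force dest!: compact_imp_bounded simp: bounded_iff)
  have "(\<lambda>n. q ^ n * M) \<longlonglongrightarrow> 0 * M" using q by (intro tendsto_intros LIMSEQ_power_zero) auto
  then have "eventually (\<lambda>n. q ^ n * M < r) sequentially"
    using r by (intro order_tendstoD) auto
  then obtain N where N: "q ^ n * M < r" if "n \<ge> N" for n by (auto simp: eventually_sequentially)
  have "u x < \<epsilon>" if x: "0 < x" "x < (\<psi> ^^ N) c" for x
  proof -
    have ex: "\<exists>n. (\<phi> ^^ n) x \<ge> c"
    proof -
      have "eventually (\<lambda>n. (\<psi> ^^ n) c < x) sequentially"
        using psi_pow_tendsto_0[of c] c x by (intro order_tendstoD) auto
      then obtain n where "(\<psi> ^^ n) c < x" by (auto simp: eventually_sequentially)
      then have "(\<phi> ^^ n) ((\<psi> ^^ n) c) < (\<phi> ^^ n) x"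
        using phi_pow_less_iff psi_pow_nonneg x c by simp
      then have "c \<le> (\<phi> ^^ n) x" using phi_psi_pow[of c n] c by linarith
      then show ?thesis by (rule exI)
    qed
    define n where "n = (LEAST n. (\<phi> ^^ n) x \<ge> c)"
    have n1: "(\<phi> ^^ n) x \<ge> c" unfolding n_def using ex by (rule LeastI_ex)
    have n2: "(\<phi> ^^ j) x < c" if "j < n" for j
      using not_less_Least[of j "\<lambda>n. (\<phi> ^^ n) x \<ge> c"] that by (simp add: n_def)
    have "n > N"
    proof (rule ccontr)
      assume "\<not> n > N"
      then obtain k where k: "N = k + n" by (metis add.commute le_Suc_ex linorder_not_less)
      have "(\<phi> ^^ n) x < (\<phi> ^^ n) ((\<psi> ^^ N) c)" using x c psi_pow_nonneg phi_pow_less_iff by simp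
      also have "(\<psi> ^^ N) c = (\<psi> ^^ n) ((\<psi> ^^ k) c)"
        unfolding k by (simp only: add.commute[of k n] funpow_add comp_apply)
      also have "(\<phi> ^^ n) \<dots> = (\<psi> ^^ k) c" using phi_psi_pow psi_pow_nonneg c by simp
      also have "\<dots> \<le> c"
      proof (induction k)
        case (Suc k)
        then show ?case using psi_le[of "(\<psi> ^^ k) c"] psi_pow_nonneg[of c k] c by simp
      qed simp
      finally show False using n1 by simp
    qed
    then obtain m where m: "n = Suc m" by (cases n) auto
    have "(\<phi> ^^ n) x \<le> \<phi> c"
      using n2[of m] m phi_less_iff[of "(\<phi> ^^ m) x" c] phi_pow_nonneg[of x m] x c by auto
    then have "\<bar>v ((\<phi> ^^ n) x)\<bar> \<le> M" using M n1 by auto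
    then have "q ^ n * v ((\<phi> ^^ n) x) \<le> q ^ n * M" using q by (intro mult_left_mono) auto
    then have "v x < r" using vpow[of x n] n2 x N[of n] \<open>n > N\<close> by fastforce
    then show ?thesis using r by (simp add: v_def r_def)
  qed
  then show "eventually (\<lambda>x. dist (u x) 0 < \<epsilon>) (at_right 0)"
    using psi_pow_pos[OF c(1), of N] nn
    by (auto simp: eventually_at_right_field intro!: exI[of _ "(\<psi> ^^ N) c"])
qed

subsection \<open>Solutions of the functional equation extend flatly\<close>

text \<open>The equation \<open>\<beta> \<circ> \<phi> = \<nu> \<beta>\<close>, differentiated \<open>k\<close> times by the chain and product rules. A
  coefficient of the next step is the derivative of the old one plus \<open>\<phi>'\<close> times its predecessor, so
  the leading one is \<open>\<phi>'\<^sup>k\<close>. The function \<open>g\<close> extends \<open>\<phi>\<close> smoothly beyond \<open>0\<close>, which keeps the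
  coefficients bounded there.\<close>

lemma derivative_recursion:
  fixes D :: "nat \<Rightarrow> real \<Rightarrow> complex" and g :: "real \<Rightarrow> real"
  assumes U: "open U" and g: "\<And>n. C_diff_on n g U" "\<And>x. x \<in> U \<Longrightarrow> x \<ge> 0 \<Longrightarrow> \<phi> x = g x"
    and D: "\<And>k x. x > 0 \<Longrightarrow> (D k has_vector_derivative D (Suc k) x) (at x)"
    and eq: "\<And>x. x > 0 \<Longrightarrow> D 0 (\<phi> x) = \<nu> * D 0 x"
  defines "dg \<equiv> \<lambda>x. frechet_derivative g (at x) 1"
  shows "\<exists>P. (\<forall>j n. C_diff_on n (P j) U) \<and> (\<forall>j>k. P j = (\<lambda>_. 0)) \<and> (\<forall>x. P k x = dg x ^ k) \<and>
    (\<forall>x\<in>U. x > 0 \<longrightarrow> \<nu> * D k x = (\<Sum>j\<le>k. P j x *\<^sub>R D j (\<phi> x)))"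
proof (induction k)
  case 0
  show ?case
    by (rule exI[of _ "\<lambda>j x. if j = 0 then 1 else 0"])
      (use eq U in \<open>auto intro: C_diff_on_const simp: fun_eq_iff\<close>)
next
  case (Suc k)
  then obtain P where P: "\<And>j n. C_diff_on n (P j) U" "\<And>j. j > k \<Longrightarrow> P j = (\<lambda>_. 0)"
    "\<And>x. P k x = dg x ^ k"
    "\<And>x. x \<in> U \<Longrightarrow> x > 0 \<Longrightarrow> \<nu> * D k x = (\<Sum>j\<le>k. P j x *\<^sub>R D j (\<phi> x))" by blast
  define Q where "Q j x = frechet_derivative (P j) (at x) 1 + (case j of 0 \<Rightarrow> 0 | Suc i \<Rightarrow> P i x * dg x)"
    for j x
  have dgC: "C_diff_on n dg U" for n
    using C_diff_on_real_derivative[OF g(1)] by (simp add: dg_def)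
  have QC: "C_diff_on n (Q j) U" for n j
  proof (cases j)
    case 0
    then show ?thesis using C_diff_on_real_derivative[OF P(1)] by (simp add: Q_def[abs_def])
  next
    case (Suc i)
    then show ?thesis
      by (simp add: Q_def[abs_def] del: C_diff_on.simps, intro C_diff_on_add U C_diff_on_real_derivative P
          C_diff_on_bilinear[OF bounded_bilinear_mult U] dgC)
  qed
  have Q0: "Q j = (\<lambda>_. 0)" if "j > Suc k" for j
    using that P(2)[of j] P(2)[of "j - 1"] by (cases j) (auto simp: Q_def[abs_def])
  have Qk: "Q (Suc k) x = dg x ^ Suc k" for x
    using P(2)[of "Suc k"] P(3)[of x] by (simp add: Q_def mult.commute)
  have rec: "\<nu> * D (Suc k) x = (\<Sum>j\<le>Suc k. Q j x *\<^sub>R D j (\<phi> x))" if x: "x \<in> U" "x > 0" for x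
  proof -
    have Pd: "(P j has_vector_derivative frechet_derivative (P j) (at x) 1) (at x)" for j
      using has_vector_derivative_frechet[of "P j" x] P(1)[of 1 j] x by simp
    have gd: "(g has_vector_derivative dg x) (at x)"
      using has_vector_derivative_frechet[of g x] g(1)[of 1] x by (simp add: dg_def)
    have "(\<phi> has_vector_derivative dg x) (at x)"
      by (rule has_vector_derivative_transform_within_open[OF gd, of "U \<inter> {0<..}"])
        (use x U g(2) in auto)
    then have Dd: "((\<lambda>x. D j (\<phi> x)) has_vector_derivative dg x *\<^sub>R D (Suc j) (\<phi> x)) (at x)" for j
      using vector_diff_chain_at[of \<phi> "dg x" x "D j"] D[OF phi_pos[OF x(2)], of j] by (simp add: o_def)
    have R: "((\<lambda>x. \<Sum>j\<le>k. P j x *\<^sub>R D j (\<phi> x)) has_vector_derivative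
      (\<Sum>j\<le>k. P j x *\<^sub>R (dg x *\<^sub>R D (Suc j) (\<phi> x)) +
        frechet_derivative (P j) (at x) 1 *\<^sub>R D j (\<phi> x))) (at x)"
      using Pd Dd
      by (intro has_vector_derivative_sum has_vector_derivative_scaleR)
        (auto simp: has_real_derivative_iff_has_vector_derivative)
    have "((\<lambda>x. \<nu> * D k x) has_vector_derivative \<nu> * D (Suc k) x) (at x)"
      using D[OF x(2), of k] by (rule has_vector_derivative_mult_right)
    then have L: "((\<lambda>x. \<Sum>j\<le>k. P j x *\<^sub>R D j (\<phi> x)) has_vector_derivative \<nu> * D (Suc k) x) (at x)"
      by (rule has_vector_derivative_transform_within_open[of _ _ _ "U \<inter> {0<..}"])
        (use x U P(4) in auto)
    have "(\<Sum>j\<le>Suc k. Q j x *\<^sub>R D j (\<phi> x)) =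
      (\<Sum>j\<le>Suc k. frechet_derivative (P j) (at x) 1 *\<^sub>R D j (\<phi> x)) +
      (\<Sum>j\<le>Suc k. (case j of 0 \<Rightarrow> 0 | Suc i \<Rightarrow> P i x * dg x) *\<^sub>R D j (\<phi> x))"
      by (simp add: Q_def scaleR_add_left sum.distrib)
    also have "\<dots> = (\<Sum>j\<le>k. frechet_derivative (P j) (at x) 1 *\<^sub>R D j (\<phi> x)) +
      (\<Sum>j\<le>k. (P j x * dg x) *\<^sub>R D (Suc j) (\<phi> x))"
      using P(2)[of "Suc k"] by (subst (2) sum.atMost_Suc_shift) simp
    finally show ?thesis
      using vector_derivative_unique_at[OF L R] by (simp add: sum.distrib add.commute)
  qed
  show ?case using QC Q0 Qk rec by (intro exI[of _ Q]) auto
qed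

text \<open>Tangency to the identity at \<open>0\<close> to first order, in terms of a smooth extension of \<open>\<phi>\<close>.\<close>

lemma phi_extension:
  obtains U g where "open U" "0 \<in> U" "\<And>n. C_diff_on n g U" "\<And>x. x \<in> U \<Longrightarrow> x \<ge> 0 \<Longrightarrow> \<phi> x = g x"
    "frechet_derivative g (at 0) 1 = (1::real)"
proof -
  obtain U g where U: "open U" "0 \<in> U" "\<And>n. C_diff_on n g U" "\<And>q. q \<in> {0..} \<inter> U \<Longrightarrow> \<phi> q = g q"
    using phi_smooth unfolding smooth_on_def by (metis atLeast_iff order_refl)
  have gd: "(g has_real_derivative frechet_derivative g (at 0) 1) (at 0)"
    using has_vector_derivative_frechet[of g 0] U(3)[of 1] U(2)
    by (simp add: has_real_derivative_iff_has_vector_derivative)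
  have lim: "((\<lambda>x. (g x - g 0) / (x - 0)) \<longlongrightarrow> frechet_derivative g (at 0) 1) (at_right 0)"
    using gd unfolding has_field_derivative_iff by (rule tendsto_within_subset) auto
  have "((\<lambda>x. (\<phi> x - x) /\<^sub>R x ^ 1 + 1) \<longlongrightarrow> 0 + 1) (at_right 0)"
    using phi_flat unfolding flat_at_0_def by (intro tendsto_add tendsto_const) blast
  moreover have "eventually (\<lambda>x. (\<phi> x - x) /\<^sub>R x ^ 1 + 1 = (g x - g 0) / (x - 0)) (at_right 0)"
  proof -
    have "eventually (\<lambda>x. x \<in> U) (at_right 0)"
      using eventually_at_topological U by blast
    moreover have "eventually (\<lambda>x::real. x > 0) (at_right 0)" by (rule eventually_at_right_less)
    ultimately show ?thesis
    proof eventually_elim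
      case (elim x)
      then show ?case using U(4)[of x] U(4)[of 0] U(2) phi_0 by (simp add: field_simps)
    qed
  qed
  ultimately have "((\<lambda>x. (g x - g 0) / (x - 0)) \<longlongrightarrow> 0 + 1) (at_right 0)"
    by (rule Lim_transform_eventually)
  then have "frechet_derivative g (at 0) 1 = 0 + 1"
    using lim by (intro tendsto_unique[OF trivial_limit_at_right_real])
  then show ?thesis using that[of U g] U by auto
qed

text \<open>Near \<open>0\<close> the leading coefficient \<open>\<phi>'\<^sup>k\<close> is close to \<open>1\<close>, so that the recursion contracts by
  roughly \<open>1 / \<bar>\<nu>\<bar>\<close>, and by induction its lower order terms tend to \<open>0\<close>.\<close>

theorem solution_extends_by_zero:
  fixes \<beta> :: "real \<Rightarrow> complex"
  assumes nu: "cmod \<nu> > 1" and smooth: "smooth_on {0<..} \<beta>"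
    and eq: "\<And>x. x > 0 \<Longrightarrow> \<beta> (\<phi> x) = \<nu> * \<beta> x"
  shows "smooth_on UNIV (\<lambda>x. if x > 0 then \<beta> x else 0)"
proof -
  obtain D where D0: "D 0 = \<beta>"
    and D: "\<And>k x. x > 0 \<Longrightarrow> (D k has_vector_derivative D (Suc k) x) (at x)"
    using smooth C_diff_on_real_iff[of "{0<..}" \<beta>] by (auto simp: smooth_on_open_iff)
  obtain U g where U: "open U" "0 \<in> U" and g: "\<And>n. C_diff_on n g U"
    "\<And>x. x \<in> U \<Longrightarrow> x \<ge> 0 \<Longrightarrow> \<phi> x = g x" and g1: "frechet_derivative g (at 0) 1 = (1::real)"
    using phi_extension by blast
  define dg where "dg = (\<lambda>x. frechet_derivative g (at x) 1)"
  have ev_U: "eventually (\<lambda>x. x \<in> U \<and> 0 < x) (at_right 0)"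
    using U by (intro eventually_conj eventually_at_right_less)
      (auto simp: eventually_at_topological)
  have lim_U: "(p \<longlongrightarrow> p 0) (at_right 0)" if "\<And>n. C_diff_on n p U" for p :: "real \<Rightarrow> real"
    using that[of 0] U by (auto simp: continuous_on_eq_continuous_at isCont_def intro: tendsto_within_subset)
  have "(D k \<longlongrightarrow> 0) (at_right 0)" for k
  proof (induction k rule: less_induct)
    case (less k)
    have eq0: "D 0 (\<phi> x) = \<nu> * D 0 x" if "x > 0" for x using eq[OF that] D0 by simp
    obtain P where P: "\<And>j n. C_diff_on n (P j) U" "\<And>x. P k x = dg x ^ k"
      "\<And>x. x \<in> U \<Longrightarrow> x > 0 \<Longrightarrow> \<nu> * D k x = (\<Sum>j\<le>k. P j x *\<^sub>R D j (\<phi> x))"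
      using derivative_recursion[of U g D \<nu> k, OF U(1) g D eq0] unfolding dg_def by blast
    define e where "e x = (\<Sum>j<k. P j x *\<^sub>R D j (\<phi> x))" for x
    have "(e \<longlongrightarrow> (\<Sum>j<k. P j 0 *\<^sub>R 0)) (at_right 0)"
      unfolding e_def
      by (intro tendsto_sum tendsto_scaleR lim_U P filterlim_compose[OF _ phi_at_right] less) auto
    then have "((\<lambda>x. norm (e x) / cmod \<nu>) \<longlongrightarrow> norm (0 :: complex) / cmod \<nu>) (at_right 0)"
      using nu by (intro tendsto_divide tendsto_norm) auto
    then have e0: "((\<lambda>x. norm (e x) / cmod \<nu>) \<longlongrightarrow> 0) (at_right 0)" by simp
    have "((\<lambda>x. \<bar>P k x\<bar>) \<longlongrightarrow> \<bar>P k 0\<bar>) (at_right 0)" by (intro tendsto_rabs lim_U P)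
    then have "((\<lambda>x. \<bar>P k x\<bar>) \<longlongrightarrow> 1) (at_right 0)" using P(2) g1 by (simp add: dg_def)
    then have "eventually (\<lambda>x. \<bar>P k x\<bar> < (1 + cmod \<nu>) / 2) (at_right 0)"
      by (rule order_tendstoD) (use nu in simp)
    then have "eventually (\<lambda>x. \<bar>P k x\<bar> < (1 + cmod \<nu>) / 2 \<and> x \<in> U) (at_right 0)"
      using ev_U by eventually_elim auto
    then obtain d where d: "d > 0"
      "\<And>x. 0 < x \<Longrightarrow> x < d \<Longrightarrow> \<bar>P k x\<bar> < (1 + cmod \<nu>) / 2 \<and> x \<in> U"
      by (auto simp: eventually_at_right_field)
    have "((\<lambda>x. norm (D k x)) \<longlongrightarrow> 0) (at_right 0)"
    proof (rule contraction_tendsto_0[of _ "((1 + cmod \<nu>) / 2) / cmod \<nu>" d "\<lambda>x. norm (e x) / cmod \<nu>"])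
      have "continuous_on {0<..} (D k)"
        using D by (meson continuous_at_imp_continuous_on greaterThan_iff has_vector_derivative_continuous)
      then show "continuous_on {0<..} (\<lambda>x. norm (D k x))" by (rule continuous_on_norm)
      fix x assume x: "0 < x" "x < d"
      have "\<nu> * D k x = e x + P k x *\<^sub>R D k (\<phi> x)"
        using P(3)[of x] d(2)[OF x] x by (simp add: e_def lessThan_Suc_atMost[symmetric])
      then have "cmod \<nu> * norm (D k x) \<le> norm (e x) + \<bar>P k x\<bar> * norm (D k (\<phi> x))"
        by (metis norm_mult norm_scaleR norm_triangle_ineq)
      also have "\<dots> \<le> norm (e x) + (1 + cmod \<nu>) / 2 * norm (D k (\<phi> x))"
        using d(2)[OF x] by (intro add_left_mono mult_right_mono) auto
      finally have "norm (D k x) \<le> (norm (e x) + (1 + cmod \<nu>) / 2 * norm (D k (\<phi> x))) / cmod \<nu>"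
        using nu by (subst pos_le_divide_eq) (auto simp: mult.commute)
      also have "\<dots> = (1 + cmod \<nu>) / 2 / cmod \<nu> * norm (D k (\<phi> x)) + norm (e x) / cmod \<nu>"
        by (metis (no_types) add.commute add_divide_distrib times_divide_eq_left)
      finally show "norm (D k x) \<le> \<dots>" .
    next
      show "(1 + cmod \<nu>) / 2 / cmod \<nu> < 1" using nu by (subst pos_divide_less_eq) (linarith, simp)
    qed (use nu d e0 in auto)
    then show ?case by (rule tendsto_norm_zero_cancel)
  qed
  then show ?thesis using smooth_extension_by_zero[of D, OF D] unfolding D0 by blast
qed

end

section \<open>The deck group\<close>

locale reeb = expanding_half \<phi> for \<phi> :: "real \<Rightarrow> real" +
  fixes lam mu :: complex
  assumes lam_ge: "cmod lam \<ge> cmod mu" and mu_gt: "cmod mu > 1"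
begin

lemma lam_gt: "cmod lam > 1" using lam_ge mu_gt by linarith

lemma lam_nz [simp]: "lam \<noteq> 0" and mu_nz [simp]: "mu \<noteq> 0"
  using lam_gt mu_gt by auto

text \<open>Integer iterates of \<open>\<phi>\<close> and of the generator of the deck group.\<close>

definition phz :: "int \<Rightarrow> real \<Rightarrow> real" where
  "phz k x = (if k \<ge> 0 then (\<phi> ^^ nat k) x else (\<psi> ^^ nat (- k)) x)"

definition Tz :: "int \<Rightarrow> pt \<Rightarrow> pt" where
  "Tz k p = (lam powi k * fst p, mu powi k * fst (snd p), phz k (snd (snd p)))"

lemma phz_nonneg: "x \<ge> 0 \<Longrightarrow> phz k x \<ge> 0"
  by (simp add: phz_def phi_pow_nonneg psi_pow_nonneg)

lemma phz_pos: "x > 0 \<Longrightarrow> phz k x > 0"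
  by (simp add: phz_def phi_pow_pos psi_pow_pos)

lemma phz_0 [simp]: "phz 0 x = x" by (simp add: phz_def)

lemma phz_at_0 [simp]: "phz k 0 = 0"
proof -
  have "(\<phi> ^^ n) 0 = 0" "(\<psi> ^^ n) 0 = 0" for n by (induction n) (auto simp: phi_0 psi_0)
  then show ?thesis by (simp add: phz_def)
qed

lemma phz_succ: assumes "x \<ge> 0" shows "phz (k + 1) x = \<phi> (phz k x)"
proof (cases "k \<ge> 0")
  case True
  then show ?thesis by (simp add: phz_def nat_add_distrib)
next
  case False
  define m where "m = nat (- k - 1)"
  have k: "k = - int m - 1" using False by (simp add: m_def)
  have "phz k x = \<psi> ((\<psi> ^^ m) x)" by (simp add: phz_def k nat_add_distrib)
  moreover have "phz (k + 1) x = (\<psi> ^^ m) x" by (cases m) (simp_all add: phz_def k nat_add_distrib)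
  ultimately show ?thesis using phi_psi psi_pow_nonneg assms by simp
qed

lemma phz_pred: "x \<ge> 0 \<Longrightarrow> phz (k - 1) x = \<psi> (phz k x)"
  using phz_succ[of x "k - 1"] psi_phi[OF phz_nonneg[of x "k - 1"]] by simp

lemma phz_add: assumes "x \<ge> 0" shows "phz (j + k) x = phz j (phz k x)"
proof (induction j rule: int_induct[where k = 0])
  case base
  then show ?case by simp
next
  case (step1 i)
  then show ?case using phz_succ[of x "i + k"] phz_succ[of "phz k x" i] assms phz_nonneg
    by (simp add: algebra_simps)
next
  case (step2 i)
  then show ?case using phz_pred[of x "i + k"] phz_pred[of "phz k x" i] assms phz_nonneg
    by (simp add: algebra_simps)
qed

lemma phz_1: "x \<ge> 0 \<Longrightarrow> phz 1 x = \<phi> x" using phz_succ[of x 0] by simp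

lemma phz_inj: "x \<ge> 0 \<Longrightarrow> y \<ge> 0 \<Longrightarrow> phz k x = phz k y \<Longrightarrow> x = y"
  using phz_add[of x "-k" k] phz_add[of y "-k" k] by simp

lemma phz_less: "0 \<le> x \<Longrightarrow> x < y \<Longrightarrow> phz k x < phz k y"
proof (induction k rule: int_induct[where k = 0])
  case (step1 i)
  then show ?case by (simp add: phz_succ phi_mono phz_nonneg)
next
  case (step2 i)
  then have "phz i x < phz i y" by simp
  then have "\<phi> (phz (i - 1) x) < \<phi> (phz (i - 1) y)"
    using phz_succ[of x "i - 1"] phz_succ[of y "i - 1"] step2.prems by simp
  then show ?case using phi_less_iff phz_nonneg step2.prems by simp
qed simp

lemma phz_ge: assumes "x > 0" "k \<ge> 0" shows "phz k x \<ge> x"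
  using assms(2)
proof (induction k rule: int_ge_induct)
  case (step i)
  then show ?case using phz_succ[of x i] phi_gt[OF phz_pos[OF assms(1)], of i] assms by simp
qed simp

lemma phz_smooth: "smooth_on {0..} (phz k)"
proof -
  have pow: "smooth_on {0..} (\<lambda>x. (h ^^ n) x)"
    if "smooth_on {0..} h" "\<And>x. x \<ge> 0 \<Longrightarrow> h x \<ge> 0" for h :: "real \<Rightarrow> real" and n
  proof -
    have nn: "(h ^^ n) x \<ge> 0" if "x \<ge> 0" for n x by (induction n) (use that \<open>\<And>x. x \<ge> 0 \<Longrightarrow> h x \<ge> 0\<close> in auto)
    show ?thesis
    proof (induction n)
      case (Suc n)
      have "smooth_on {0..} (\<lambda>x. h ((h ^^ n) x))"
        by (rule smooth_on_compose[OF Suc that(1)]) (use nn in auto)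
      then show ?case by simp
    qed (simp add: smooth_on_id)
  qed
  show ?thesis
    using pow[OF phi_smooth phi_nonneg, of "nat k"] pow[OF psi_smooth psi_nonneg, of "nat (- k)"]
    by (cases "k \<ge> 0") (simp_all add: phz_def[abs_def])
qed

subsection \<open>The action on the covering space\<close>

lemma Rt_iff: "p \<in> Rt \<longleftrightarrow> 0 \<le> height p \<and> p \<noteq> 0"
  by (cases p) (auto simp: Rt_def height_def zero_prod_def)

lemma height_Tz [simp]: "height (Tz k p) = phz k (height p)"
  by (simp add: Tz_def height_def)

lemma Tz_in_Rt: assumes "p \<in> Rt" shows "Tz k p \<in> Rt"
proof (cases p)
  case (fields z w x)
  then show ?thesis using assms phz_nonneg[of x k] phz_inj[of x 0 k]
    by (auto simp: Rt_def Tz_def)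
qed

lemma Tz_0 [simp]: "Tz 0 p = p" by (simp add: Tz_def)

lemma Tz_add: "p \<in> Rt \<Longrightarrow> Tz (j + k) p = Tz j (Tz k p)"
  by (simp add: Tz_def phz_add Rt_iff height_def power_int_add mult.assoc)

lemma Tz_minus: "p \<in> Rt \<Longrightarrow> Tz (- k) (Tz k p) = p" "p \<in> Rt \<Longrightarrow> Tz k (Tz (- k) p) = p"
  using Tz_add[of p "-k" k] Tz_add[of p k "-k"] by simp_all

lemma T_map_eq: "p \<in> Rt \<Longrightarrow> T_map lam mu \<phi> p = Tz 1 p"
  by (cases p) (simp add: T_map_def Tz_def phz_1 Rt_iff height_def)

lemma T_map_pow_eq: "p \<in> Rt \<Longrightarrow> (T_map lam mu \<phi> ^^ n) p = Tz (int n) p"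
proof (induction n)
  case (Suc n)
  then show ?case by (simp add: T_map_eq Tz_in_Rt flip: Tz_add)
qed simp

lemma Tz_smooth: "smooth_on Rt (Tz k)"
proof -
  have "smooth_on Rt (\<lambda>p. phz k (snd (snd p)))"
    by (rule smooth_on_compose[OF _ phz_smooth]) (auto intro!: smooth_on_intros simp: Rt_iff height_def)
  then show ?thesis unfolding Tz_def[abs_def] by (intro smooth_on_intros)
qed

lemma Tz_cont: "continuous_on Rt (Tz k)"
  by (rule smooth_on_imp_continuous_on[OF Tz_smooth])

abbreviation "pr \<equiv> proj_R lam mu \<phi>"

lemma mem_pr: assumes "p \<in> Rt" shows "q \<in> pr p \<longleftrightarrow> (\<exists>k. q = Tz k p)"
proof
  assume "q \<in> pr p"
  then obtain n where q: "q \<in> Rt" "q = (T_map lam mu \<phi> ^^ n) p \<or> p = (T_map lam mu \<phi> ^^ n) q"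
    unfolding proj_R_def by auto
  then show "\<exists>k. q = Tz k p"
    using T_map_pow_eq[OF assms, of n] T_map_pow_eq[OF q(1), of n] Tz_minus(1)[OF q(1), of "int n"] by metis
next
  assume "\<exists>k. q = Tz k p"
  then obtain k where k: "q = Tz k p" by auto
  then have q: "q \<in> Rt" using Tz_in_Rt[OF assms] by simp
  show "q \<in> pr p"
  proof (cases "k \<ge> 0")
    case True
    then have "q = (T_map lam mu \<phi> ^^ nat k) p" using k assms by (simp add: T_map_pow_eq)
    then show ?thesis using q unfolding proj_R_def by blast
  next
    case False
    then have "p = (T_map lam mu \<phi> ^^ nat (- k)) q"
      using k q assms by (simp add: T_map_pow_eq Tz_minus)
    then show ?thesis using q unfolding proj_R_def by blast
  qed
qed

lemma pr_self: "p \<in> Rt \<Longrightarrow> p \<in> pr p"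
  using mem_pr[of p p] Tz_0[of p] by metis

lemma pr_eq_iff: assumes "p \<in> Rt" "q \<in> Rt" shows "pr p = pr q \<longleftrightarrow> (\<exists>k. q = Tz k p)"
proof
  assume "pr p = pr q"
  then show "\<exists>k. q = Tz k p" using mem_pr[OF assms(1)] pr_self[OF assms(2)] by auto
next
  assume "\<exists>k. q = Tz k p"
  then obtain k where k: "q = Tz k p" by auto
  show "pr p = pr q"
  proof (intro equalityI subsetI)
    fix r assume "r \<in> pr p"
    then obtain j where "r = Tz j p" using mem_pr[OF assms(1)] by auto
    then have "r = Tz (j - k) q" using k assms Tz_add[of p "j - k" k] by simp
    then show "r \<in> pr q" using mem_pr[OF assms(2)] by auto
  next
    fix r assume "r \<in> pr q"
    then obtain j where "r = Tz j q" using mem_pr[OF assms(2)] by auto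
    then have "r = Tz (j + k) p" using k assms by (simp add: Tz_add)
    then show "r \<in> pr p" using mem_pr[OF assms(1)] by auto
  qed
qed

lemma pr_Tz: "p \<in> Rt \<Longrightarrow> pr (Tz k p) = pr p"
  using pr_eq_iff[of p "Tz k p"] Tz_in_Rt by metis

text \<open>Two points of the annulus of radii \<open>\<bar>z\<bar> / \<surd>\<bar>c\<bar>\<close> and \<open>\<bar>z\<bar> \<surd>\<bar>c\<bar>\<close> have moduli with ratio less than \<open>\<bar>c\<bar>\<close>.\<close>

lemma powi_norm_range:
  assumes c: "cmod c > 1" and z: "z \<noteq> 0"
    and 1: "cmod z / sqrt (cmod c) < cmod a" "cmod a < cmod z * sqrt (cmod c)"
    and 2: "cmod z / sqrt (cmod c) < cmod (c powi k * a)" "cmod (c powi k * a) < cmod z * sqrt (cmod c)"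
  shows "k = 0"
proof -
  define s where "s = sqrt (cmod c)"
  have s: "s > 1" "s * s = cmod c" using c by (auto simp: s_def)
  have sp: "cmod z < cmod a * s" "cmod z < cmod (c powi k * a) * s"
    using 1 2 s by (simp_all add: s_def[symmetric] pos_divide_less_eq)
  have pos: "cmod a > 0" using 1(1) s z by (smt (verit) divide_nonneg_nonneg norm_ge_zero s_def)
  have le: "cmod c \<le> cmod (c powi k)" if "k \<ge> 1" for k
    using power_increasing[of 1 "nat k" "cmod c"] c that by (simp add: norm_power power_int_def)
  consider "k \<ge> 1" | "k \<le> -1" | "k = 0" by linarith
  then show ?thesis
  proof cases
    case 1
    have "cmod z * s < cmod a * s * s" using sp s by simp
    also have "\<dots> = cmod a * cmod c" using s by (simp add: mult.assoc)
    also have "\<dots> \<le> cmod a * cmod (c powi k)" using le[OF 1] by (simp add: mult_left_mono)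
    also have "\<dots> < cmod z * s" using 2 by (simp add: s_def norm_mult mult.commute)
    finally show ?thesis .
  next
    case neg: 2
    have "c powi k * c powi (-k) = 1" using c by (subst power_int_add[symmetric]) auto
    then have ck: "cmod (c powi k) * cmod (c powi (-k)) = 1" by (metis norm_mult norm_one)
    have "cmod z * s < cmod (c powi k * a) * s * s" using sp s by simp
    also have "\<dots> = cmod (c powi k * a) * cmod c" using s by (simp add: mult.assoc)
    also have "\<dots> \<le> cmod (c powi k * a) * cmod (c powi (-k))" using le[of "-k"] neg by (simp add: mult_left_mono)
    also have "\<dots> = cmod a" using ck by (simp add: norm_mult algebra_simps)
    also have "\<dots> < cmod z * s" using 1 by (simp add: s_def)
    finally show ?thesis .
  qed simp
qed

text \<open>The deck group acts freely and properly discontinuously: off the axis an annulus in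
  one coordinate is displaced from itself, and over positive height an interval
  \<open>(a, \<phi> a)\<close> of heights is.\<close>

lemma properly_discontinuous:
  assumes a: "a \<in> Rt"
  obtains W where "open W" "a \<in> W" "\<And>q k. q \<in> W \<Longrightarrow> q \<in> Rt \<Longrightarrow> Tz k q \<in> W \<Longrightarrow> k = 0"
proof -
  obtain z w x where p: "a = (z, w, x)" by (cases a)
  have cont: "continuous_on UNIV (\<lambda>p. cmod (fst p))" "continuous_on UNIV (\<lambda>p. cmod (fst (snd p)))"
    "continuous_on UNIV (\<lambda>p. snd (snd p))" for p :: pt
    by (auto intro!: continuous_intros)
  consider "z \<noteq> 0" | "w \<noteq> 0" | "x > 0" using a p by (auto simp: Rt_def)
  then show ?thesis
  proof cases
    case 1
    let ?W = "{p :: pt. cmod (fst p) \<in> {cmod z / sqrt (cmod lam)<..<cmod z * sqrt (cmod lam)}}"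
    have "open ?W"
      using open_vimage[OF open_greaterThanLessThan cont(1)] by (simp add: vimage_def)
    moreover have "a \<in> ?W" using lam_gt 1 by (simp add: p field_simps)
    ultimately show ?thesis
      by (rule that) (use powi_norm_range[OF lam_gt 1] in \<open>auto simp: Tz_def\<close>)
  next
    case 2
    let ?W = "{p :: pt. cmod (fst (snd p)) \<in> {cmod w / sqrt (cmod mu)<..<cmod w * sqrt (cmod mu)}}"
    have "open ?W"
      using open_vimage[OF open_greaterThanLessThan cont(2)] by (simp add: vimage_def)
    moreover have "a \<in> ?W" using mu_gt 2 by (simp add: p field_simps)
    ultimately show ?thesis
      by (rule that) (use powi_norm_range[OF mu_gt 2] in \<open>auto simp: Tz_def\<close>)
  next
    case 3
    \<comment> \<open>Any \<open>c\<close> with \<open>\<psi> x < c < x\<close> satisfies \<open>c < x < \<phi> c\<close>.\<close>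
    define c where "c = (\<psi> x + x) / 2"
    have c: "0 < c" "\<psi> x < c" "c < x" using psi_pos[OF 3] psi_less[OF 3] by (auto simp: c_def)
    have c2: "x < \<phi> c" using phi_mono[of "\<psi> x" c] c psi_pos[OF 3] phi_psi[of x] 3 by simp
    let ?W = "{p :: pt. snd (snd p) \<in> {c<..<\<phi> c}}"
    have "open ?W"
      using open_vimage[OF open_greaterThanLessThan cont(3)] by (simp add: vimage_def)
    moreover have "a \<in> ?W" using c c2 by (simp add: p)
    moreover have "k = 0" if "q \<in> ?W" "q \<in> Rt" "Tz k q \<in> ?W" for q k
    proof -
      define y where "y = snd (snd q)"
      have y: "c < y" "y < \<phi> c" "c < phz k y" "phz k y < \<phi> c"
        using that by (auto simp: y_def Tz_def)
      consider "k \<ge> 1" | "k \<le> -1" | "k = 0" by linarith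
      then show ?thesis
      proof cases
        case 1
        have "\<phi> c < \<phi> y" using phi_mono y c by simp
        also have "\<phi> y \<le> phz (k - 1) (\<phi> y)" using phz_ge[of "\<phi> y" "k - 1"] phi_pos[of y] y c 1 by simp
        also have "\<dots> = phz k y" using phz_add[of y "k - 1" 1] phz_1[of y] y c by simp
        finally show ?thesis using y by simp
      next
        case 2
        have "phz k y < phz k (\<phi> c)" using phz_less y c by simp
        also have "\<dots> = phz (k + 1) c" using phz_add[of c k 1] phz_1[of c] c by simp
        also have "\<dots> \<le> phz (- k - 1) (phz (k + 1) c)" using phz_ge[of "phz (k + 1) c" "- k - 1"] phz_pos c 2 by simp
        also have "\<dots> = c" using phz_add[of c "- k - 1" "k + 1"] c by simp
        finally show ?thesis using y by simp
      qed simp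
    qed
    ultimately show ?thesis by (rule that)
  qed
qed

lemma Tz_free: "p \<in> Rt \<Longrightarrow> Tz j p = Tz k p \<Longrightarrow> j = k"
proof -
  assume p: "p \<in> Rt" and eq: "Tz j p = Tz k p"
  obtain W where W: "p \<in> W" "\<And>q k. q \<in> W \<Longrightarrow> q \<in> Rt \<Longrightarrow> Tz k q \<in> W \<Longrightarrow> k = 0"
    using properly_discontinuous[OF p] by metis
  have "Tz (j - k) p = p"
    using Tz_add[OF p, of "-k" j] Tz_minus(1)[OF p, of k] eq by (simp add: add.commute)
  then have "j - k = 0" using W(1) W(2)[of p "j - k"] p by simp
  then show "j = k" by simp
qed

end

section \<open>Topology of the covering space\<close>

text \<open>Reflecting negative heights retracts the punctured Euclidean space of dimension \<open>5\<close> onto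
  \<^const>\<open>Rt\<close>, which is therefore simply connected.\<close>

lemma Rt_retract: "Rt retract_of (- {0})"
proof -
  have "retraction (- {0}) Rt (\<lambda>p. (fst p, fst (snd p), \<bar>snd (snd p)\<bar>))"
    unfolding retraction_def
    by (auto simp: Rt_def zero_prod_def intro!: continuous_intros)
  then show ?thesis unfolding retract_of_def by blast
qed

lemma Rt_simply_connected: "simply_connected Rt"
  by (rule retract_of_simply_connected[OF simply_connected_punctured_universe Rt_retract]) simp

lemma Rt_locally_path_connected: "locally path_connected Rt"
  by (rule retract_of_locally_path_connected[OF open_imp_locally_path_connected Rt_retract])
    (rule open_Compl[OF closed_singleton])

lemma Rt_connected: "connected Rt"
  using Rt_simply_connected simply_connected_imp_connected by blast

lemma at_level_in_Rt: "at_level x w \<in> Rt \<longleftrightarrow> 0 < x \<or> x = 0 \<and> w \<noteq> 0"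
  by (cases w) (auto simp: at_level_def Rt_def zero_prod_def)

lemma leaf_domain: "{w. at_level x w \<in> Rt} = (if x > 0 then UNIV else if x = 0 then - {0} else {})"
  by (auto simp: at_level_in_Rt)

lemma open_leaf_domain: "open {w. at_level x w \<in> Rt}"
  unfolding leaf_domain by auto

lemma connected_leaf_domain: "connected {w. at_level x w \<in> Rt}"
  unfolding leaf_domain by (auto intro: connected_punctured_universe)

lemma cont_at_level: "continuous_on S (at_level x)"
  unfolding at_level_def[abs_def] by (intro continuous_intros)

lemma height_at_level [simp]: "height (at_level x w) = x"
  and proj_at_level [simp]: "proj_C2 (at_level x w) = w"
  by (simp_all add: height_def at_level_def proj_C2_def)

lemma at_level_proj: "height p = x \<Longrightarrow> at_level x (proj_C2 p) = p"
  by (auto simp: height_def at_level_def proj_C2_def)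

lemma leaf_t_eq: "leaf_t x = at_level x ` {w. at_level x w \<in> Rt}"
proof (intro equalityI subsetI)
  fix p assume "p \<in> leaf_t x"
  then have "p = at_level x (proj_C2 p)" "p \<in> Rt" by (simp_all add: leaf_t_def at_level_proj)
  then show "p \<in> at_level x ` {w. at_level x w \<in> Rt}" by (metis imageI mem_Collect_eq)
qed (auto simp: leaf_t_def)

lemma leaf_t_connected: "connected (leaf_t x)"
  unfolding leaf_t_eq by (intro connected_continuous_image cont_at_level connected_leaf_domain)

lemma base_in_leaf: "x \<ge> 0 \<Longrightarrow> (1, 0, x) \<in> leaf_t x"
  by (simp add: leaf_t_def Rt_def height_def)

lemma base_in_Rt: "x \<ge> 0 \<Longrightarrow> (1, 0, x) \<in> Rt"
  by (simp add: Rt_def)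

lemma leaf_tD: "p \<in> leaf_t x \<Longrightarrow> p \<in> Rt" "p \<in> leaf_t x \<Longrightarrow> height p = x"
  by (auto simp: leaf_t_def)

lemma height_nonneg: "p \<in> Rt \<Longrightarrow> height p \<ge> 0"
  by (auto simp: Rt_def height_def)

lemma cont_height: "continuous_on S height"
  unfolding height_def[abs_def] by (intro continuous_intros)

text \<open>A ball that misses the origin meets \<^const>\<open>Rt\<close> in a convex set.\<close>

lemma small_ball_connected:
  assumes "p \<in> Rt" "e \<le> norm p"
  shows "connected (ball p e \<inter> Rt)"
proof -
  have "0 \<notin> ball p e" using assms by (simp add: dist_norm)
  then have "ball p e \<inter> Rt = ball p e \<inter> {q. 0 \<le> height q}"
    by (auto simp: Rt_def height_def zero_prod_def)
  moreover have "convex {q. 0 \<le> height q}"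
    by (auto simp: convex_def height_def)
  ultimately show ?thesis by (simp add: convex_Int convex_connected)
qed


section \<open>Lifting maps of the Reeb component\<close>

context reeb
begin

text \<open>The deck transformation relating two lifts is locally constant, because the deck group acts
  properly discontinuously.\<close>

lemma lifts_differ_by_deck:
  fixes S :: "'x::topological_space set"
  assumes S: "connected S"
    and cont: "continuous_on S g" "continuous_on S h"
    and Rt: "\<And>s. s \<in> S \<Longrightarrow> g s \<in> Rt" "\<And>s. s \<in> S \<Longrightarrow> h s \<in> Rt"
    and eq: "\<And>s. s \<in> S \<Longrightarrow> pr (g s) = pr (h s)"
  shows "\<exists>k. \<forall>s\<in>S. h s = Tz k (g s)"
proof -
  define n where "n s = (SOME k. h s = Tz k (g s))" for s
  have n: "h s = Tz (n s) (g s)" if "s \<in> S" for s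
  proof -
    have "\<exists>k. h s = Tz k (g s)" using eq[OF that] pr_eq_iff Rt that by simp
    then show ?thesis unfolding n_def by (rule someI_ex)
  qed
  have "n constant_on S"
  proof (rule locally_constant_imp_constant[OF S])
    fix a assume a: "a \<in> S"
    obtain W where W: "open W" "g a \<in> W" "\<And>q k. q \<in> W \<Longrightarrow> q \<in> Rt \<Longrightarrow> Tz k q \<in> W \<Longrightarrow> k = 0"
      using properly_discontinuous[OF Rt(1)[OF a]] by metis
    have c: "continuous_on S (\<lambda>s. Tz (- n a) (h s))"
      by (rule continuous_on_compose2[OF Tz_cont cont(2)]) (use Rt in auto)
    let ?V = "(S \<inter> g -` W) \<inter> (S \<inter> (\<lambda>s. Tz (- n a) (h s)) -` W)"
    have "openin (top_of_set S) ?V"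
      by (intro openin_Int continuous_openin_preimage_gen cont c W)
    moreover have "a \<in> ?V" using a W n[OF a] Tz_minus(1)[OF Rt(1)[OF a]] by simp
    moreover have "n s = n a" if "s \<in> ?V" for s
    proof -
      have s: "s \<in> S" "g s \<in> W" "Tz (- n a) (h s) \<in> W" using that by auto
      then have "Tz (- n a + n s) (g s) \<in> W"
        using n[OF s(1)] Tz_add[OF Rt(1)[OF s(1)], of "- n a" "n s"] by metis
      then have "- n a + n s = 0" by (rule W(3)[OF s(2) Rt(1)[OF s(1)]])
      then show ?thesis by simp
    qed
    ultimately show "\<exists>T. openin (top_of_set S) T \<and> a \<in> T \<and> (\<forall>x\<in>T. n x = n a)" by blast
  qed
  then obtain k where "\<And>s. s \<in> S \<Longrightarrow> n s = k" by (auto simp: constant_on_def)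
  then show ?thesis using n by (intro exI[of _ k]) auto
qed

lemma lifts_agree:
  fixes S :: "'x::topological_space set"
  assumes S: "connected S"
    and cont: "continuous_on S g" "continuous_on S h"
    and Rt: "\<And>s. s \<in> S \<Longrightarrow> g s \<in> Rt" "\<And>s. s \<in> S \<Longrightarrow> h s \<in> Rt"
    and eq: "\<And>s. s \<in> S \<Longrightarrow> pr (g s) = pr (h s)"
    and a: "a \<in> S" "g a = h a" and s: "s \<in> S"
  shows "g s = h s"
proof -
  obtain k where k: "\<And>s. s \<in> S \<Longrightarrow> h s = Tz k (g s)"
    using lifts_differ_by_deck[OF S cont Rt eq] by blast
  have "Tz k (g a) = Tz 0 (g a)" using k[OF a(1)] a(2) by simp
  then have "k = 0" by (rule Tz_free[OF Rt(1)[OF a(1)]])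
  then show ?thesis using k[OF s] by simp
qed

text \<open>The graph of the relation \<open>f (pr p) = pr q\<close> is a covering of \<^const>\<open>Rt\<close>: over the domain of a
  local lift it splits into the graphs of its deck translates.\<close>

lemma covering_space_relation:
  assumes f: "smooth_R lam mu \<phi> f"
  shows "covering_space {(p, q). p \<in> Rt \<and> q \<in> Rt \<and> f (pr p) = pr q} fst Rt"
    (is "covering_space ?E fst Rt")
proof
  show "continuous_on ?E fst" by (intro continuous_intros)
  have loc: "\<exists>U L. open U \<and> p \<in> U \<and> continuous_on (U \<inter> Rt) L \<and>
     (\<forall>q\<in>U \<inter> Rt. L q \<in> Rt \<and> f (pr q) = pr (L q))" if "p \<in> Rt" for p
    using f that unfolding smooth_R_def by (metis smooth_on_imp_continuous_on)
  show "fst ` ?E = Rt"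
  proof (intro equalityI subsetI)
    fix p assume p: "p \<in> Rt"
    then obtain q where "q \<in> Rt" "f (pr p) = pr q" using loc[OF p] by blast
    then have "(p, q) \<in> ?E" using p by simp
    then show "p \<in> fst ` ?E" using imageI[of "(p, q)" ?E fst] by simp
  qed auto
  fix p assume "p \<in> Rt"
  then obtain U L where U: "open U" "p \<in> U" and Lc: "continuous_on (U \<inter> Rt) L"
    and L: "\<And>q. q \<in> U \<inter> Rt \<Longrightarrow> L q \<in> Rt" "\<And>q. q \<in> U \<inter> Rt \<Longrightarrow> f (pr q) = pr (L q)"
    using loc by metis
  define T where "T = U \<inter> Rt"
  \<comment> \<open>The sheets are the images of the sections \<open>\<sigma> k\<close>.\<close>
  define \<sigma> where "\<sigma> k q = (q, Tz k (L q))" for k q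
  have \<sigma>E: "\<sigma> k q \<in> ?E" if "q \<in> T" for k q
    using that L[of q] Tz_in_Rt[OF L(1)[of q]] pr_Tz[OF L(1)[of q]] by (simp add: \<sigma>_def T_def)
  have \<sigma>c: "continuous_on T (\<sigma> k)" for k
    unfolding \<sigma>_def T_def
    by (intro continuous_intros continuous_on_compose2[OF Tz_cont Lc]) (use L in auto)
  have sheet: "\<exists>k. e = \<sigma> k (fst e)" if "e \<in> ?E" "fst e \<in> T" for e
  proof -
    obtain a b where e: "e = (a, b)" by (cases e)
    have "pr (L a) = pr b" using that L(2)[of a] by (simp add: e T_def)
    then have "\<exists>k. b = Tz k (L a)" using that pr_eq_iff[of "L a" b] L(1)[of a] by (simp add: e T_def)
    then show ?thesis by (simp add: \<sigma>_def e)
  qed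
  show "\<exists>T. p \<in> T \<and> openin (top_of_set Rt) T \<and>
      (\<exists>v. \<Union> v = ?E \<inter> fst -` T \<and> (\<forall>u\<in>v. openin (top_of_set ?E) u) \<and> pairwise disjnt v \<and>
        (\<forall>u\<in>v. \<exists>q. homeomorphism u T fst q))"
  proof (intro exI conjI)
    show "p \<in> T" using U \<open>p \<in> Rt\<close> by (simp add: T_def)
    show "openin (top_of_set Rt) T" using U by (auto simp: T_def openin_open)
    show "\<Union> (range (\<lambda>k. \<sigma> k ` T)) = ?E \<inter> fst -` T"
    proof (intro equalityI subsetI)
      fix e assume "e \<in> \<Union> (range (\<lambda>k. \<sigma> k ` T))"
      then obtain k q where "q \<in> T" "e = \<sigma> k q" by auto
      then show "e \<in> ?E \<inter> fst -` T" using \<sigma>E[of q k] by (simp add: \<sigma>_def)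
    next
      fix e assume e: "e \<in> ?E \<inter> fst -` T"
      then obtain k where "e = \<sigma> k (fst e)" using sheet[of e] by auto
      moreover have "fst e \<in> T" using e by auto
      ultimately show "e \<in> \<Union> (range (\<lambda>k. \<sigma> k ` T))" by blast
    qed
    show "pairwise disjnt (range (\<lambda>k. \<sigma> k ` T))"
    proof (rule pairwiseI)
      fix u v assume uv: "u \<in> range (\<lambda>k. \<sigma> k ` T)" "v \<in> range (\<lambda>k. \<sigma> k ` T)" "u \<noteq> v"
      then obtain j k where jk: "u = \<sigma> j ` T" "v = \<sigma> k ` T" by blast
      show "disjnt u v"
      proof (rule ccontr)
        assume "\<not> disjnt u v"
        then obtain e where "e \<in> \<sigma> j ` T" "e \<in> \<sigma> k ` T" using jk unfolding disjnt_iff by blast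
        then obtain q r where "q \<in> T" "r \<in> T" "\<sigma> j q = \<sigma> k r" by (metis imageE)
        then have "q \<in> T" "Tz j (L q) = Tz k (L q)" by (auto simp: \<sigma>_def)
        then have "j = k" using Tz_free[OF L(1)] by (simp add: T_def)
        then show False using uv jk by simp
      qed
    qed
    show "\<forall>u\<in>range (\<lambda>k. \<sigma> k ` T). \<exists>q. homeomorphism u T fst q"
    proof
      fix u assume "u \<in> range (\<lambda>k. \<sigma> k ` T)"
      then obtain k where u: "u = \<sigma> k ` T" by blast
      have "homeomorphism u T fst (\<sigma> k)"
        by (rule homeomorphismI) (use \<sigma>c u in \<open>auto simp: \<sigma>_def intro!: continuous_intros\<close>)
      then show "\<exists>q. homeomorphism u T fst q" by blast
    qed
    show "\<forall>u\<in>range (\<lambda>k. \<sigma> k ` T). openin (top_of_set ?E) u"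
    proof
      fix u assume "u \<in> range (\<lambda>k. \<sigma> k ` T)"
      then obtain k where u: "u = \<sigma> k ` T" by blast
      show "openin (top_of_set ?E) u"
      proof (subst openin_subopen, rule ballI)
        fix e assume "e \<in> u"
        then obtain q where q: "q \<in> T" "e = \<sigma> k q" using u by blast
        have LqR: "L q \<in> Rt" using L q by (simp add: T_def)
        obtain W where W: "open W" "L q \<in> W" "\<And>q k. q \<in> W \<Longrightarrow> q \<in> Rt \<Longrightarrow> Tz k q \<in> W \<Longrightarrow> k = 0"
          using properly_discontinuous[OF LqR] by metis
        define N where "N = ?E \<inter> fst -` U"
        have N: "openin (top_of_set ?E) N"
          unfolding N_def by (intro continuous_openin_preimage_gen U continuous_intros)
        have Nc: "continuous_on N (\<lambda>e. L (fst e))" "continuous_on N (\<lambda>e. Tz (- k) (snd e))"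
          by (rule continuous_on_compose2[OF Lc], auto simp: N_def intro!: continuous_intros)
            (rule continuous_on_compose2[OF Tz_cont], auto intro!: continuous_intros)
        define M where "M = (N \<inter> (\<lambda>e. L (fst e)) -` W) \<inter> (N \<inter> (\<lambda>e. Tz (- k) (snd e)) -` W)"
        have "openin (top_of_set N) M"
          unfolding M_def by (intro openin_Int continuous_openin_preimage_gen Nc W)
        then have "openin (top_of_set ?E) M" using N by (rule openin_trans)
        moreover have "e \<in> M"
          using q \<sigma>E[OF q(1), of k] W LqR by (auto simp: M_def N_def \<sigma>_def Tz_minus T_def)
        moreover have "M \<subseteq> u"
        proof
          fix e assume "e \<in> M"
          then have e: "e \<in> ?E" "fst e \<in> U" "L (fst e) \<in> W" "Tz (- k) (snd e) \<in> W"
            by (auto simp: M_def N_def)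
          then have eT: "fst e \<in> T" by (auto simp: T_def)
          obtain m where m: "e = \<sigma> m (fst e)" using sheet[OF e(1) eT] by blast
          then have "snd e = Tz m (L (fst e))" by (metis \<sigma>_def snd_conv)
          then have "Tz (- k + m) (L (fst e)) \<in> W"
            using e(4) Tz_add[OF L(1)[of "fst e"], of "- k" m] eT by (simp add: T_def)
          moreover have "L (fst e) \<in> Rt" using L(1)[of "fst e"] eT by (simp add: T_def)
          ultimately have "- k + m = 0" using W(3)[OF e(3)] by blast
          then have "m = k" by simp
          then show "e \<in> u" using m u eT by blast
        qed
        ultimately show "\<exists>T. openin (top_of_set ?E) T \<and> e \<in> T \<and> T \<subseteq> u" by blast
      qed
    qed
  qed
qed

text \<open>A section of this covering is a lift of \<open>f\<close>, and sections exist because \<^const>\<open>Rt\<close> is simply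
  connected.\<close>

lemma continuous_lift_exists:
  assumes f: "smooth_R lam mu \<phi> f" and pq: "p \<in> Rt" "q \<in> Rt" "f (pr p) = pr q"
  obtains F where "continuous_on Rt F" "\<And>r. r \<in> Rt \<Longrightarrow> F r \<in> Rt" "F p = q"
    "\<And>r. r \<in> Rt \<Longrightarrow> pr (F r) = f (pr r)"
proof -
  let ?E = "{(p, q). p \<in> Rt \<and> q \<in> Rt \<and> f (pr p) = pr q}"
  have E: "(p, q) \<in> ?E" using pq by simp
  obtain g where g: "continuous_on Rt g" "g \<in> Rt \<rightarrow> ?E" "g p = (p, q)" "\<And>y. y \<in> Rt \<Longrightarrow> fst (g y) = y"
    by (rule covering_space_lift_strong[OF covering_space_relation[OF f] E pq(1)
          Rt_simply_connected Rt_locally_path_connected, of "\<lambda>x. x"]) auto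
  show ?thesis
  proof (rule that[of "\<lambda>r. snd (g r)"])
    show "continuous_on Rt (\<lambda>r. snd (g r))" using g(1) by (intro continuous_intros)
    fix r assume r: "r \<in> Rt"
    then have "g r \<in> ?E" using g(2) by (rule Pi_mem[rotated])
    then show "snd (g r) \<in> Rt" "pr (snd (g r)) = f (pr r)" using g(4)[OF r] by auto
  qed (simp add: g)
qed

end

section \<open>Lifts as a class of maps\<close>

lemma subgroup_BijGroupI:
  assumes "H \<subseteq> Bij S" "H \<noteq> {}" "\<And>f g. f \<in> H \<Longrightarrow> g \<in> H \<Longrightarrow> compose S f g \<in> H"
    and inv: "\<And>f. f \<in> H \<Longrightarrow> \<exists>g\<in>H. \<forall>x\<in>S. g (f x) = x"
  shows "subgroup H (BijGroup S)"
proof -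
  interpret group "BijGroup S" by (rule group_BijGroup)
  have mult: "f \<otimes>\<^bsub>BijGroup S\<^esub> g = compose S f g" if "f \<in> H" "g \<in> H" for f g
    using assms(1) that by (simp add: BijGroup_def subsetD)
  show ?thesis
  proof (rule subgroupI)
    show "H \<subseteq> carrier (BijGroup S)" using assms(1) by (simp add: BijGroup_def)
    show "f \<otimes>\<^bsub>BijGroup S\<^esub> g \<in> H" if "f \<in> H" "g \<in> H" for f g
      using assms(3)[OF that] mult[OF that] by simp
    fix f assume f: "f \<in> H"
    obtain g where g: "g \<in> H" "\<forall>x\<in>S. g (f x) = x" using inv[OF f] by blast
    have "compose S g f = (\<lambda>x\<in>S. x)" unfolding compose_def by (rule restrict_ext) (simp add: g(2))
    then have "g \<otimes>\<^bsub>BijGroup S\<^esub> f = \<one>\<^bsub>BijGroup S\<^esub>" using mult[OF g(1) f] by (simp add: BijGroup_def)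
    then have "inv\<^bsub>BijGroup S\<^esub> f = g"
      by (rule inv_equality) (use assms(1) f g(1) in \<open>simp_all add: BijGroup_def subsetD\<close>)
    then show "inv\<^bsub>BijGroup S\<^esub> f \<in> H" using g(1) by simp
  qed (rule assms(2))
qed

lemma holomorphic2_on_cong:
  assumes "open W" "\<And>w. w \<in> W \<Longrightarrow> F w = G w" "holomorphic2_on F W"
  shows "holomorphic2_on G W"
  unfolding holomorphic2_on_def
proof
  fix w assume w: "w \<in> W"
  then obtain D where D: "(F has_derivative D) (at w)" "\<And>c v. D (cscale c v) = cscale c (D v)"
    using assms(3) unfolding holomorphic2_on_def by metis
  have "(G has_derivative D) (at w)"
    by (rule has_derivative_transform_within_open[OF D(1) assms(1) w]) (use assms(2) in simp)
  then show "\<exists>D. (G has_derivative D) (at w) \<and> (\<forall>c v. D (cscale c v) = cscale c (D v))"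
    using D(2) by blast
qed

lemma leaf_holomorphic_t_cong:
  assumes "\<And>p. p \<in> Rt \<Longrightarrow> F p = G p" "leaf_holomorphic_t F x"
  shows "leaf_holomorphic_t G x"
  using assms(2) unfolding leaf_holomorphic_t_def
  by (rule holomorphic2_on_cong[OF open_leaf_domain, rotated]) (simp add: assms(1))

lemma holomorphic2_on_compose:
  assumes "holomorphic2_on F V" "holomorphic2_on G W" "\<And>v. v \<in> V \<Longrightarrow> F v \<in> W"
  shows "holomorphic2_on (\<lambda>v. G (F v)) V"
  unfolding holomorphic2_on_def
proof
  fix v assume v: "v \<in> V"
  obtain D where D: "(F has_derivative D) (at v)" "\<And>c u. D (cscale c u) = cscale c (D u)"
    using assms(1) v unfolding holomorphic2_on_def by metis
  obtain E where E: "(G has_derivative E) (at (F v))" "\<And>c u. E (cscale c u) = cscale c (E u)"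
    using assms(2) assms(3)[OF v] unfolding holomorphic2_on_def by metis
  have "((\<lambda>v. G (F v)) has_derivative (E \<circ> D)) (at v)"
    using diff_chain_at[OF D(1) E(1)] by (simp add: o_def)
  then show "\<exists>D. ((\<lambda>v. G (F v)) has_derivative D) (at v) \<and> (\<forall>c u. D (cscale c u) = cscale c (D u))"
    using D(2) E(2) by (intro exI[of _ "E \<circ> D"]) simp
qed

lemma holomorphic2_on_id: "holomorphic2_on (\<lambda>v. v) W"
  unfolding holomorphic2_on_def by (intro ballI exI[of _ "\<lambda>v. v"]) auto

context reeb
begin

text \<open>All properties of the lifts except invertibility. The height of \<open>F p\<close> is compared with that over
  the base point \<open>(1, 0)\<close> of the same leaf, so that leaves go to leaves.\<close>

definition equivariant :: "(pt \<Rightarrow> pt) \<Rightarrow> bool" where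
  "equivariant F \<longleftrightarrow> (\<forall>p\<in>Rt. F p \<in> Rt) \<and> smooth_on Rt F \<and>
     (\<forall>p\<in>Rt. height (F p) = height (F (1, 0, height p))) \<and> (\<forall>x\<ge>0. leaf_holomorphic_t F x) \<and>
     (\<forall>p\<in>Rt. F (Tz 1 p) = Tz 1 (F p)) \<and> (\<forall>p\<in>leaf_t 0. F p = p)"

lemma equivariantD:
  assumes "equivariant F"
  shows "p \<in> Rt \<Longrightarrow> F p \<in> Rt" "smooth_on Rt F"
    "p \<in> Rt \<Longrightarrow> height (F p) = height (F (1, 0, height p))"
    "x \<ge> 0 \<Longrightarrow> leaf_holomorphic_t F x" "p \<in> Rt \<Longrightarrow> F (Tz 1 p) = Tz 1 (F p)"
    "p \<in> leaf_t 0 \<Longrightarrow> F p = p"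
  using assms unfolding equivariant_def by simp_all

lemma equivariantI:
  assumes "\<And>p. p \<in> Rt \<Longrightarrow> F p \<in> Rt" "smooth_on Rt F"
    "\<And>p. p \<in> Rt \<Longrightarrow> height (F p) = \<eta> (height p)"
    "\<And>x. x \<ge> 0 \<Longrightarrow> leaf_holomorphic_t F x" "\<And>p. p \<in> Rt \<Longrightarrow> F (Tz 1 p) = Tz 1 (F p)"
    "\<And>p. p \<in> leaf_t 0 \<Longrightarrow> F p = p"
  shows "equivariant F"
proof -
  have "height (F p) = height (F (1, 0, height p))" if "p \<in> Rt" for p
    using assms(3)[OF that] assms(3)[OF base_in_Rt[OF height_nonneg[OF that]]]
    by (simp add: height_def)
  then show ?thesis unfolding equivariant_def using assms(1,2,4-) by simp
qed

definition lifts :: "(pt \<Rightarrow> pt) set" where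
  "lifts = {F \<in> Bij Rt. equivariant F \<and> equivariant (inv_into Rt F)}"

lemma equivariant_cong:
  assumes "\<And>p. p \<in> Rt \<Longrightarrow> F p = G p" "equivariant F"
  shows "equivariant G"
proof (rule equivariantI[where \<eta> = "\<lambda>x. height (F (1, 0, x))"])
  note F = equivariantD[OF assms(2)]
  show "smooth_on Rt G" using smooth_on_cong[OF F(2) assms(1)] .
  fix p assume p: "p \<in> Rt"
  show "G p \<in> Rt" using F(1)[OF p] assms(1)[OF p] by simp
  show "height (G p) = height (F (1, 0, height p))" using F(3)[OF p] assms(1)[OF p] by simp
  show "G (Tz 1 p) = Tz 1 (G p)" using F(5)[OF p] assms(1)[OF p] assms(1)[OF Tz_in_Rt[OF p]] by simp
next
  note F = equivariantD[OF assms(2)]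
  show "leaf_holomorphic_t G x" if "x \<ge> 0" for x using leaf_holomorphic_t_cong[OF assms(1) F(4)[OF that]] .
  show "G p = p" if "p \<in> leaf_t 0" for p using F(6)[OF that] assms(1)[OF leaf_tD(1)[OF that]] by simp
qed

lemma equivariant_compose:
  assumes "equivariant F" "equivariant G"
  shows "equivariant (\<lambda>p. F (G p))"
proof (rule equivariantI[where \<eta> = "\<lambda>x. height (F (1, 0, height (G (1, 0, x))))"])
  note F = equivariantD[OF assms(1)] and G = equivariantD[OF assms(2)]
  show "smooth_on Rt (\<lambda>p. F (G p))" by (rule smooth_on_compose[OF G(2) F(2) G(1)])
  show "F (G p) \<in> Rt" "height (F (G p)) = height (F (1, 0, height (G (1, 0, height p))))"
    "F (G (Tz 1 p)) = Tz 1 (F (G p))" if "p \<in> Rt" for p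
    using F(1)[OF G(1)[OF that]] F(3)[OF G(1)[OF that]] F(5)[OF G(1)[OF that]] G(3,5)[OF that] by simp_all
  show "F (G p) = p" if "p \<in> leaf_t 0" for p using F(6)[OF that] G(6)[OF that] by simp
  fix x :: real assume x: "x \<ge> 0"
  define y where "y = height (G (1, 0, x))"
  have y: "y \<ge> 0" using height_nonneg[OF G(1)[OF base_in_Rt[OF x]]] by (simp add: y_def)
  have lev: "at_level y (proj_C2 (G (at_level x w))) = G (at_level x w)" if "at_level x w \<in> Rt" for w
    by (rule at_level_proj) (use G(3)[OF that] in \<open>simp add: y_def\<close>)
  let ?V = "{w. at_level x w \<in> Rt}" and ?g = "\<lambda>w. proj_C2 (G (at_level x w))"
    and ?f = "\<lambda>w. proj_C2 (F (at_level y w))"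
  have "holomorphic2_on ?g ?V" using G(4)[OF x] by (simp add: leaf_holomorphic_t_def)
  moreover have "holomorphic2_on ?f {w. at_level y w \<in> Rt}"
    using F(4)[OF y] by (simp add: leaf_holomorphic_t_def)
  moreover have "?g w \<in> {w. at_level y w \<in> Rt}" if "w \<in> ?V" for w
    using that lev[of w] G(1)[of "at_level x w"] by simp
  ultimately have *: "holomorphic2_on (\<lambda>w. ?f (?g w)) ?V" by (rule holomorphic2_on_compose)
  show "leaf_holomorphic_t (\<lambda>p. F (G p)) x"
    unfolding leaf_holomorphic_t_def
    by (rule holomorphic2_on_cong[OF open_leaf_domain _ *]) (simp add: lev)
qed

lemma equivariant_id: "equivariant (\<lambda>p. p)"
  by (rule equivariantI[where \<eta> = "\<lambda>x. x"])
    (simp_all add: leaf_holomorphic_t_def smooth_on_id holomorphic2_on_id)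

lemma equivariant_Tz:
  assumes "equivariant F" "p \<in> Rt" shows "F (Tz k p) = Tz k (F p)"
proof -
  note F = equivariantD[OF assms(1)]
  show ?thesis
  proof (induction k rule: int_induct[where k = 0])
    case (step1 i)
    have "F (Tz (i + 1) p) = F (Tz 1 (Tz i p))" using Tz_add[of p 1 i] assms by (simp add: add.commute)
    also have "\<dots> = Tz 1 (Tz i (F p))" using F(5)[OF Tz_in_Rt[OF assms(2)]] step1 by simp
    also have "\<dots> = Tz (i + 1) (F p)" using Tz_add[of "F p" 1 i] F(1) assms by (simp add: add.commute)
    finally show ?case .
  next
    case (step2 i)
    have "Tz i (F p) = F (Tz 1 (Tz (i - 1) p))" using step2 Tz_add[of p 1 "i - 1"] assms by simp
    also have "\<dots> = Tz 1 (F (Tz (i - 1) p))" using F(5)[OF Tz_in_Rt[OF assms(2)]] .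
    finally have "Tz (- 1) (Tz i (F p)) = F (Tz (i - 1) p)"
      using Tz_minus(1)[OF F(1)[OF Tz_in_Rt[OF assms(2)]], of 1 "i - 1"] by simp
    then show ?case using Tz_add[OF F(1)[OF assms(2)], of "- 1" i] by simp
  qed simp
qed

lemma lifts_Bij: "F \<in> lifts \<Longrightarrow> F \<in> Bij Rt" and lifts_equivariant: "F \<in> lifts \<Longrightarrow> equivariant F"
  by (simp_all add: lifts_def)

lemma liftsI:
  assumes "equivariant F" "equivariant G" "F \<in> extensional Rt"
    and "\<And>p. p \<in> Rt \<Longrightarrow> G (F p) = p" "\<And>p. p \<in> Rt \<Longrightarrow> F (G p) = p"
  shows "F \<in> lifts"
proof -
  have Rt: "F p \<in> Rt" "G p \<in> Rt" if "p \<in> Rt" for p using assms(1,2) that by (auto intro: equivariantD)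
  have bij: "bij_betw F Rt Rt"
    by (rule bij_betw_byWitness[where f' = G]) (use assms Rt in auto)
  have "inv_into Rt F p = G p" if "p \<in> Rt" for p
    using bij_betw_inv_into_left[OF bij Rt(2)[OF that]] assms(5)[OF that] by simp
  then have "equivariant (inv_into Rt F)" using equivariant_cong[of G "inv_into Rt F"] assms(2) by simp
  then show ?thesis using assms bij by (simp add: lifts_def Bij_def)
qed

lemma lifts_inverse:
  assumes "F \<in> lifts"
  obtains G where "G \<in> lifts" "\<And>p. p \<in> Rt \<Longrightarrow> G (F p) = p" "\<And>p. p \<in> Rt \<Longrightarrow> F (G p) = p"
proof -
  define G where "G = restrict (inv_into Rt F) Rt"
  have bij: "bij_betw F Rt Rt" using lifts_Bij[OF assms] by (simp add: Bij_def)
  have FRt: "F p \<in> Rt" if "p \<in> Rt" for p using bij_betwE[OF bij] that by blast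
  have inv: "G (F p) = p" "F (G p) = p" if "p \<in> Rt" for p
    using bij_betw_inv_into_left[OF bij that] bij_betw_inv_into_right[OF bij that] FRt[OF that] that
    by (simp_all add: G_def)
  have "equivariant G"
    by (rule equivariant_cong[of "inv_into Rt F"]) (use assms in \<open>auto simp: G_def lifts_def\<close>)
  then have "G \<in> lifts"
    by (intro liftsI[of G F]) (use assms inv in \<open>auto simp: lifts_def G_def\<close>)
  then show ?thesis using that inv by blast
qed

lemma lifts_compose: assumes "F \<in> lifts" "G \<in> lifts" shows "compose Rt F G \<in> lifts"
proof -
  obtain F' where F': "F' \<in> lifts" "\<And>p. p \<in> Rt \<Longrightarrow> F' (F p) = p" "\<And>p. p \<in> Rt \<Longrightarrow> F (F' p) = p"
    using lifts_inverse[OF assms(1)] by blast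
  obtain G' where G': "G' \<in> lifts" "\<And>p. p \<in> Rt \<Longrightarrow> G' (G p) = p" "\<And>p. p \<in> Rt \<Longrightarrow> G (G' p) = p"
    using lifts_inverse[OF assms(2)] by blast
  have Rt: "F p \<in> Rt" "G p \<in> Rt" "F' p \<in> Rt" "G' p \<in> Rt" if "p \<in> Rt" for p
    using assms F'(1) G'(1) that by (auto intro: equivariantD lifts_equivariant)
  show ?thesis
  proof (rule liftsI[of _ "\<lambda>p. G' (F' p)"])
    show "equivariant (compose Rt F G)"
      by (rule equivariant_cong[OF _ equivariant_compose[OF assms[THEN lifts_equivariant]]])
        (simp add: compose_def)
    show "equivariant (\<lambda>p. G' (F' p))"
      by (rule equivariant_compose[OF lifts_equivariant[OF G'(1)] lifts_equivariant[OF F'(1)]])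
  qed (simp_all add: compose_def F' G' Rt)
qed

lemma lifts_id: "(\<lambda>p\<in>Rt. p) \<in> lifts"
  by (rule liftsI[of _ "\<lambda>p. p"]) (auto intro: equivariant_id equivariant_cong[OF _ equivariant_id])

lemma lifts_in_Aut_Rt:
  assumes F: "F \<in> lifts" shows "F \<in> carrier Aut_Rt"
proof -
  let ?G = "inv_into Rt F"
  have bij: "bij_betw F Rt Rt" using lifts_Bij[OF F] by (simp add: Bij_def)
  have FE: "equivariant F" "equivariant ?G" using F by (auto simp: lifts_def)
  have FRt: "F p \<in> Rt" "?G p \<in> Rt" if "p \<in> Rt" for p using FE that by (auto intro: equivariantD)
  have inv: "?G (F p) = p" "F (?G p) = p" if "p \<in> Rt" for p
    using bij_betw_inv_into_left[OF bij that] bij_betw_inv_into_right[OF bij that] by simp_all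
  define \<eta> \<theta> where "\<eta> x = height (F (1, 0, x))" and "\<theta> x = height (?G (1, 0, x))" for x
  have h: "\<forall>p\<in>Rt. height (F p) = \<eta> (height p)" "\<forall>p\<in>Rt. height (?G p) = \<theta> (height p)"
    using equivariantD(3)[OF FE(1)] equivariantD(3)[OF FE(2)] by (simp_all add: \<eta>_def \<theta>_def)
  have "\<exists>y\<ge>0. bij_betw F (leaf_t x) (leaf_t y) \<and> leaf_holomorphic_t F x \<and> leaf_holomorphic_t ?G y"
    if x: "x \<ge> 0" for x
  proof (intro exI[of _ "\<eta> x"] conjI)
    have b: "(1, 0, x) \<in> Rt" "height (1, 0, x) = x" using base_in_Rt[OF x] by (simp_all add: height_def)
    show y: "\<eta> x \<ge> 0" using h(1) FRt(1) b height_nonneg by metis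
    have th: "\<theta> (\<eta> x) = x" using h FRt(1) b inv(1) by metis
    show "bij_betw F (leaf_t x) (leaf_t (\<eta> x))"
      by (rule bij_betw_byWitness[where f' = ?G]) (use h FRt inv th in \<open>auto simp: leaf_t_def\<close>)
    show "leaf_holomorphic_t F x" "leaf_holomorphic_t ?G (\<eta> x)"
      using equivariantD(4)[OF FE(1) x] equivariantD(4)[OF FE(2) y] .
  qed
  then show ?thesis
    using lifts_Bij[OF F] equivariantD(2)[OF FE(1)] equivariantD(2)[OF FE(2)] by (simp add: Aut_Rt_def)
qed

end

section \<open>Automorphisms of the Reeb component\<close>

context reeb
begin

abbreviation "reebC \<equiv> Reeb lam mu \<phi>"
abbreviation "hopf \<equiv> Hopf lam mu \<phi>"
abbreviation "leafR \<equiv> leaf_R lam mu \<phi>"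
abbreviation "smoothR \<equiv> smooth_R lam mu \<phi>"
abbreviation "leaf_holR \<equiv> leaf_holomorphic_R lam mu \<phi>"
abbreviation "trv \<equiv> transverse lam mu \<phi>"

lemma leaf_holRE:
  assumes "leaf_holR f x y" "at_level x w \<in> Rt"
  obtains W L where "open W" "w \<in> W" "holomorphic2_on L W" "\<And>v. v \<in> W \<Longrightarrow> at_level x v \<in> Rt"
    "\<And>v. v \<in> W \<Longrightarrow> at_level y (L v) \<in> Rt"
    "\<And>v. v \<in> W \<Longrightarrow> f (pr (at_level x v)) = pr (at_level y (L v))"
proof -
  have "\<exists>W L. open W \<and> w \<in> W \<and> holomorphic2_on L W \<and>
        (\<forall>v\<in>W. at_level x v \<in> Rt \<and> at_level y (L v) \<in> Rt \<and>
           f (pr (at_level x v)) = pr (at_level y (L v)))" (is "\<exists>W L. ?P W L")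
    by (rule assms(1)[unfolded leaf_holomorphic_R_def, rule_format, OF assms(2)])
  then obtain W L where "?P W L" by (elim exE)
  then show ?thesis by (intro that[of W L]) simp_all
qed

lemma b0: "(1, 0, 0) \<in> leaf_t 0" "(1, 0, 0) \<in> Rt"
  using base_in_leaf[of 0] base_in_Rt[of 0] by auto

lemma Tz_leaf_0: "p \<in> leaf_t 0 \<Longrightarrow> Tz k p \<in> leaf_t 0"
  by (simp add: leaf_t_def Tz_in_Rt)

lemma leafR_subset: "leafR x \<subseteq> reebC"
  by (auto simp: leaf_R_def Reeb_def leaf_t_def)

text \<open>A map of the Reeb component that is the identity on the Hopf surface lifts to a map that is
  the identity over it. The heights on the image of a leaf form a countable connected set, and
  smoothness, holomorphy and equivariance follow from the uniqueness of lifts.\<close>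

lemma equivariant_lift_exists:
  assumes smooth: "smoothR f" and fix0: "\<And>P. P \<in> hopf \<Longrightarrow> f P = P"
    and leaf: "\<And>x. x \<ge> 0 \<Longrightarrow> \<exists>y\<ge>0. f ` leafR x \<subseteq> leafR y \<and> leaf_holR f x y"
  obtains F where "equivariant F" "\<And>p. p \<in> Rt \<Longrightarrow> pr (F p) = f (pr p)"
proof -
  have hp: "f (pr p) = pr p" if "p \<in> leaf_t 0" for p using fix0 that by (simp add: leaf_R_def)
  obtain F where Fc: "continuous_on Rt F" and FRt: "\<And>r. r \<in> Rt \<Longrightarrow> F r \<in> Rt"
    and F0: "F (1, 0, 0) = (1, 0, 0)" and Fpr: "\<And>r. r \<in> Rt \<Longrightarrow> pr (F r) = f (pr r)"
    using continuous_lift_exists[OF smooth b0(2) b0(2) hp[OF b0(1)]] by metis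
  have sub: "leaf_t x \<subseteq> Rt" for x using leaf_tD by blast
  have id0: "F p = p" if "p \<in> leaf_t 0" for p
    by (rule lifts_agree[OF leaf_t_connected, of 0 F "\<lambda>p. p"])
      (use b0 F0 Fpr FRt hp leaf_tD that in \<open>auto intro: continuous_on_subset[OF Fc sub] continuous_intros\<close>)
  have comm: "F (Tz 1 p) = Tz 1 (F p)" if p: "p \<in> Rt" for p
  proof (rule lifts_agree[OF Rt_connected _ _ _ _ _ b0(2) _ p])
    show "continuous_on Rt (\<lambda>p. F (Tz 1 p))"
      by (rule continuous_on_compose2[OF Fc Tz_cont]) (auto intro: Tz_in_Rt)
    show "continuous_on Rt (\<lambda>p. Tz 1 (F p))"
      by (rule continuous_on_compose2[OF Tz_cont Fc]) (auto intro: FRt)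
    show "F (Tz 1 (1, 0, 0)) = Tz 1 (F (1, 0, 0))" using id0[OF Tz_leaf_0[OF b0(1)]] F0 by simp
  qed (simp_all add: FRt Tz_in_Rt Fpr pr_Tz)
  have sm: "smooth_on Rt F"
  proof (rule smooth_on_local)
    fix p assume p: "p \<in> Rt"
    obtain U L where U: "open U" "p \<in> U" and L: "smooth_on (U \<inter> Rt) L"
      "\<And>q. q \<in> U \<inter> Rt \<Longrightarrow> L q \<in> Rt" "\<And>q. q \<in> U \<inter> Rt \<Longrightarrow> f (pr q) = pr (L q)"
      using smooth p unfolding smooth_R_def by metis
    obtain d where d: "d > 0" "ball p d \<subseteq> U" using U open_contains_ball by blast
    define e where "e = min d (norm p)"
    have e: "e > 0" "ball p e \<subseteq> U" "e \<le> norm p"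
      using d p by (auto simp: e_def Rt_iff)
    let ?S = "ball p e \<inter> Rt"
    have SU: "?S \<subseteq> U \<inter> Rt" using e by auto
    have "\<exists>k. \<forall>s\<in>?S. F s = Tz k (L s)"
    proof (rule lifts_differ_by_deck[OF small_ball_connected[OF p e(3)], of L F])
      show "continuous_on ?S L"
        by (rule continuous_on_subset[OF smooth_on_imp_continuous_on[OF L(1)] SU])
      show "continuous_on ?S F" by (rule continuous_on_subset[OF Fc]) auto
      show "L s \<in> Rt" "F s \<in> Rt" "pr (L s) = pr (F s)" if "s \<in> ?S" for s
        using SU that L(2)[of s] L(3)[of s] FRt[of s] Fpr[of s] by auto
    qed
    then obtain k where k: "\<And>s. s \<in> ?S \<Longrightarrow> F s = Tz k (L s)" by blast
    have "smooth_on ?S (\<lambda>s. Tz k (L s))"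
      by (rule smooth_on_compose[OF smooth_on_subset[OF L(1) SU] Tz_smooth]) (use L(2) SU in auto)
    then have "smooth_on ?S F" by (rule smooth_on_cong) (simp add: k)
    then have "smooth_on (Rt \<inter> ball p e) F" by (simp add: Int_commute)
    then show "\<exists>U. open U \<and> p \<in> U \<and> smooth_on (Rt \<inter> U) F"
      using e(1) by (intro exI[of _ "ball p e"]) auto
  qed
  have ht: "height (F p) = height (F (1, 0, height p))" if p: "p \<in> Rt" for p
  proof -
    define x where "x = height p"
    have x: "x \<ge> 0" using height_nonneg[OF p] by (simp add: x_def)
    \<comment> \<open>The leaf of the quotient lifts to the leaves at the heights \<open>phz k y\<close>.\<close>
    obtain y where y: "f ` leafR x \<subseteq> leafR y" using leaf[OF x] by blast
    have "height (F q) \<in> range (\<lambda>k. phz k y)" if q: "q \<in> leaf_t x" for q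
    proof -
      have "f (pr q) \<in> leafR y" using y q by (auto simp: leaf_R_def)
      then obtain r where r: "r \<in> leaf_t y" "f (pr q) = pr r" by (auto simp: leaf_R_def)
      then have "pr r = pr (F q)" using Fpr leaf_tD q by simp
      then obtain k where "F q = Tz k r" using pr_eq_iff leaf_tD r q FRt by metis
      then show ?thesis using leaf_tD(2)[OF r(1)] by simp
    qed
    then have "(\<lambda>q. height (F q)) ` leaf_t x \<subseteq> range (\<lambda>k. phz k y)" by blast
    then have cnt: "countable ((\<lambda>q. height (F q)) ` leaf_t x)"
      by (rule countable_subset) (rule countable_image, rule countableI_type)
    have conn: "connected ((\<lambda>q. height (F q)) ` leaf_t x)"
      by (intro connected_continuous_image leaf_t_connected continuous_on_compose2[OF cont_height]
          continuous_on_subset[OF Fc sub]) auto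
    have "p \<in> leaf_t x" using p by (simp add: leaf_t_def x_def)
    then have "height (F p) \<in> (\<lambda>q. height (F q)) ` leaf_t x"
      "height (F (1, 0, x)) \<in> (\<lambda>q. height (F q)) ` leaf_t x"
      using base_in_leaf[OF x] by blast+
    then show ?thesis using connected_uncountable[OF conn] cnt x_def by blast
  qed
  have hol: "leaf_holomorphic_t F x" if x: "x \<ge> 0" for x
    unfolding leaf_holomorphic_t_def holomorphic2_on_def
  proof
    fix w assume "w \<in> {w. at_level x w \<in> Rt}"
    then have w: "at_level x w \<in> Rt" by simp
    obtain y where y: "leaf_holR f x y" using leaf[OF x] by blast
    obtain W L where W: "open W" "w \<in> W" "holomorphic2_on L W"
      "\<And>v. v \<in> W \<Longrightarrow> at_level x v \<in> Rt" "\<And>v. v \<in> W \<Longrightarrow> at_level y (L v) \<in> Rt"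
      "\<And>v. v \<in> W \<Longrightarrow> f (pr (at_level x v)) = pr (at_level y (L v))"
      by (rule leaf_holRE[OF y w]) blast
    obtain e where e: "e > 0" "ball w e \<subseteq> W" using W open_contains_ball by blast
    have Lc: "continuous_on (ball w e) L"
    proof (rule continuous_at_imp_continuous_on, rule)
      fix v assume "v \<in> ball w e"
      then have "v \<in> W" using e by auto
      then obtain D where "(L has_derivative D) (at v)" using W(3) unfolding holomorphic2_on_def by metis
      then show "isCont L v" by (rule has_derivative_continuous)
    qed
    have "\<exists>k. \<forall>v\<in>ball w e. F (at_level x v) = Tz k (at_level y (L v))"
    proof (rule lifts_differ_by_deck[of "ball w e" "\<lambda>v. at_level y (L v)" "\<lambda>v. F (at_level x v)"])
      show "continuous_on (ball w e) (\<lambda>v. at_level y (L v))"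
        by (rule continuous_on_compose2[OF cont_at_level Lc]) auto
      show "continuous_on (ball w e) (\<lambda>v. F (at_level x v))"
        by (rule continuous_on_compose2[OF Fc cont_at_level]) (use W e in auto)
      show "at_level y (L v) \<in> Rt" "F (at_level x v) \<in> Rt"
        "pr (at_level y (L v)) = pr (F (at_level x v))" if "v \<in> ball w e" for v
        using W(4-6)[of v] FRt[OF W(4)[of v]] Fpr[OF W(4)[of v]] that e by auto
    qed (simp add: convex_connected)
    then obtain k where k: "\<And>v. v \<in> ball w e \<Longrightarrow> F (at_level x v) = Tz k (at_level y (L v))" by blast
    define \<delta> where "\<delta> u = (lam powi k * fst u, mu powi k * snd u)" for u :: "complex \<times> complex"
    have \<delta>: "(\<delta> has_derivative \<delta>) (at u)" for u
      unfolding \<delta>_def[abs_def] by (auto intro!: derivative_eq_intros)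
    obtain D where D: "(L has_derivative D) (at w)" "\<And>c v. D (cscale c v) = cscale c (D v)"
      using W(2,3) unfolding holomorphic2_on_def by metis
    have "((\<lambda>v. \<delta> (L v)) has_derivative (\<lambda>v. \<delta> (D v))) (at w)"
      using diff_chain_at[OF D(1) \<delta>] by (simp add: o_def)
    then have "((\<lambda>v. proj_C2 (F (at_level x v))) has_derivative (\<lambda>v. \<delta> (D v))) (at w)"
      by (rule has_derivative_transform_within_open[of _ _ _ _ "ball w e"])
        (use e in \<open>simp_all only: k, simp_all add: \<delta>_def proj_C2_def Tz_def at_level_def\<close>)
    moreover have "\<delta> (D (cscale c v)) = cscale c (\<delta> (D v))" for c v
      unfolding D(2) by (simp add: \<delta>_def cscale_def)
    ultimately show "\<exists>D. ((\<lambda>v. proj_C2 (F (at_level x v))) has_derivative D) (at w) \<and>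
      (\<forall>c v. D (cscale c v) = cscale c (D v))" by (intro exI[of _ "\<lambda>v. \<delta> (D v)"] conjI allI)
  qed
  have "equivariant F"
    by (rule equivariantI[where \<eta> = "\<lambda>x. height (F (1, 0, x))"]) (use FRt sm ht hol comm id0 in auto)
  then show ?thesis using that Fpr by blast
qed

text \<open>Descent to the quotient; equivariance makes the choice of a representative immaterial.\<close>

definition desc :: "(pt \<Rightarrow> pt) \<Rightarrow> pt set \<Rightarrow> pt set" where
  "desc F = (\<lambda>P\<in>reebC. pr (F (SOME p. p \<in> Rt \<and> pr p = P)))"

lemma desc_pr: assumes "equivariant F" "p \<in> Rt" shows "desc F (pr p) = pr (F p)"
proof -
  define q where "q = (SOME q. q \<in> Rt \<and> pr q = pr p)"
  have "q \<in> Rt \<and> pr q = pr p" unfolding q_def by (rule someI[of _ p]) (use assms in simp)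
  then have q: "q \<in> Rt" "pr q = pr p" by auto
  then obtain k where "p = Tz k q" using pr_eq_iff[OF q(1) assms(2)] by auto
  then have "F p = Tz k (F q)" using equivariant_Tz[OF assms(1) q(1)] by simp
  then have "pr (F p) = pr (F q)" using pr_Tz[OF equivariantD(1)[OF assms(1) q(1)]] by simp
  moreover have "pr p \<in> reebC" using assms by (simp add: Reeb_def)
  ultimately show ?thesis by (simp add: desc_def q_def)
qed

lemma reebE: assumes "P \<in> reebC" obtains p where "p \<in> Rt" "P = pr p"
  using assms by (auto simp: Reeb_def)

lemma pr_in_reeb: "p \<in> Rt \<Longrightarrow> pr p \<in> reebC" by (simp add: Reeb_def)

lemma desc_in_reeb: "equivariant F \<Longrightarrow> P \<in> reebC \<Longrightarrow> desc F P \<in> reebC"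
  by (elim reebE) (simp add: desc_pr pr_in_reeb equivariantD)

lemma desc_compose:
  assumes "equivariant F" "equivariant G"
  shows "compose reebC (desc F) (desc G) = desc (compose Rt F G)"
proof (rule extensionalityI[of _ reebC])
  fix P assume "P \<in> reebC"
  then obtain p where p: "p \<in> Rt" "P = pr p" by (rule reebE)
  have "equivariant (compose Rt F G)"
    by (rule equivariant_cong[OF _ equivariant_compose[OF assms]]) (simp add: compose_def)
  then show "compose reebC (desc F) (desc G) P = desc (compose Rt F G) P"
    using p assms by (simp add: compose_def desc_pr pr_in_reeb equivariantD)
qed (auto simp: desc_def)

lemma smooth_R_desc: assumes "equivariant F" shows "smoothR (desc F)"
  unfolding smooth_R_def
  using equivariantD[OF assms] desc_pr[OF assms]
  by (intro ballI exI[of _ UNIV] exI[of _ F]) auto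

lemma smooth_R_cong:
  assumes "\<And>P. P \<in> reebC \<Longrightarrow> f P = g P" "smoothR f"
  shows "smoothR g"
  unfolding smooth_R_def
proof
  fix p assume "p \<in> Rt"
  then obtain U F where UF: "open U" "p \<in> U" "smooth_on (U \<inter> Rt) F"
     "\<And>q. q \<in> U \<inter> Rt \<Longrightarrow> F q \<in> Rt \<and> f (pr q) = pr (F q)"
    using assms(2) unfolding smooth_R_def by metis
  have "F q \<in> Rt \<and> g (pr q) = pr (F q)" if "q \<in> U \<inter> Rt" for q
    using UF(4)[OF that] assms(1)[OF pr_in_reeb[of q]] that by auto
  then show "\<exists>U F. open U \<and> p \<in> U \<and> smooth_on (U \<inter> Rt) F \<and>
      (\<forall>q\<in>U \<inter> Rt. F q \<in> Rt \<and> g (pr q) = pr (F q))"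
    using UF(1-3) by (intro exI[of _ U] exI[of _ F]) simp
qed

lemma leaf_holomorphic_R_cong:
  assumes "\<And>P. P \<in> reebC \<Longrightarrow> f P = g P" "leaf_holR f x y"
  shows "leaf_holR g x y"
  unfolding leaf_holomorphic_R_def
proof (intro allI impI)
  fix w assume w: "at_level x w \<in> Rt"
  obtain W F where WF: "open W" "w \<in> W" "holomorphic2_on F W"
    "\<And>v. v \<in> W \<Longrightarrow> at_level x v \<in> Rt" "\<And>v. v \<in> W \<Longrightarrow> at_level y (F v) \<in> Rt"
    "\<And>v. v \<in> W \<Longrightarrow> f (pr (at_level x v)) = pr (at_level y (F v))"
    by (rule leaf_holRE[OF assms(2) w]) blast
  have "at_level x v \<in> Rt \<and> at_level y (F v) \<in> Rt \<and> g (pr (at_level x v)) = pr (at_level y (F v))"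
    if "v \<in> W" for v
    using WF(4-6)[OF that] assms(1)[OF pr_in_reeb[of "at_level x v"]] by simp
  then show "\<exists>W F. open W \<and> w \<in> W \<and> holomorphic2_on F W \<and>
        (\<forall>v\<in>W. at_level x v \<in> Rt \<and> at_level y (F v) \<in> Rt \<and>
           g (pr (at_level x v)) = pr (at_level y (F v)))"
    using WF(1-3) by (intro exI[of _ W] exI[of _ F]) simp
qed

lemma leaf_holomorphic_R_desc:
  assumes F: "equivariant F" and x: "x \<ge> 0" and y: "y = height (F (1, 0, x))"
  shows "leaf_holR (desc F) x y"
  unfolding leaf_holomorphic_R_def
proof (intro allI impI)
  fix w assume w: "at_level x w \<in> Rt"
  let ?W = "{w. at_level x w \<in> Rt}" and ?F = "\<lambda>w. proj_C2 (F (at_level x w))"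
  have "at_level y (?F v) = F (at_level x v)" if "v \<in> ?W" for v
    by (rule at_level_proj) (use equivariantD(3)[OF F, of "at_level x v"] that y in simp)
  then have "at_level y (?F v) \<in> Rt \<and> desc F (pr (at_level x v)) = pr (at_level y (?F v))"
    if "v \<in> ?W" for v
    using that equivariantD(1)[OF F, of "at_level x v"] desc_pr[OF F, of "at_level x v"] by simp
  moreover have "holomorphic2_on ?F ?W" using equivariantD(4)[OF F x] by (simp add: leaf_holomorphic_t_def)
  ultimately show "\<exists>W G. open W \<and> w \<in> W \<and> holomorphic2_on G W \<and>
      (\<forall>v\<in>W. at_level x v \<in> Rt \<and> at_level y (G v) \<in> Rt \<and>
         desc F (pr (at_level x v)) = pr (at_level y (G v)))"
    using w open_leaf_domain by (intro exI[of _ ?W] exI[of _ ?F]) simp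
qed

lemma leafR_phz: assumes "y \<ge> 0" shows "leafR (phz k y) = leafR y"
proof (intro equalityI subsetI)
  fix P assume "P \<in> leafR (phz k y)"
  then obtain q where q: "q \<in> leaf_t (phz k y)" "P = pr q" by (auto simp: leaf_R_def)
  have "Tz (- k) q \<in> leaf_t y"
    using q(1) phz_add[OF assms, of "- k" k] by (simp add: leaf_t_def Tz_in_Rt)
  moreover have "P = pr (Tz (- k) q)" using q pr_Tz[OF leaf_tD(1)[OF q(1)]] by simp
  ultimately show "P \<in> leafR y" by (simp add: leaf_R_def)
next
  fix P assume "P \<in> leafR y"
  then obtain q where q: "q \<in> leaf_t y" "P = pr q" by (auto simp: leaf_R_def)
  have "Tz k q \<in> leaf_t (phz k y)" using q(1) by (simp add: leaf_t_def Tz_in_Rt)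
  moreover have "P = pr (Tz k q)" using q pr_Tz[OF leaf_tD(1)[OF q(1)]] by simp
  ultimately show "P \<in> leafR (phz k y)" by (simp add: leaf_R_def)
qed

text \<open>The height that labels a leaf of the quotient is determined only up to iterates of \<open>\<phi>\<close>.\<close>

lemma leaf_holomorphic_R_phz:
  assumes "y \<ge> 0" "leaf_holR f (phz k y) x"
  shows "leaf_holR f y x"
  unfolding leaf_holomorphic_R_def
proof (intro allI impI)
  fix w assume w: "at_level y w \<in> Rt"
  define \<delta> where "\<delta> u = (lam powi k * fst u, mu powi k * snd u)" for u :: "complex \<times> complex"
  have \<delta>: "at_level (phz k y) (\<delta> u) = Tz k (at_level y u)" for u
    by (simp add: \<delta>_def at_level_def Tz_def)
  have \<delta>w: "at_level (phz k y) (\<delta> w) \<in> Rt" using w by (simp add: \<delta> Tz_in_Rt)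
  obtain W L where W: "open W" "\<delta> w \<in> W" "holomorphic2_on L W"
    "\<And>v. v \<in> W \<Longrightarrow> at_level (phz k y) v \<in> Rt" "\<And>v. v \<in> W \<Longrightarrow> at_level x (L v) \<in> Rt"
    "\<And>v. v \<in> W \<Longrightarrow> f (pr (at_level (phz k y) v)) = pr (at_level x (L v))"
    by (rule leaf_holRE[OF assms(2) \<delta>w]) blast
  have d: "(\<delta> has_derivative \<delta>) (at u)" for u
    unfolding \<delta>_def[abs_def] by (auto intro!: derivative_eq_intros)
  let ?W = "\<delta> -` W"
  have "open ?W"
    by (rule open_vimage[OF W(1)]) (auto intro!: continuous_intros simp: \<delta>_def[abs_def])
  moreover have "holomorphic2_on \<delta> ?W"
    unfolding holomorphic2_on_def
    by (intro ballI exI[of _ \<delta>] conjI d) (simp add: \<delta>_def cscale_def)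
  then have "holomorphic2_on (\<lambda>v. L (\<delta> v)) ?W" by (rule holomorphic2_on_compose[OF _ W(3)]) simp
  moreover have "at_level y v \<in> Rt \<and> at_level x (L (\<delta> v)) \<in> Rt \<and>
      f (pr (at_level y v)) = pr (at_level x (L (\<delta> v)))" if "v \<in> ?W" for v
  proof -
    have v: "\<delta> v \<in> W" using that by simp
    have "phz k y = 0 \<longleftrightarrow> y = 0" using phz_pos[of y k] assms(1) by fastforce
    moreover have "\<delta> 0 = 0" by (simp add: \<delta>_def zero_prod_def)
    ultimately have "at_level y v \<in> Rt"
      using W(4)[OF v] assms(1) by (auto simp: at_level_in_Rt)
    then show ?thesis using W(5,6)[OF v] by (simp add: \<delta> pr_Tz)
  qed
  ultimately show "\<exists>W L. open W \<and> w \<in> W \<and> holomorphic2_on L W \<and>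
        (\<forall>v\<in>W. at_level y v \<in> Rt \<and> at_level x (L v) \<in> Rt \<and>
           f (pr (at_level y v)) = pr (at_level x (L v)))"
    using W(2) by (intro exI[of _ ?W] exI[of _ "\<lambda>v. L (\<delta> v)"]) simp
qed

abbreviation "autRH \<equiv> Aut_RH lam mu \<phi>"

lemma autRH_iff: "f \<in> carrier autRH \<longleftrightarrow> f \<in> Bij reebC \<and>
    smoothR f \<and> smoothR (inv_into reebC f) \<and>
    (\<forall>x\<ge>0. \<exists>y\<ge>0. bij_betw f (leafR x) (leafR y) \<and> leaf_holR f x y \<and>
      leaf_holR (inv_into reebC f) y x) \<and> (\<forall>P\<in>hopf. f P = P)"
proof -
  have "restrict f hopf = (\<lambda>P\<in>hopf. P) \<longleftrightarrow> (\<forall>P\<in>hopf. f P = P)"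
  proof
    assume eq: "restrict f hopf = (\<lambda>P\<in>hopf. P)"
    show "\<forall>P\<in>hopf. f P = P"
    proof
      fix P assume "P \<in> hopf"
      then show "f P = P" using fun_cong[OF eq, of P] by simp
    qed
  qed (intro restrict_ext, simp)
  then show ?thesis
    by (simp add: Aut_RH_def kernel_def Aut_R_def Aut_H_def BijGroup_def conj_assoc)
qed

lemma autRH_mult:
  assumes "f \<in> carrier autRH" "g \<in> carrier autRH"
  shows "f \<otimes>\<^bsub>autRH\<^esub> g = compose reebC f g"
proof -
  have "f \<in> Bij reebC" "g \<in> Bij reebC" using assms by (simp_all add: autRH_iff)
  then show ?thesis by (simp add: Aut_RH_def Aut_R_def BijGroup_def)
qed

lemma desc_in_autRH:
  assumes F: "F \<in> lifts" shows "desc F \<in> carrier autRH"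
proof -
  obtain G where G: "G \<in> lifts" "\<And>p. p \<in> Rt \<Longrightarrow> G (F p) = p" "\<And>p. p \<in> Rt \<Longrightarrow> F (G p) = p"
    using lifts_inverse[OF F] by blast
  note FE = lifts_equivariant[OF F] and GE = lifts_equivariant[OF G(1)]
  note FD = equivariantD[OF FE] and GD = equivariantD[OF GE]
  have inv: "desc G (desc F P) = P" "desc F (desc G P) = P" if "P \<in> reebC" for P
    using that FD(1) GD(1) by (auto elim!: reebE simp: desc_pr FE GE G)
  have bij: "bij_betw (desc F) reebC reebC"
    by (rule bij_betw_byWitness[where f' = "desc G"]) (use inv FE GE desc_in_reeb in auto)
  have eq: "desc G P = inv_into reebC (desc F) P" if "P \<in> reebC" for P
    using bij_betw_inv_into_left[OF bij desc_in_reeb[OF GE that]] inv(2)[OF that] by simp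
  have "\<exists>y\<ge>0. bij_betw (desc F) (leafR x) (leafR y) \<and> leaf_holR (desc F) x y \<and>
      leaf_holR (inv_into reebC (desc F)) y x" if x: "x \<ge> 0" for x
  proof -
    define y where "y = height (F (1, 0, x))"
    have b: "(1, 0, x) \<in> Rt" using base_in_Rt[OF x] .
    have y: "y \<ge> 0" using height_nonneg[OF FD(1)[OF b]] by (simp add: y_def)
    have xy: "height (G (1, 0, y)) = x"
      using GD(3)[OF FD(1)[OF b]] G(2)[OF b] by (simp add: y_def height_def)
    have Fl: "F p \<in> leaf_t y" if "p \<in> leaf_t x" for p
      using FD(1)[OF leaf_tD(1)[OF that]] FD(3)[OF leaf_tD(1)[OF that]] leaf_tD(2)[OF that]
      by (simp add: leaf_t_def y_def)
    have Gl: "G p \<in> leaf_t x" if "p \<in> leaf_t y" for p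
      using GD(1)[OF leaf_tD(1)[OF that]] GD(3)[OF leaf_tD(1)[OF that]] leaf_tD(2)[OF that] xy
      by (simp add: leaf_t_def)
    have 1: "desc F P \<in> leafR y" if "P \<in> leafR x" for P
      using that Fl by (auto simp: leaf_R_def desc_pr[OF FE] leaf_tD)
    have 2: "desc G P \<in> leafR x" if "P \<in> leafR y" for P
      using that Gl by (auto simp: leaf_R_def desc_pr[OF GE] leaf_tD)
    have "bij_betw (desc F) (leafR x) (leafR y)"
    proof (rule bij_betw_byWitness[where f' = "desc G"])
      show "\<forall>P\<in>leafR x. desc G (desc F P) = P" by (intro ballI inv(1) subsetD[OF leafR_subset])
      show "\<forall>P\<in>leafR y. desc F (desc G P) = P" by (intro ballI inv(2) subsetD[OF leafR_subset])
    qed (use 1 2 in auto)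
    moreover have "leaf_holR (desc F) x y"
      using leaf_holomorphic_R_desc[OF FE x y_def] .
    moreover have "leaf_holR (inv_into reebC (desc F)) y x"
      using leaf_holomorphic_R_cong[OF eq leaf_holomorphic_R_desc[OF GE y xy[symmetric]]] .
    ultimately show ?thesis using y by blast
  qed
  moreover have "desc F P = P" if "P \<in> hopf" for P
    using that FD(6) by (auto simp: leaf_R_def desc_pr[OF FE] leaf_tD)
  moreover have "smoothR (inv_into reebC (desc F))"
    by (rule smooth_R_cong[OF eq smooth_R_desc[OF GE]])
  moreover have "desc F \<in> Bij reebC" using bij by (simp add: Bij_def desc_def)
  ultimately show ?thesis using smooth_R_desc[OF FE] unfolding autRH_iff by blast
qed

text \<open>The lifts of \<open>f\<close> and of its inverse are inverse to each other, because their composites lift the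
  identity and fix a point.\<close>

lemma desc_surj:
  assumes f: "f \<in> carrier autRH"
  obtains F where "F \<in> lifts" "f = desc F"
proof -
  let ?g = "inv_into reebC f"
  have fB: "f \<in> Bij reebC" and fs: "smoothR f" and gs: "smoothR ?g"
    and f0: "\<And>P. P \<in> hopf \<Longrightarrow> f P = P"
    and leaf: "\<And>x. x \<ge> 0 \<Longrightarrow> \<exists>y\<ge>0. bij_betw f (leafR x) (leafR y) \<and>
      leaf_holR f x y \<and> leaf_holR ?g y x"
    using f unfolding autRH_iff by blast+
  have bij: "bij_betw f reebC reebC" using fB by (simp add: Bij_def)
  have inv: "?g (f P) = P" "f (?g P) = P" "f P \<in> reebC" "?g P \<in> reebC" if "P \<in> reebC" for P
    using bij_betw_inv_into_left[OF bij that] bij_betw_inv_into_right[OF bij that]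
      bij_betwE[OF bij] bij_betwE[OF bij_betw_inv_into[OF bij]] that by blast+
  have lf: "\<exists>y\<ge>0. f ` leafR x \<subseteq> leafR y \<and> leaf_holR f x y" if "x \<ge> 0" for x
    using leaf[OF that] by (auto simp: bij_betw_def)
  obtain F where F: "equivariant F" "\<And>p. p \<in> Rt \<Longrightarrow> pr (F p) = f (pr p)"
    using equivariant_lift_exists[OF fs f0 lf] by blast
  have g0: "?g P = P" if "P \<in> hopf" for P
    using inv(1)[of P] f0[OF that] that leafR_subset[of 0] by auto
  have lg: "\<exists>x\<ge>0. ?g ` leafR y \<subseteq> leafR x \<and> leaf_holR ?g y x" if y: "y \<ge> 0" for y
  proof -
    define P where "P = ?g (pr (1, 0, y))"
    have "P \<in> reebC" using inv(4)[OF pr_in_reeb[OF base_in_Rt[OF y]]] by (simp add: P_def)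
    then obtain p where p: "p \<in> Rt" "P = pr p" by (rule reebE)
    define x where "x = height p"
    have x: "x \<ge> 0" using height_nonneg[OF p(1)] by (simp add: x_def)
    obtain y' where y': "y' \<ge> 0" "bij_betw f (leafR x) (leafR y')" "leaf_holR ?g y' x"
      using leaf[OF x] by blast
    have "p \<in> leaf_t x" using p by (simp add: leaf_t_def x_def)
    then have "P \<in> leafR x" using p by (simp add: leaf_R_def)
    then have "f P \<in> leafR y'" using y'(2) bij_betwE by blast
    then have "pr (1, 0, y) \<in> leafR y'"
      using inv(2)[OF pr_in_reeb[OF base_in_Rt[OF y]]] by (simp add: P_def)
    then obtain q where q: "q \<in> leaf_t y'" "pr (1, 0, y) = pr q" by (auto simp: leaf_R_def)
    then obtain k where k: "q = Tz k (1, 0, y)"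
      using pr_eq_iff[OF base_in_Rt[OF y] leaf_tD(1)[OF q(1)]] by auto
    have hy: "y' = phz k y" using leaf_tD(2)[OF q(1)] by (simp add: k height_def Tz_def)
    have "leafR y = leafR y'" unfolding hy by (rule leafR_phz[OF y, symmetric])
    moreover have "?g ` leafR y' \<subseteq> leafR x"
    proof (intro image_subsetI)
      fix Q assume "Q \<in> leafR y'"
      then have "Q \<in> f ` leafR x" using y'(2) by (simp add: bij_betw_def)
      then obtain S where S: "S \<in> leafR x" "Q = f S" by blast
      then show "?g Q \<in> leafR x" using inv(1)[of S] leafR_subset[of x] by auto
    qed
    moreover have "leaf_holR ?g y x"
      using leaf_holomorphic_R_phz[OF y] y'(3) unfolding hy by blast
    ultimately show ?thesis using x by blast
  qed
  obtain G where G: "equivariant G" "\<And>p. p \<in> Rt \<Longrightarrow> pr (G p) = ?g (pr p)"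
    using equivariant_lift_exists[OF gs g0 lg] by blast
  have id: "A (B p) = p" if A: "equivariant A" and B: "equivariant B" and p: "p \<in> Rt"
    and pr: "\<And>p. p \<in> Rt \<Longrightarrow> pr (A (B p)) = pr p" for A B p
  proof (rule lifts_agree[OF Rt_connected _ _ _ _ _ b0(2) _ p])
    have "equivariant (\<lambda>p. A (B p))" by (rule equivariant_compose[OF A B])
    then show "continuous_on Rt (\<lambda>p. A (B p))"
      using smooth_on_imp_continuous_on equivariantD(2) by blast
    show "A (B (1, 0, 0)) = (1, 0, 0)"
      using equivariantD(6)[OF A b0(1)] equivariantD(6)[OF B b0(1)] by simp
  qed (simp_all add: pr equivariantD[OF A] equivariantD[OF B])
  have FG: "F (G p) = p" if "p \<in> Rt" for p
    by (rule id[OF F(1) G(1) that])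
      (simp add: F(2) G(2) equivariantD(1)[OF G(1)] inv(2) pr_in_reeb)
  have GF: "G (F p) = p" if "p \<in> Rt" for p
    by (rule id[OF G(1) F(1) that])
      (simp add: F(2) G(2) equivariantD(1)[OF F(1)] inv(1) pr_in_reeb)
  define F' where "F' = restrict F Rt"
  have "equivariant F'" by (rule equivariant_cong[OF _ F(1)]) (simp add: F'_def)
  then have F': "F' \<in> lifts"
    by (rule liftsI[OF _ G(1)]) (use FG GF equivariantD(1)[OF G(1)] in \<open>auto simp: F'_def\<close>)
  have "f = desc F'"
  proof (rule extensionalityI[of _ reebC])
    show "f \<in> extensional reebC" using fB by (simp add: Bij_def)
    show "desc F' \<in> extensional reebC" by (simp add: desc_def)
    fix P assume "P \<in> reebC"
    then obtain p where p: "p \<in> Rt" "P = pr p" by (rule reebE)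
    then show "f P = desc F' P"
      using desc_pr[OF lifts_equivariant[OF F'] p(1)] F(2)[OF p(1)] by (simp add: F'_def)
  qed
  then show ?thesis using that F' by blast
qed


text \<open>Two lifts of the same automorphism agree at the boundary, hence everywhere.\<close>

lemma lift_R_desc: assumes F: "F \<in> lifts" shows "lift_R lam mu \<phi> (desc F) = F"
  unfolding lift_R_def
proof (rule the_equality)
  note FE = lifts_equivariant[OF F]
  note FD = equivariantD[OF FE]
  show "F \<in> carrier Aut_Rt \<and> (\<forall>p\<in>Rt. pr (F p) = desc F (pr p)) \<and>
      (\<forall>p\<in>Rt. F (T_map lam mu \<phi> p) = T_map lam mu \<phi> (F p)) \<and> (\<forall>p\<in>leaf_t 0. F p = p)"
    using lifts_in_Aut_Rt[OF F] FD by (simp add: desc_pr[OF FE] T_map_eq)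
  fix G
  assume G: "G \<in> carrier Aut_Rt \<and> (\<forall>p\<in>Rt. pr (G p) = desc F (pr p)) \<and>
      (\<forall>p\<in>Rt. G (T_map lam mu \<phi> p) = T_map lam mu \<phi> (G p)) \<and> (\<forall>p\<in>leaf_t 0. G p = p)"
  then have GB: "G \<in> Bij Rt" and Gs: "smooth_on Rt G" by (simp_all add: Aut_Rt_def)
  show "G = F"
  proof (rule extensionalityI[of _ Rt])
    show "G \<in> extensional Rt" "F \<in> extensional Rt" using GB lifts_Bij[OF F] by (simp_all add: Bij_def)
    fix p assume p: "p \<in> Rt"
    have GRt: "G q \<in> Rt" if "q \<in> Rt" for q using Bij_imp_funcset[OF GB] that by (rule Pi_mem)
    show "G p = F p"
      by (rule lifts_agree[OF Rt_connected smooth_on_imp_continuous_on[OF Gs]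
            smooth_on_imp_continuous_on[OF FD(2)] GRt FD(1) _ b0(2) _ p])
        (simp_all add: G desc_pr[OF FE] b0 FD(6)[OF b0(1)])
  qed
qed

lemma desc_inj: "F \<in> lifts \<Longrightarrow> G \<in> lifts \<Longrightarrow> desc F = desc G \<Longrightarrow> F = G"
  by (metis lift_R_desc)

lemma subgroup_lifts: "subgroup lifts (BijGroup Rt)"
proof (rule subgroup_BijGroupI)
  show "lifts \<subseteq> Bij Rt" using lifts_Bij by blast
  show "lifts \<noteq> {}" using lifts_id by blast
  show "\<exists>G\<in>lifts. \<forall>p\<in>Rt. G (F p) = p" if F: "F \<in> lifts" for F
  proof -
    obtain G where G: "G \<in> lifts" "\<And>p. p \<in> Rt \<Longrightarrow> G (F p) = p" "\<And>p. p \<in> Rt \<Longrightarrow> F (G p) = p"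
      using lifts_inverse[OF F] by blast
    show ?thesis by (intro bexI[OF _ G(1)] ballI G(2))
  qed
qed (rule lifts_compose)

text \<open>The group structure is transported from the lifts along \<^term>\<open>desc\<close>.\<close>

lemma autRH_group: "group autRH"
proof -
  let ?L = "(BijGroup Rt)\<lparr>carrier := lifts\<rparr>"
  interpret L: group ?L by (rule subgroup.subgroup_is_group[OF subgroup_lifts group_BijGroup])
  have im: "desc ` lifts = carrier autRH"
  proof (intro equalityI subsetI)
    fix f assume "f \<in> carrier autRH"
    then show "f \<in> desc ` lifts" by (rule desc_surj) auto
  qed (use desc_in_autRH in auto)
  have "desc \<in> hom ?L autRH"
  proof (rule homI)
    fix F G assume "F \<in> carrier ?L" "G \<in> carrier ?L"
    then have FG: "F \<in> lifts" "G \<in> lifts" by auto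
    have "F \<otimes>\<^bsub>?L\<^esub> G = compose Rt F G"
      using lifts_Bij[OF FG(1)] lifts_Bij[OF FG(2)] by (simp add: BijGroup_def)
    then show "desc (F \<otimes>\<^bsub>?L\<^esub> G) = desc F \<otimes>\<^bsub>autRH\<^esub> desc G"
      using FG autRH_mult desc_in_autRH desc_compose lifts_equivariant by simp
  qed (use desc_in_autRH in simp)
  then have "group (autRH \<lparr>carrier := desc ` carrier ?L, one := desc \<one>\<^bsub>?L\<^esub>\<rparr>)"
    by (rule L.hom_imp_img_group)
  moreover have "desc \<one>\<^bsub>?L\<^esub> = \<one>\<^bsub>autRH\<^esub>"
  proof (rule extensionalityI[of _ reebC])
    fix P assume "P \<in> reebC"
    then obtain p where p: "p \<in> Rt" "P = pr p" by (rule reebE)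
    then show "desc \<one>\<^bsub>?L\<^esub> P = \<one>\<^bsub>autRH\<^esub> P"
      using desc_pr[OF lifts_equivariant[OF lifts_id] p(1)] pr_in_reeb[OF p(1)]
      by (simp add: BijGroup_def Aut_RH_def Aut_R_def)
  qed (auto simp: desc_def Aut_RH_def Aut_R_def BijGroup_def)
  ultimately show ?thesis using im by simp
qed


section \<open>The transverse diffeomorphism\<close>

text \<open>The carrier of the centralizer, unfolded pointwise.\<close>

definition cen :: "(real \<Rightarrow> real) set" where
  "cen = {h \<in> Bij {0..}. smooth_on {0..} h \<and> smooth_on {0..} (inv_into {0..} h) \<and>
     (\<forall>x\<ge>0. h (\<phi> x) = \<phi> (h x))}"

lemma centralizer_eq: "centralizer_Diff \<phi> = (BijGroup {0..})\<lparr>carrier := cen\<rparr>"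
proof -
  have \<phi>: "\<phi> \<in> Bij {0..}" using phi_diff by (simp add: Diff_half_def)
  have "compose {0..} h \<phi> = compose {0..} \<phi> h \<longleftrightarrow> (\<forall>x\<ge>0. h (\<phi> x) = \<phi> (h x))" for h
  proof
    assume eq: "compose {0..} h \<phi> = compose {0..} \<phi> h"
    have "h (\<phi> x) = \<phi> (h x)" if "x \<ge> 0" for x
      using fun_cong[OF eq, of x] that by (simp add: compose_def)
    then show "\<forall>x\<ge>0. h (\<phi> x) = \<phi> (h x)" by blast
  next
    assume "\<forall>x\<ge>0. h (\<phi> x) = \<phi> (h x)"
    then show "compose {0..} h \<phi> = compose {0..} \<phi> h"
      unfolding compose_def by (intro restrict_ext) simp
  qed
  then show ?thesis
    using \<phi> by (auto simp: centralizer_Diff_def cen_def Diff_half_def BijGroup_def)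
qed

lemma cen_mult:
  assumes "h \<in> cen" "k \<in> cen" shows "h \<otimes>\<^bsub>centralizer_Diff \<phi>\<^esub> k = compose {0..} h k"
  using assms by (simp add: centralizer_eq BijGroup_def cen_def)

lemma cenI:
  assumes "smooth_on {0..} h" "smooth_on {0..} k" "h \<in> extensional {0..}"
    and "\<And>x. x \<ge> 0 \<Longrightarrow> h x \<ge> 0" "\<And>x. x \<ge> 0 \<Longrightarrow> k x \<ge> 0"
    and inv: "\<And>x. x \<ge> 0 \<Longrightarrow> k (h x) = x" "\<And>x. x \<ge> 0 \<Longrightarrow> h (k x) = x"
    and "\<And>x. x \<ge> 0 \<Longrightarrow> h (\<phi> x) = \<phi> (h x)"
  shows "h \<in> cen"
proof -
  have bij: "bij_betw h {0..} {0..}"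
    by (rule bij_betw_byWitness[where f' = k]) (use assms in auto)
  have "k x = inv_into {0..} h x" if "x \<in> {0..}" for x
    using bij_betw_inv_into_left[OF bij, of "k x"] assms(5)[of x] inv(2)[of x] that by simp
  then have "smooth_on {0..} (inv_into {0..} h)" using assms(2) smooth_on_cong by blast
  then show ?thesis using assms bij by (simp add: cen_def Bij_def)
qed

lemma cen_inverse:
  assumes h: "h \<in> cen"
  obtains k where "k \<in> cen" "\<And>x. x \<ge> 0 \<Longrightarrow> k (h x) = x" "\<And>x. x \<ge> 0 \<Longrightarrow> h (k x) = x"
proof -
  let ?k = "inv_into {0..} h"
  have bij: "bij_betw h {0..} {0..}" using h by (simp add: cen_def Bij_def)
  have nn: "h x \<ge> 0" "?k x \<ge> 0" if "x \<ge> 0" for x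
    using bij_betwE[OF bij] bij_betwE[OF bij_betw_inv_into[OF bij]] that by auto
  have inv: "?k (h x) = x" "h (?k x) = x" if "x \<ge> 0" for x
    using bij_betw_inv_into_left[OF bij] bij_betw_inv_into_right[OF bij] that by simp_all
  have com: "?k (\<phi> x) = \<phi> (?k x)" if x: "x \<ge> 0" for x
  proof -
    have "h (\<phi> (?k x)) = \<phi> x" using h nn(2)[OF x] inv(2)[OF x] by (simp add: cen_def)
    then show ?thesis using inv(1)[OF phi_nonneg[OF nn(2)[OF x]]] by simp
  qed
  have sm: "smooth_on {0..} h" "smooth_on {0..} ?k" using h by (simp_all add: cen_def)
  have "restrict ?k {0..} \<in> cen"
  proof (rule cenI[of _ h])
    show "smooth_on {0..} (restrict ?k {0..})" by (rule smooth_on_cong[OF sm(2)]) simp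
  qed (use sm nn inv com phi_nonneg in auto)
  then show ?thesis using that[of "restrict ?k {0..}"] nn inv by simp
qed

lemma cenD:
  assumes "h \<in> cen"
  shows "smooth_on {0..} h" "x \<ge> 0 \<Longrightarrow> h x \<ge> 0" "x \<ge> 0 \<Longrightarrow> h (\<phi> x) = \<phi> (h x)" "h \<in> extensional {0..}"
proof -
  have "bij_betw h {0..} {0..}" using assms by (simp add: cen_def Bij_def)
  then show "x \<ge> 0 \<Longrightarrow> h x \<ge> 0" using bij_betwE by fastforce
qed (use assms in \<open>auto simp: cen_def Bij_def\<close>)

text \<open>A diffeomorphism commuting with \<open>\<phi>\<close> permutes the fixed points of \<open>\<phi>\<close>.\<close>

lemma cen_0: assumes "h \<in> cen" shows "h 0 = 0"
  using cenD(3)[OF assms, of 0] cenD(2)[OF assms, of 0] phi_0 phi_gt[of "h 0"] by fastforce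

lemma subgroup_cen: "subgroup cen (BijGroup {0..})"
proof (rule subgroup_BijGroupI)
  show "cen \<subseteq> Bij {0..}" by (auto simp: cen_def)
  have "(\<lambda>x\<in>{0..}. x) \<in> cen"
  proof (rule cenI[of _ "\<lambda>x. x"])
    show "smooth_on {0..} (\<lambda>x::real\<in>{0..}. x)" by (rule smooth_on_cong[OF smooth_on_id]) simp
  qed (auto simp: smooth_on_id phi_nonneg)
  then show "cen \<noteq> {}" by blast
  show "\<exists>k\<in>cen. \<forall>x\<in>{0..}. k (h x) = x" if h: "h \<in> cen" for h
  proof -
    obtain k where "k \<in> cen" "\<And>x. x \<ge> 0 \<Longrightarrow> k (h x) = x" "\<And>x. x \<ge> 0 \<Longrightarrow> h (k x) = x"
      using cen_inverse[OF h] by blast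
    then show ?thesis by auto
  qed
  fix h k assume h: "h \<in> cen" and k: "k \<in> cen"
  obtain h' where h': "h' \<in> cen" "\<And>x. x \<ge> 0 \<Longrightarrow> h' (h x) = x" "\<And>x. x \<ge> 0 \<Longrightarrow> h (h' x) = x"
    using cen_inverse[OF h] by blast
  obtain k' where k': "k' \<in> cen" "\<And>x. x \<ge> 0 \<Longrightarrow> k' (k x) = x" "\<And>x. x \<ge> 0 \<Longrightarrow> k (k' x) = x"
    using cen_inverse[OF k] by blast
  note nn = cenD(2)[OF h] cenD(2)[OF k] cenD(2)[OF h'(1)] cenD(2)[OF k'(1)]
  show "compose {0..} h k \<in> cen"
  proof (rule cenI[of _ "\<lambda>x. k' (h' x)"])
    have "smooth_on {0..} (\<lambda>x. h (k x))"
      by (rule smooth_on_compose[OF cenD(1)[OF k] cenD(1)[OF h]]) (use nn in auto)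
    then show "smooth_on {0..} (compose {0..} h k)" by (rule smooth_on_cong) (simp add: compose_def)
    show "smooth_on {0..} (\<lambda>x. k' (h' x))"
      by (rule smooth_on_compose[OF cenD(1)[OF h'(1)] cenD(1)[OF k'(1)]]) (use nn in auto)
  qed (simp_all add: compose_def nn h' k' phi_nonneg cenD(3)[OF h] cenD(3)[OF k])
qed

lemma cen_group: "group (centralizer_Diff \<phi>)"
  unfolding centralizer_eq by (rule subgroup.subgroup_is_group[OF subgroup_cen group_BijGroup])

lemma transverse_desc:
  assumes F: "F \<in> lifts"
  shows "trv (desc F) = (\<lambda>x\<in>{0..}. height (F (1, 0, x)))"
  unfolding transverse_def lift_R_desc[OF F]
proof (rule the_equality)
  note FD = equivariantD[OF lifts_equivariant[OF F]]
  have "height (F p) = (\<lambda>x\<in>{0..}. height (F (1, 0, x))) (height p)" if "p \<in> Rt" for p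
    using FD(3)[OF that] height_nonneg[OF that] by simp
  then show "(\<lambda>x\<in>{0..}. height (F (1, 0, x))) \<in> extensional {0..} \<and>
      (\<forall>p\<in>Rt. height (F p) = (\<lambda>x\<in>{0..}. height (F (1, 0, x))) (height p))" by simp
  fix \<eta> assume \<eta>: "\<eta> \<in> extensional {0..} \<and> (\<forall>p\<in>Rt. height (F p) = \<eta> (height p))"
  show "\<eta> = (\<lambda>x\<in>{0..}. height (F (1, 0, x)))"
  proof (rule extensionalityI[of _ "{0..}"])
    fix x :: real assume "x \<in> {0..}"
    then show "\<eta> x = (\<lambda>x\<in>{0..}. height (F (1, 0, x))) x"
      using \<eta> base_in_Rt[of x] by (auto simp: height_def)
  qed (use \<eta> in auto)
qed

lemma transverse_in_cen:
  assumes F: "F \<in> lifts"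
  shows "(\<lambda>x\<in>{0..}. height (F (1, 0, x))) \<in> cen"
proof -
  obtain G where G: "G \<in> lifts" "\<And>p. p \<in> Rt \<Longrightarrow> G (F p) = p" "\<And>p. p \<in> Rt \<Longrightarrow> F (G p) = p"
    using lifts_inverse[OF F] by blast
  note FD = equivariantD[OF lifts_equivariant[OF F]] and GD = equivariantD[OF lifts_equivariant[OF G(1)]]
  have sm: "smooth_on {0..} (\<lambda>x. height (H (1, 0, x)))" if H: "equivariant H" for H
  proof -
    have "smooth_on {0..} (\<lambda>x. H (1, 0, x))"
      by (rule smooth_on_compose[OF _ equivariantD(2)[OF H]])
        (auto intro!: smooth_on_intros base_in_Rt)
    then show ?thesis unfolding height_def by (intro smooth_on_snd)
  qed
  have nn: "height (H (1, 0, x)) \<ge> 0" if "equivariant H" "x \<ge> 0" for H x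
    using height_nonneg[OF equivariantD(1)[OF that(1) base_in_Rt[OF that(2)]]] .
  show ?thesis
  proof (rule cenI[of _ "\<lambda>x. height (G (1, 0, x))"])
    show "smooth_on {0..} (\<lambda>x\<in>{0..}. height (F (1, 0, x)))"
      by (rule smooth_on_cong[OF sm[OF lifts_equivariant[OF F]]]) simp
    show "smooth_on {0..} (\<lambda>x. height (G (1, 0, x)))" by (rule sm[OF lifts_equivariant[OF G(1)]])
    fix x :: real assume x: "x \<ge> 0"
    note b = base_in_Rt[OF x]
    show "(\<lambda>x\<in>{0..}. height (F (1, 0, x))) x \<ge> 0" "height (G (1, 0, x)) \<ge> 0"
      using nn lifts_equivariant F G(1) x by auto
    show "height (G (1, 0, (\<lambda>x\<in>{0..}. height (F (1, 0, x))) x)) = x"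
      using GD(3)[OF FD(1)[OF b]] G(2)[OF b] x by (simp add: height_def)
    show "(\<lambda>x\<in>{0..}. height (F (1, 0, x))) (height (G (1, 0, x))) = x"
      using FD(3)[OF GD(1)[OF b]] G(3)[OF b] nn[OF lifts_equivariant[OF G(1)] x] by (simp add: height_def)
    have "height (F (1, 0, \<phi> x)) = height (F (Tz 1 (1, 0, x)))"
      using FD(3)[OF Tz_in_Rt[OF b, of 1]] phz_1[OF x] by (simp add: height_def Tz_def)
    also have "\<dots> = \<phi> (height (F (1, 0, x)))"
      using FD(5)[OF b] phz_1[OF nn[OF lifts_equivariant[OF F] x]] by simp
    finally show "(\<lambda>x\<in>{0..}. height (F (1, 0, x))) (\<phi> x) = \<phi> ((\<lambda>x\<in>{0..}. height (F (1, 0, x))) x)"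
      using x phi_nonneg[OF x] by simp
  qed simp
qed

lemma transverse_hom: "trv \<in> hom autRH (centralizer_Diff \<phi>)"
proof (rule homI)
  fix f assume "f \<in> carrier autRH"
  then obtain F where "F \<in> lifts" "f = desc F" by (rule desc_surj)
  then show "trv f \<in> carrier (centralizer_Diff \<phi>)"
    using transverse_desc transverse_in_cen by (simp add: centralizer_eq)
next
  fix f g assume f: "f \<in> carrier autRH" and g: "g \<in> carrier autRH"
  obtain F where F: "F \<in> lifts" "f = desc F" using f by (rule desc_surj)
  obtain G where G: "G \<in> lifts" "g = desc G" using g by (rule desc_surj)
  note FD = equivariantD[OF lifts_equivariant[OF F(1)]] and GD = equivariantD[OF lifts_equivariant[OF G(1)]]
  have fg: "f \<otimes>\<^bsub>autRH\<^esub> g = desc (compose Rt F G)"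
    using autRH_mult[OF f g] desc_compose lifts_equivariant F G by simp
  have "trv (f \<otimes>\<^bsub>autRH\<^esub> g) = (\<lambda>x\<in>{0..}. height (F (G (1, 0, x))))"
    unfolding fg transverse_desc[OF lifts_compose[OF F(1) G(1)]]
    by (rule restrict_ext) (simp add: compose_def base_in_Rt)
  also have "\<dots> = compose {0..} (\<lambda>x\<in>{0..}. height (F (1, 0, x))) (\<lambda>x\<in>{0..}. height (G (1, 0, x)))"
    unfolding compose_def
  proof (rule restrict_ext)
    fix x :: real assume "x \<in> {0..}"
    then have x: "x \<ge> 0" by simp
    note b = base_in_Rt[OF x]
    show "height (F (G (1, 0, x))) =
        (\<lambda>x\<in>{0..}. height (F (1, 0, x))) ((\<lambda>x\<in>{0..}. height (G (1, 0, x))) x)"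
      using FD(3)[OF GD(1)[OF b]] height_nonneg[OF GD(1)[OF b]] x by simp
  qed
  also have "\<dots> = trv f \<otimes>\<^bsub>centralizer_Diff \<phi>\<^esub> trv g"
    using F G cen_mult transverse_in_cen transverse_desc by simp
  finally show "trv (f \<otimes>\<^bsub>autRH\<^esub> g) =
    trv f \<otimes>\<^bsub>centralizer_Diff \<phi>\<^esub> trv g" .
qed

text \<open>Acting on the height alone splits the extension.\<close>

lemma product_equivariant:
  assumes h: "h \<in> cen"
  shows "equivariant (\<lambda>p. (fst p, fst (snd p), h (snd (snd p))))"
proof (rule equivariantI[where \<eta> = h])
  have pos: "h x > 0" if "x > 0" for x
  proof -
    obtain k where k: "k \<in> cen" "\<And>x. x \<ge> 0 \<Longrightarrow> k (h x) = x" "\<And>x. x \<ge> 0 \<Longrightarrow> h (k x) = x"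
      using cen_inverse[OF h] by blast
    then have "h x \<noteq> 0" using k(2)[of x] cen_0[OF k(1)] that by fastforce
    then show ?thesis using cenD(2)[OF h, of x] that by simp
  qed
  show "smooth_on Rt (\<lambda>p. (fst p, fst (snd p), h (snd (snd p))))"
    by (intro smooth_on_intros smooth_on_compose[OF _ cenD(1)[OF h]])
      (auto simp: Rt_def)
  fix p assume p: "p \<in> Rt"
  then have x: "snd (snd p) \<ge> 0" by (auto simp: Rt_def)
  show "(fst p, fst (snd p), h (snd (snd p))) \<in> Rt"
    using p x cenD(2)[OF h x] pos[of "snd (snd p)"] by (cases p) (auto simp: Rt_def)
  show "(fst (Tz 1 p), fst (snd (Tz 1 p)), h (snd (snd (Tz 1 p)))) =
    Tz 1 (fst p, fst (snd p), h (snd (snd p)))"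
    using cenD(3)[OF h x] phz_1[OF x] phz_1[OF cenD(2)[OF h x]] by (simp add: Tz_def)
next
  show "leaf_holomorphic_t (\<lambda>p. (fst p, fst (snd p), h (snd (snd p)))) x" for x
    by (simp add: leaf_holomorphic_t_def proj_C2_def at_level_def holomorphic2_on_id)
  show "(fst p, fst (snd p), h (snd (snd p))) = p" if "p \<in> leaf_t 0" for p
    using leaf_tD(2)[OF that] cen_0[OF h] by (cases p) (simp add: height_def)
qed (simp add: height_def)

lemma product_lift:
  assumes h: "h \<in> cen"
  shows "(\<lambda>p\<in>Rt. (fst p, fst (snd p), h (snd (snd p)))) \<in> lifts"
proof -
  obtain k where k: "k \<in> cen" "\<And>x. x \<ge> 0 \<Longrightarrow> k (h x) = x" "\<And>x. x \<ge> 0 \<Longrightarrow> h (k x) = x"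
    using cen_inverse[OF h] by blast
  have nn: "snd (snd p) \<ge> 0" if "p \<in> Rt" for p using that by (auto simp: Rt_def)
  show ?thesis
  proof (rule liftsI[OF _ product_equivariant[OF k(1)]])
    show "equivariant (\<lambda>p\<in>Rt. (fst p, fst (snd p), h (snd (snd p))))"
      by (rule equivariant_cong[OF _ product_equivariant[OF h]]) simp
    fix p assume p: "p \<in> Rt"
    show "(\<lambda>p\<in>Rt. (fst p, fst (snd p), h (snd (snd p)))) (fst p, fst (snd p), k (snd (snd p))) = p"
      using equivariantD(1)[OF product_equivariant[OF k(1)] p] k(3)[OF nn[OF p]] by simp
  qed (simp_all add: k nn)
qed

lemma transverse_surj: "trv ` carrier autRH = carrier (centralizer_Diff \<phi>)"
proof (rule equalityI)
  show "trv ` carrier autRH \<subseteq> carrier (centralizer_Diff \<phi>)"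
    by (rule hom_carrier[OF transverse_hom])
  show "carrier (centralizer_Diff \<phi>) \<subseteq> trv ` carrier autRH"
  proof
    fix h assume "h \<in> carrier (centralizer_Diff \<phi>)"
    then have h: "h \<in> cen" by (simp add: centralizer_eq)
    let ?F = "\<lambda>p\<in>Rt. (fst p, fst (snd p), h (snd (snd p)))"
    have "trv (desc ?F) = (\<lambda>x\<in>{0..}. h x)"
      unfolding transverse_desc[OF product_lift[OF h]]
      by (rule restrict_ext) (simp add: base_in_Rt height_def)
    then have "h = trv (desc ?F)"
      using cenD(4)[OF h] by (simp add: extensional_restrict)
    then show "h \<in> trv ` carrier autRH"
      by (rule image_eqI[OF _ desc_in_autRH[OF product_lift[OF h]]])
  qed
qed

lemma transverse_extension:
  "group_extension (K_group lam mu \<phi>) (\<lambda>f. f) autRH trv (centralizer_Diff \<phi>)"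
proof -
  interpret group_hom autRH "centralizer_Diff \<phi>" trv
    using autRH_group cen_group transverse_hom by (simp add: group_hom_def group_hom_axioms_def)
  have "group (K_group lam mu \<phi>)"
    unfolding K_group_def by (rule subgroup.subgroup_is_group[OF subgroup_kernel autRH_group])
  moreover have "(\<lambda>f. f) \<in> mon (K_group lam mu \<phi>) autRH"
    by (auto simp: mon_def hom_def K_group_def kernel_def)
  moreover have "trv \<in> epi autRH (centralizer_Diff \<phi>)"
    using transverse_hom transverse_surj by (simp add: epi_def)
  ultimately show ?thesis
    using autRH_group cen_group by (simp add: group_extension_def K_group_def)
qed

end

section \<open>Entire functions along backward orbits\<close>

lemma sphere_bound_higher_deriv_0:
  assumes "f holomorphic_on UNIV" "\<And>w. cmod w = 1 \<Longrightarrow> cmod (f w) \<le> B"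
  shows "cmod ((deriv ^^ i) f 0) \<le> fact i * B"
  using Cauchy_inequality[of f 0 1 B i] assms
  by (auto simp: norm_minus_commute intro: holomorphic_on_subset holomorphic_on_imp_continuous_on)

text \<open>Rescaling by \<open>\<sigma>\<close> multiplies the \<open>i\<close>-th Taylor coefficient by \<open>\<sigma>\<^sup>i\<close>. If the values are
  multiplied by a factor of at most that size while the functions become small on the unit circle,
  the Cauchy estimate leaves no room for the coefficient.\<close>

lemma rescaled_coefficient_vanishes:
  fixes u :: "nat \<Rightarrow> complex \<Rightarrow> complex"
  assumes hol: "\<And>n. u n holomorphic_on UNIV"
    and scale: "\<And>n w. u 0 (\<sigma> ^ n * w) = \<kappa> ^ n * u n w"
    and \<sigma>: "\<sigma> \<noteq> 0" and le: "cmod \<kappa> \<le> cmod \<sigma> ^ i"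
    and small: "\<And>\<epsilon>. \<epsilon> > 0 \<Longrightarrow> \<exists>n. \<forall>w. cmod w = 1 \<longrightarrow> cmod (u n w) \<le> \<epsilon>"
  shows "(deriv ^^ i) (u 0) 0 = 0"
proof -
  have "cmod ((deriv ^^ i) (u 0) 0) \<le> fact i * \<epsilon>" if \<epsilon>: "\<epsilon> > 0" for \<epsilon>
  proof -
    obtain n where n: "\<And>w. cmod w = 1 \<Longrightarrow> cmod (u n w) \<le> \<epsilon>" using small[OF \<epsilon>] by blast
    have "(\<sigma> ^ n) ^ i * (deriv ^^ i) (u 0) 0 = (deriv ^^ i) (\<lambda>w. u 0 (\<sigma> ^ n * w)) 0"
      using higher_deriv_compose_linear[OF hol[of 0] open_UNIV open_UNIV, of 0 "\<sigma> ^ n" i] by simp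
    also have "\<dots> = \<kappa> ^ n * (deriv ^^ i) (u n) 0"
      unfolding scale by (rule higher_deriv_cmult[OF hol]) auto
    finally have "(cmod \<sigma> ^ i) ^ n * cmod ((deriv ^^ i) (u 0) 0) = cmod \<kappa> ^ n * cmod ((deriv ^^ i) (u n) 0)"
      by (metis norm_mult norm_power power_mult mult.commute)
    also have "\<dots> \<le> (cmod \<sigma> ^ i) ^ n * (fact i * \<epsilon>)"
      by (intro mult_mono power_mono le sphere_bound_higher_deriv_0 hol n) auto
    finally show ?thesis using \<sigma> by (simp add: mult_le_cancel_left)
  qed
  note * = this
  have "cmod ((deriv ^^ i) (u 0) 0) \<le> 0 + \<epsilon>" if "\<epsilon> > 0" for \<epsilon>
    using *[of "\<epsilon> / fact i"] that by simp
  then have "cmod ((deriv ^^ i) (u 0) 0) \<le> 0" by (rule field_le_epsilon)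
  then show ?thesis by simp
qed

lemma entire_eq_polynomial:
  assumes hol: "f holomorphic_on UNIV" and z: "\<And>i. i \<ge> m \<Longrightarrow> (deriv ^^ i) f 0 = 0"
  shows "f w = (\<Sum>i<m. (deriv ^^ i) f 0 / fact i * w ^ i)"
proof -
  have "(\<lambda>n. (deriv ^^ n) f 0 / fact n * (w - 0) ^ n) sums f w"
    by (rule holomorphic_power_series[of _ _ "cmod w + 1"])
      (auto intro: holomorphic_on_subset[OF hol])
  moreover have "(\<lambda>n. (deriv ^^ n) f 0 / fact n * (w - 0) ^ n) sums
      (\<Sum>i<m. (deriv ^^ i) f 0 / fact i * (w - 0) ^ i)"
    by (rule sums_finite) (use z in auto)
  ultimately show ?thesis using sums_unique2 by fastforce
qed

text \<open>The combination \<open>p(2z) - 2\<^sup>m p(z)\<close> removes the coefficient of degree \<open>m\<close> and rescales the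
  others, so the coefficients inherit the regularity of the values.\<close>

lemma smooth_coefficients:
  fixes a :: "nat \<Rightarrow> real \<Rightarrow> complex"
  assumes "\<And>z. smooth_on S (\<lambda>x. \<Sum>i<m. a i x * z ^ i)" "i < m"
  shows "smooth_on S (a i)"
  using assms
proof (induction m arbitrary: a i)
  case (Suc m)
  have small: "smooth_on S (a j)" if j: "j < m" for j
  proof -
    have "smooth_on S (\<lambda>x. (2 ^ j - 2 ^ m) * a j x)"
    proof (rule Suc.IH[OF _ j])
      fix z :: complex
      have "smooth_on S (\<lambda>x. (\<Sum>i<Suc m. a i x * (2 * z) ^ i) - 2 ^ m * (\<Sum>i<Suc m. a i x * z ^ i))"
        by (intro smooth_on_diff smooth_on_mult smooth_on_const Suc.prems(1))
      then show "smooth_on S (\<lambda>x. \<Sum>i<m. (2 ^ i - 2 ^ m) * a i x * z ^ i)"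
        by (rule smooth_on_cong)
          (simp add: power_mult_distrib algebra_simps sum_distrib_left sum_subtractf)
    qed
    then have sm: "smooth_on S (\<lambda>x. inverse (2 ^ j - 2 ^ m) * ((2 ^ j - 2 ^ m) * a j x))"
      by (rule smooth_on_mult[OF smooth_on_const])
    define c :: complex where "c = 2 ^ j - 2 ^ m"
    have "(2::nat) ^ j \<noteq> 2 ^ m" using j by simp
    then have "of_nat (2 ^ j) \<noteq> (of_nat (2 ^ m) :: complex)" by (simp only: of_nat_eq_iff not_False_eq_True)
    then have "c \<noteq> 0" by (simp add: c_def)
    then have "inverse c * (c * a j x) = a j x" for x by (simp add: mult.assoc[symmetric])
    then show ?thesis using smooth_on_cong[OF sm, of "a j"] by (simp add: c_def)
  qed
  have "smooth_on S (\<lambda>x. (\<Sum>i<Suc m. a i x * 1 ^ i) - (\<Sum>i<m. a i x))"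
    by (intro smooth_on_diff smooth_on_sum Suc.prems(1)) (use small in auto)
  then have "smooth_on S (a m)" by (rule smooth_on_cong) simp
  then show ?case using small Suc.prems(2) by (cases "i = m") auto
qed simp

lemma holomorphic2_slices:
  assumes "holomorphic2_on G UNIV"
  shows "(\<lambda>z. fst (G (z, w))) holomorphic_on UNIV" "(\<lambda>z. snd (G (z, w))) holomorphic_on UNIV"
    "(\<lambda>z. fst (G (w, z))) holomorphic_on UNIV" "(\<lambda>z. snd (G (w, z))) holomorphic_on UNIV"
proof -
  have "\<exists>D. (G has_derivative D) (at v) \<and> (\<forall>c u. D (cscale c u) = cscale c (D u))" for v
    using assms unfolding holomorphic2_on_def by blast
  then obtain D where D: "\<And>v. (G has_derivative D v) (at v)" "\<And>v c u. D v (cscale c u) = cscale c (D v u)"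
    by metis
  have d1: "((\<lambda>z. G (z, w)) has_derivative (\<lambda>h. D (z, w) (h, 0))) (at z)" for z
  proof -
    have "((\<lambda>z. (z, w)) has_derivative (\<lambda>h. (h, 0))) (at z)" by (auto intro!: derivative_eq_intros)
    from diff_chain_at[OF this D(1)] show ?thesis by (simp add: o_def)
  qed
  have d2: "((\<lambda>z. G (w, z)) has_derivative (\<lambda>h. D (w, z) (0, h))) (at z)" for z
  proof -
    have "((\<lambda>z. (w, z)) has_derivative (\<lambda>h. (0, h))) (at z)" by (auto intro!: derivative_eq_intros)
    from diff_chain_at[OF this D(1)] show ?thesis by (simp add: o_def)
  qed
  have l1: "fst (D v (h, 0)) = h * fst (D v (1, 0))" "snd (D v (h, 0)) = h * snd (D v (1, 0))" for v h
    using arg_cong[OF D(2)[of v h "(1, 0)"], of fst] arg_cong[OF D(2)[of v h "(1, 0)"], of snd]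
    by (simp_all add: cscale_def)
  have l2: "fst (D v (0, h)) = h * fst (D v (0, 1))" "snd (D v (0, h)) = h * snd (D v (0, 1))" for v h
    using arg_cong[OF D(2)[of v h "(0, 1)"], of fst] arg_cong[OF D(2)[of v h "(0, 1)"], of snd]
    by (simp_all add: cscale_def)
  have fd: "((\<lambda>z. f z) has_field_derivative c) (at z)"
    if "(f has_derivative (\<lambda>h. h * c)) (at z)" for f :: "complex \<Rightarrow> complex" and c z
  proof -
    have "(\<lambda>h. h * c) = (*) c" by (rule ext) (rule mult.commute)
    then show ?thesis using that unfolding has_field_derivative_def by simp
  qed
  have "((\<lambda>z. fst (G (z, w))) has_field_derivative fst (D (z, w) (1, 0))) (at z)"
    "((\<lambda>z. snd (G (z, w))) has_field_derivative snd (D (z, w) (1, 0))) (at z)" for z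
  proof -
    have e: "(\<lambda>h. fst (D (z, w) (h, 0))) = (\<lambda>h. h * fst (D (z, w) (1, 0)))"
      "(\<lambda>h. snd (D (z, w) (h, 0))) = (\<lambda>h. h * snd (D (z, w) (1, 0)))"
      by (rule ext, rule l1)+
    show "((\<lambda>z. fst (G (z, w))) has_field_derivative fst (D (z, w) (1, 0))) (at z)"
      by (rule fd, subst e(1)[symmetric], rule has_derivative_fst[OF d1])
    show "((\<lambda>z. snd (G (z, w))) has_field_derivative snd (D (z, w) (1, 0))) (at z)"
      by (rule fd, subst e(2)[symmetric], rule has_derivative_snd[OF d1])
  qed
  then show "(\<lambda>z. fst (G (z, w))) holomorphic_on UNIV" "(\<lambda>z. snd (G (z, w))) holomorphic_on UNIV"
    unfolding holomorphic_on_open[OF open_UNIV] by blast+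
  have "((\<lambda>z. fst (G (w, z))) has_field_derivative fst (D (w, z) (0, 1))) (at z)"
    "((\<lambda>z. snd (G (w, z))) has_field_derivative snd (D (w, z) (0, 1))) (at z)" for z
  proof -
    have e: "(\<lambda>h. fst (D (w, z) (0, h))) = (\<lambda>h. h * fst (D (w, z) (0, 1)))"
      "(\<lambda>h. snd (D (w, z) (0, h))) = (\<lambda>h. h * snd (D (w, z) (0, 1)))"
      by (rule ext, rule l2)+
    show "((\<lambda>z. fst (G (w, z))) has_field_derivative fst (D (w, z) (0, 1))) (at z)"
      by (rule fd, subst e(1)[symmetric], rule has_derivative_fst[OF d2])
    show "((\<lambda>z. snd (G (w, z))) has_field_derivative snd (D (w, z) (0, 1))) (at z)"
      by (rule fd, subst e(2)[symmetric], rule has_derivative_snd[OF d2])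
  qed
  then show "(\<lambda>z. fst (G (w, z))) holomorphic_on UNIV" "(\<lambda>z. snd (G (w, z))) holomorphic_on UNIV"
    unfolding holomorphic_on_open[OF open_UNIV] by blast+
qed

text \<open>Uniform continuity on the compact collar \<open>C \<times> [0, 1]\<close>.\<close>

lemma small_near_boundary:
  fixes h :: "pt \<Rightarrow> complex"
  assumes cont: "continuous_on Rt h" and zero: "\<And>p. p \<in> leaf_t 0 \<Longrightarrow> h p = 0"
    and C: "compact C" "0 \<notin> C" and "\<epsilon> > 0"
  obtains \<delta> where "\<delta> > 0" "\<And>w x. w \<in> C \<Longrightarrow> 0 \<le> x \<Longrightarrow> x < \<delta> \<Longrightarrow> cmod (h (at_level x w)) < \<epsilon>"
proof -
  let ?K = "C \<times> {0..1::real}" and ?g = "\<lambda>(w, x). h (at_level x w)"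
  have inRt: "at_level x w \<in> Rt" if "w \<in> C" "x \<ge> 0" for w x
    using that C by (auto simp: at_level_in_Rt)
  have "continuous_on ?K (\<lambda>q. (fst (fst q), snd (fst q), snd q))" by (intro continuous_intros)
  then have "continuous_on ?K (\<lambda>q. h (fst (fst q), snd (fst q), snd q))"
    by (rule continuous_on_compose2[OF cont]) (use inRt in \<open>auto simp: at_level_def\<close>)
  moreover have "?g = (\<lambda>q. h (fst (fst q), snd (fst q), snd q))"
    by (simp add: fun_eq_iff at_level_def)
  ultimately have "continuous_on ?K ?g" by simp
  moreover have "compact ?K" using C by (intro compact_Times) auto
  ultimately have "uniformly_continuous_on ?K ?g" by (rule compact_uniformly_continuous)
  then obtain d where d: "d > 0"
    "\<And>q r. q \<in> ?K \<Longrightarrow> r \<in> ?K \<Longrightarrow> dist r q < d \<Longrightarrow> dist (?g r) (?g q) < \<epsilon>"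
    using \<open>\<epsilon> > 0\<close> unfolding uniformly_continuous_on_def by metis
  show ?thesis
  proof (rule that[of "min d 1"])
    fix w x assume w: "w \<in> C" and x: "0 \<le> x" "x < min d 1"
    have "h (at_level 0 w) = 0" by (rule zero) (use inRt[OF w] in \<open>simp add: leaf_t_def\<close>)
    moreover have "dist (w, x) (w, 0) < d" using x by (simp add: dist_Pair_Pair dist_real_def)
    ultimately show "cmod (h (at_level x w)) < \<epsilon>"
      using d(2)[of "(w, 0)" "(w, x)"] w x by simp
  qed (use d in simp)
qed


section \<open>Functions multiplied by a constant under the deck group\<close>

context reeb
begin

text \<open>Both coordinates of a lift over the identity differ from the corresponding coordinate
  functions by such a function, with \<open>\<kappa>\<close> equal to \<open>\<lambda>\<close> and \<open>\<mu>\<close>, respectively.\<close>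

definition multiplicative :: "complex \<Rightarrow> (pt \<Rightarrow> complex) \<Rightarrow> bool" where
  "multiplicative \<kappa> h \<longleftrightarrow> smooth_on Rt h \<and> (\<forall>p\<in>leaf_t 0. h p = 0) \<and>
     (\<forall>p\<in>Rt. h (Tz 1 p) = \<kappa> * h p) \<and>
     (\<forall>x>0. \<forall>w. (\<lambda>z. h (z, w, x)) holomorphic_on UNIV \<and> (\<lambda>z. h (w, z, x)) holomorphic_on UNIV)"

lemma multiplicativeD:
  assumes "multiplicative \<kappa> h"
  shows "smooth_on Rt h" "p \<in> leaf_t 0 \<Longrightarrow> h p = 0" "p \<in> Rt \<Longrightarrow> h (Tz 1 p) = \<kappa> * h p"
    "x > 0 \<Longrightarrow> (\<lambda>z. h (z, w, x)) holomorphic_on UNIV"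
    "x > 0 \<Longrightarrow> (\<lambda>z. h (w, z, x)) holomorphic_on UNIV"
  using assms unfolding multiplicative_def by simp_all

lemma multiplicative_pow:
  assumes h: "multiplicative \<kappa> h" and "x > 0"
  shows "h (lam ^ n * z, mu ^ n * w, x) = \<kappa> ^ n * h (z, w, (\<psi> ^^ n) x)"
  using \<open>x > 0\<close>
proof (induction n arbitrary: x)
  case (Suc n)
  have p: "(lam ^ n * z, mu ^ n * w, \<psi> x) \<in> Rt" using psi_pos[OF Suc.prems] by (simp add: Rt_def)
  have "Tz 1 (lam ^ n * z, mu ^ n * w, \<psi> x) = (lam ^ Suc n * z, mu ^ Suc n * w, x)"
    using phz_1[OF psi_nonneg, of x] phi_psi[of x] Suc.prems by (simp add: Tz_def mult.assoc)
  then have "h (lam ^ Suc n * z, mu ^ Suc n * w, x) = \<kappa> * h (lam ^ n * z, mu ^ n * w, \<psi> x)"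
    using multiplicativeD(3)[OF h p] by simp
  also have "\<dots> = \<kappa> ^ Suc n * h (z, w, (\<psi> ^^ n) (\<psi> x))"
    using Suc.IH[OF psi_pos[OF Suc.prems]] by simp
  finally show ?case by (simp add: funpow_swap1)
qed simp

lemma eventually_small:
  assumes h: "multiplicative \<kappa> h" and C: "compact C" "0 \<notin> C" and "x > 0" "\<epsilon> > 0"
  obtains n where "\<And>w. w \<in> C \<Longrightarrow> cmod (h (at_level ((\<psi> ^^ n) x) w)) < \<epsilon>"
proof -
  obtain \<delta> where \<delta>: "\<delta> > 0" "\<And>w x. w \<in> C \<Longrightarrow> 0 \<le> x \<Longrightarrow> x < \<delta> \<Longrightarrow> cmod (h (at_level x w)) < \<epsilon>"
    using small_near_boundary[OF smooth_on_imp_continuous_on[OF multiplicativeD(1)[OF h]]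
        multiplicativeD(2)[OF h] C \<open>\<epsilon> > 0\<close>] by blast
  have "eventually (\<lambda>n. (\<psi> ^^ n) x < \<delta>) sequentially"
    using psi_pow_tendsto_0[of x] \<open>x > 0\<close> \<delta>(1) by (intro order_tendstoD) auto
  then obtain n where "(\<psi> ^^ n) x < \<delta>" by (auto simp: eventually_sequentially)
  then show ?thesis using that[of n] \<delta>(2) psi_pow_nonneg[of x n] \<open>x > 0\<close> by simp
qed

text \<open>The second coordinates of a backward orbit stay bounded, so that the circles in the first
  coordinate stay in a compact set away from the axis.\<close>

lemma multiplicative_indep_fst:
  assumes h: "multiplicative \<kappa> h" and le: "cmod \<kappa> \<le> cmod lam" and x: "x > 0"
  shows "h (z, w, x) = h (z', w, x)"
proof -
  \<comment> \<open>The functions on the lines that correspond under the \<open>n\<close>-th iterate of the deck generator to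
    the line through the given point.\<close>
  define u where "u n z = h (z, w / mu ^ n, (\<psi> ^^ n) x)" for n z
  have hol: "u n holomorphic_on UNIV" for n
    unfolding u_def by (rule multiplicativeD(4)[OF h psi_pow_pos[OF x]])
  have scale: "u 0 (lam ^ n * z) = \<kappa> ^ n * u n z" for n z
    using multiplicative_pow[OF h x, of n z "w / mu ^ n"] by (simp add: u_def)
  have small: "\<exists>n. \<forall>z. cmod z = 1 \<longrightarrow> cmod (u n z) \<le> \<epsilon>" if \<epsilon>: "\<epsilon> > 0" for \<epsilon>
  proof -
    let ?C = "sphere 0 1 \<times> cball 0 (cmod w) :: (complex \<times> complex) set"
    have "compact ?C" "0 \<notin> ?C" by (auto intro!: compact_Times simp: zero_prod_def)
    then obtain n where n: "\<And>v. v \<in> ?C \<Longrightarrow> cmod (h (at_level ((\<psi> ^^ n) x) v)) < \<epsilon>"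
      using eventually_small[OF h _ _ x \<epsilon>] by blast
    have "cmod (w / mu ^ n) \<le> cmod w"
    proof -
      have "1 \<le> cmod mu ^ n" using mu_gt by (intro one_le_power) simp
      then show ?thesis by (simp add: norm_divide norm_power divide_le_eq mult_left_le_imp_le mult_le_cancel_left1)
    qed
    then have "cmod (u n z) \<le> \<epsilon>" if "cmod z = 1" for z
      using n[of "(z, w / mu ^ n)"] that by (simp add: u_def at_level_def)
    then show ?thesis by blast
  qed
  have z0: "(deriv ^^ i) (u 0) 0 = 0" if "i \<ge> 1" for i
  proof (rule rescaled_coefficient_vanishes[OF hol scale lam_nz _ small])
    have "cmod lam ^ 1 \<le> cmod lam ^ i" using lam_gt that by (intro power_increasing) auto
    then show "cmod \<kappa> \<le> cmod lam ^ i" using le by simp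
  qed
  have "u 0 z = u 0 0" for z using entire_eq_polynomial[of "u 0" 1 z, OF hol z0] by simp
  then have "u 0 z = u 0 z'" by metis
  then show ?thesis by (simp add: u_def)
qed

text \<open>The first coordinate \<open>1\<close> is one choice; by the preceding lemma any other gives the same
  Taylor coefficients in the second coordinate when \<open>\<bar>\<kappa>\<bar> \<le> \<bar>\<lambda>\<bar>\<close>.\<close>

definition coef :: "(pt \<Rightarrow> complex) \<Rightarrow> nat \<Rightarrow> real \<Rightarrow> complex" where
  "coef h i x = (deriv ^^ i) (\<lambda>w. h (1, w, x)) 0 / fact i"

lemma coef_vanishes:
  assumes h: "multiplicative \<kappa> h" and le: "cmod \<kappa> \<le> cmod lam" and x: "x > 0"
    and i: "cmod \<kappa> \<le> cmod mu ^ i"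
  shows "coef h i x = 0"
proof -
  define u where "u n w = h (1, w, (\<psi> ^^ n) x)" for n w
  have hol: "u n holomorphic_on UNIV" for n
    unfolding u_def by (rule multiplicativeD(5)[OF h psi_pow_pos[OF x]])
  have scale: "u 0 (mu ^ n * w) = \<kappa> ^ n * u n w" for n w
    using multiplicative_pow[OF h x, of n 1 w]
      multiplicative_indep_fst[OF h le x, of "lam ^ n" "mu ^ n * w" 1] by (simp add: u_def)
  have small: "\<exists>n. \<forall>w. cmod w = 1 \<longrightarrow> cmod (u n w) \<le> \<epsilon>" if \<epsilon>: "\<epsilon> > 0" for \<epsilon>
  proof -
    let ?C = "{1} \<times> sphere 0 1 :: (complex \<times> complex) set"
    have "compact ?C" "0 \<notin> ?C" by (auto intro!: compact_Times simp: zero_prod_def)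
    then obtain n where n: "\<And>v. v \<in> ?C \<Longrightarrow> cmod (h (at_level ((\<psi> ^^ n) x) v)) < \<epsilon>"
      using eventually_small[OF h _ _ x \<epsilon>] by blast
    have "cmod (u n w) \<le> \<epsilon>" if "cmod w = 1" for w
      using n[of "(1, w)"] that by (simp add: u_def at_level_def)
    then show ?thesis by blast
  qed
  have "(deriv ^^ i) (u 0) 0 = 0"
    by (rule rescaled_coefficient_vanishes[OF hol scale mu_nz i small])
  moreover have "u 0 = (\<lambda>w. h (1, w, x))" by (rule ext) (simp add: u_def)
  ultimately show ?thesis by (simp add: coef_def)
qed

lemma coef_equation:
  assumes h: "multiplicative \<kappa> h" and le: "cmod \<kappa> \<le> cmod lam" and x: "x > 0"
  shows "coef h i (\<phi> x) = \<kappa> / mu ^ i * coef h i x"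
proof -
  have "h (1, mu * w, \<phi> x) = \<kappa> * h (1, w, x)" for w
    using multiplicative_pow[OF h phi_pos[OF x], of 1 1 w]
      multiplicative_indep_fst[OF h le phi_pos[OF x], of lam "mu * w" 1] psi_phi[of x] x by simp
  then have "(deriv ^^ i) (\<lambda>w. h (1, mu * w, \<phi> x)) 0 = (deriv ^^ i) (\<lambda>w. \<kappa> * h (1, w, x)) 0" by simp
  moreover have "(deriv ^^ i) (\<lambda>w. \<kappa> * h (1, w, x)) 0 = \<kappa> * (deriv ^^ i) (\<lambda>w. h (1, w, x)) 0"
    by (rule higher_deriv_cmult[OF multiplicativeD(5)[OF h x]]) auto
  moreover have "(deriv ^^ i) (\<lambda>w. h (1, mu * w, \<phi> x)) 0 = mu ^ i * (deriv ^^ i) (\<lambda>w. h (1, w, \<phi> x)) 0"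
    using higher_deriv_compose_linear[OF multiplicativeD(5)[OF h phi_pos[OF x], of 1] open_UNIV open_UNIV, of 0 mu i]
    by simp
  ultimately show ?thesis by (simp add: coef_def field_simps)
qed

text \<open>Since \<open>\<bar>\<mu>\<bar> > 1\<close>, only finitely many Taylor coefficients escape the vanishing criterion.\<close>

lemma multiplicative_expansion:
  assumes h: "multiplicative \<kappa> h" and le: "cmod \<kappa> \<le> cmod lam" and m: "cmod \<kappa> \<le> cmod mu ^ m"
    and x: "x > 0"
  shows "h (z, w, x) = (\<Sum>i<m. coef h i x * w ^ i)"
proof -
  have "(deriv ^^ i) (\<lambda>w. h (1, w, x)) 0 = 0" if "i \<ge> m" for i
  proof -
    have "cmod mu ^ m \<le> cmod mu ^ i" using mu_gt that by (intro power_increasing) auto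
    then have "coef h i x = 0" using m by (intro coef_vanishes[OF h le x]) simp
    then show ?thesis by (simp add: coef_def)
  qed
  from entire_eq_polynomial[OF multiplicativeD(5)[OF h x] this]
  have "h (1, w, x) = (\<Sum>i<m. coef h i x * w ^ i)" by (simp add: coef_def)
  then show ?thesis using multiplicative_indep_fst[OF h le x, of z w 1] by simp
qed

lemma coef_smooth:
  assumes h: "multiplicative \<kappa> h" and le: "cmod \<kappa> \<le> cmod lam"
  shows "smooth_on {0<..} (coef h i)"
proof -
  obtain m0 where m0: "cmod \<kappa> < cmod mu ^ m0" using real_arch_pow[OF mu_gt] by blast
  define m where "m = max m0 (Suc i)"
  have "cmod mu ^ m0 \<le> cmod mu ^ m" using mu_gt by (intro power_increasing) (auto simp: m_def)
  then have m: "cmod \<kappa> \<le> cmod mu ^ m" using m0 by simp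
  show ?thesis
  proof (rule smooth_coefficients)
    show "i < m" by (simp add: m_def)
    fix z :: complex
    have "smooth_on {0<..} (\<lambda>x. h (1, z, x))"
      by (rule smooth_on_compose[OF _ multiplicativeD(1)[OF h]])
        (auto intro!: smooth_on_intros simp: Rt_def)
    then show "smooth_on {0<..} (\<lambda>x. \<Sum>i<m. coef h i x * z ^ i)"
      by (rule smooth_on_cong) (simp add: multiplicative_expansion[OF h le m])
  qed
qed

end

section \<open>The structure of the kernel\<close>

lemma polynomial_coefficients_unique:
  fixes c d :: "'i \<Rightarrow> complex"
  assumes "finite I" "inj_on e I" "\<And>z. (\<Sum>i\<in>I. c i * z ^ e i) = (\<Sum>i\<in>I. d i * z ^ e i)" "i \<in> I"
  shows "c i = d i"
proof -
  define p where "p = (\<Sum>i\<in>I. monom (c i - d i) (e i))"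
  have "poly p z = 0" for z
    using assms(3)[of z] by (simp add: p_def poly_sum poly_monom left_diff_distrib sum_subtractf)
  then have "p = 0" using poly_all_0_iff_0 by blast
  then have "0 = coeff p (e i)" by simp
  also have "\<dots> = (\<Sum>k\<in>I. if k = i then c k - d k else 0)"
    unfolding p_def coeff_sum coeff_monom
    by (rule sum.cong) (use assms(2,4) in \<open>auto simp: inj_on_def\<close>)
  also have "\<dots> = c i - d i" using assms(1,4) by simp
  finally show ?thesis by simp
qed

context reeb
begin

text \<open>The coefficient functions that are smooth up to the boundary and vanish there, as they must for
  a lift that is the identity over the boundary leaf.\<close>

definition flat_sol :: "complex \<Rightarrow> (real \<Rightarrow> complex) \<Rightarrow> bool" where
  "flat_sol \<nu> c \<longleftrightarrow> smooth_on UNIV c \<and> c 0 = 0 \<and> (\<forall>x\<ge>0. c (\<phi> x) = \<nu> * c x)"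

definition zext :: "(real \<Rightarrow> complex) \<Rightarrow> real \<Rightarrow> complex" where
  "zext \<beta> x = (if x > 0 then \<beta> x else 0)"

lemma flat_sol_zero: "flat_sol \<nu> (\<lambda>x. 0)"
  by (simp add: flat_sol_def smooth_on_const)

lemma flat_sol_minus: "flat_sol \<nu> c \<Longrightarrow> flat_sol \<nu> (\<lambda>x. - c x)"
  by (simp add: flat_sol_def smooth_on_uminus)

text \<open>If \<open>\<bar>\<nu>\<bar> = 1\<close>, then \<open>\<bar>\<beta>\<bar>\<close> is constant along backward orbits, which end at \<open>0\<close>.\<close>

lemma Z_sol_trivial:
  assumes \<beta>: "\<beta> \<in> carrier (Z_sol \<phi> \<nu>)" and \<nu>: "cmod \<nu> = 1" and x: "x > 0"
  shows "\<beta> x = 0"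
proof -
  have eq: "\<And>x. x > 0 \<Longrightarrow> \<beta> (\<phi> x) = \<nu> * \<beta> x" using \<beta> by (simp add: Z_sol_def)
  obtain g where g: "flat_at_0 g" "\<And>x. x > 0 \<Longrightarrow> g x = \<beta> x"
    using \<beta> \<nu> by (auto simp: Z_sol_def)
  have "((\<lambda>x. g x /\<^sub>R x ^ 0) \<longlongrightarrow> 0) (at_right 0)" using g(1) unfolding flat_at_0_def by blast
  then have lim: "(g \<longlongrightarrow> 0) (at_right 0)" by simp
  have "filterlim (\<lambda>n. (\<psi> ^^ n) x) (at_right 0) sequentially"
    unfolding filterlim_at using psi_pow_tendsto_0[of x] psi_pow_pos[OF x] x
    by (simp add: less_imp_neq[THEN not_sym])
  then have "(\<lambda>n. g ((\<psi> ^^ n) x)) \<longlonglongrightarrow> 0" by (rule filterlim_compose[OF lim])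
  then have "(\<lambda>n. cmod (g ((\<psi> ^^ n) x))) \<longlonglongrightarrow> 0" by (rule tendsto_norm_zero)
  moreover have "cmod (\<beta> ((\<psi> ^^ n) x)) = cmod (\<beta> x)" for n
  proof (induction n)
    case (Suc n)
    have "\<beta> ((\<psi> ^^ n) x) = \<nu> * \<beta> ((\<psi> ^^ Suc n) x)"
      using eq[OF psi_pow_pos[OF x, of "Suc n"]] phi_psi[of "(\<psi> ^^ n) x"] psi_pow_nonneg[of x n] x by simp
    then show ?case using Suc \<nu> by (simp add: norm_mult)
  qed simp
  then have "cmod (g ((\<psi> ^^ n) x)) = cmod (\<beta> x)" for n using g(2)[OF psi_pow_pos[OF x]] by simp
  ultimately show ?thesis by (simp add: LIMSEQ_const_iff)
qed

lemma flat_sol_zext: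
  assumes \<beta>: "\<beta> \<in> carrier (Z_sol \<phi> \<nu>)" and \<nu>: "cmod \<nu> \<ge> 1"
  shows "flat_sol \<nu> (zext \<beta>)"
proof -
  have eq: "\<And>x. x > 0 \<Longrightarrow> \<beta> (\<phi> x) = \<nu> * \<beta> x" and sm: "smooth_on {0<..} \<beta>"
    using \<beta> by (simp_all add: Z_sol_def)
  have "smooth_on UNIV (zext \<beta>)"
  proof (cases "cmod \<nu> = 1")
    case True
    have "zext \<beta> = (\<lambda>x. 0)" using Z_sol_trivial[OF \<beta> True] by (auto simp: zext_def)
    then show ?thesis by (simp add: smooth_on_const)
  next
    case False
    then have "cmod \<nu> > 1" using \<nu> by simp
    then have "smooth_on UNIV (\<lambda>x. if x > 0 then \<beta> x else 0)"
      using sm eq by (rule solution_extends_by_zero)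
    then show ?thesis by (simp add: zext_def[abs_def])
  qed
  moreover have "zext \<beta> (\<phi> x) = \<nu> * zext \<beta> x" if "x \<ge> 0" for x
    using eq[of x] phi_pos[of x] phi_0 that by (cases "x = 0") (simp_all add: zext_def)
  ultimately show ?thesis by (simp add: flat_sol_def zext_def)
qed

lemma Z_sol_combine:
  assumes \<beta>: "\<beta> \<in> carrier (Z_sol \<phi> \<nu>)" and \<gamma>: "\<gamma> \<in> carrier (Z_sol \<phi> \<nu>)"
  shows "(\<lambda>x\<in>{0<..}. \<beta> x + c * \<gamma> x) \<in> carrier (Z_sol \<phi> \<nu>)"
proof -
  have "smooth_on {0<..} (\<lambda>x. \<beta> x + c * \<gamma> x)"
    by (intro smooth_on_add smooth_on_mult smooth_on_const) (use \<beta> \<gamma> in \<open>simp_all add: Z_sol_def\<close>)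
  then have "smooth_on {0<..} (\<lambda>x\<in>{0<..}. \<beta> x + c * \<gamma> x)" by (rule smooth_on_cong) simp
  moreover have "\<exists>g. smooth_on {0..} g \<and> flat_at_0 g \<and> (\<forall>x>0. g x = (\<lambda>x\<in>{0<..}. \<beta> x + c * \<gamma> x) x)"
    if \<nu>: "cmod \<nu> \<le> 1"
  proof -
    obtain g where g: "smooth_on {0..} g" "flat_at_0 g" "\<forall>x>0. g x = \<beta> x"
      using \<beta> \<nu> by (auto simp: Z_sol_def)
    obtain k where k: "smooth_on {0..} k" "flat_at_0 k" "\<forall>x>0. k x = \<gamma> x"
      using \<gamma> \<nu> by (auto simp: Z_sol_def)
    have "flat_at_0 (\<lambda>x. g x + c * k x)"
      unfolding flat_at_0_def
    proof
      fix n :: nat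
      have "((\<lambda>x. g x /\<^sub>R x ^ n + c * (k x /\<^sub>R x ^ n)) \<longlongrightarrow> 0 + c * 0) (at_right 0)"
        using g(2) k(2) unfolding flat_at_0_def by (intro tendsto_intros) blast+
      then show "((\<lambda>x. (g x + c * k x) /\<^sub>R x ^ n) \<longlongrightarrow> 0) (at_right 0)" by (simp add: scaleR_add_right)
    qed
    then show ?thesis
      using g k smooth_on_add[OF g(1) smooth_on_mult[OF smooth_on_const[of _ c] k(1)]]
      by (intro exI[of _ "\<lambda>x. g x + c * k x"]) simp
  qed
  ultimately show ?thesis using \<beta> \<gamma> by (simp add: Z_sol_def phi_pos algebra_simps)
qed

lemma Z_sol_group: "group (Z_sol \<phi> \<nu>)"
proof (rule groupI)
  let ?C = "carrier (Z_sol \<phi> \<nu>)"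
  have "\<exists>g::real \<Rightarrow> complex. smooth_on {0..} g \<and> flat_at_0 g \<and> (\<forall>x>0. g x = 0)"
    by (intro exI[of _ "\<lambda>x. 0"]) (simp add: smooth_on_const flat_at_0_def)
  moreover have "smooth_on {0<..} (\<lambda>x\<in>{0<..}. 0 :: complex)" by (rule smooth_on_cong[OF smooth_on_const]) simp
  ultimately show one: "\<one>\<^bsub>Z_sol \<phi> \<nu>\<^esub> \<in> ?C" by (simp add: Z_sol_def phi_pos)
  fix \<beta> assume \<beta>: "\<beta> \<in> ?C"
  have "(\<lambda>x\<in>{0<..}. (\<lambda>x\<in>{0<..}. 0) x + \<beta> x) = (\<lambda>x\<in>{0<..}. \<beta> x)" by (rule restrict_ext) simp
  then show "\<one>\<^bsub>Z_sol \<phi> \<nu>\<^esub> \<otimes>\<^bsub>Z_sol \<phi> \<nu>\<^esub> \<beta> = \<beta>" using \<beta> by (simp add: Z_sol_def extensional_restrict)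
  show "\<exists>\<gamma>\<in>?C. \<gamma> \<otimes>\<^bsub>Z_sol \<phi> \<nu>\<^esub> \<beta> = \<one>\<^bsub>Z_sol \<phi> \<nu>\<^esub>"
  proof
    show "(\<lambda>x\<in>{0<..}. \<one>\<^bsub>Z_sol \<phi> \<nu>\<^esub> x + - 1 * \<beta> x) \<in> ?C" by (rule Z_sol_combine[OF one \<beta>])
    show "(\<lambda>x\<in>{0<..}. \<one>\<^bsub>Z_sol \<phi> \<nu>\<^esub> x + - 1 * \<beta> x) \<otimes>\<^bsub>Z_sol \<phi> \<nu>\<^esub> \<beta> = \<one>\<^bsub>Z_sol \<phi> \<nu>\<^esub>"
      unfolding Z_sol_def by (simp, rule restrict_ext) simp
  qed
  fix \<gamma> assume \<gamma>: "\<gamma> \<in> ?C"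
  show "\<beta> \<otimes>\<^bsub>Z_sol \<phi> \<nu>\<^esub> \<gamma> \<in> ?C" using Z_sol_combine[OF \<beta> \<gamma>, of 1] by (simp add: Z_sol_def)
  show "\<beta> \<otimes>\<^bsub>Z_sol \<phi> \<nu>\<^esub> \<gamma> \<otimes>\<^bsub>Z_sol \<phi> \<nu>\<^esub> \<delta> = \<beta> \<otimes>\<^bsub>Z_sol \<phi> \<nu>\<^esub> (\<gamma> \<otimes>\<^bsub>Z_sol \<phi> \<nu>\<^esub> \<delta>)" for \<delta>
    unfolding Z_sol_def by (simp, rule restrict_ext) simp
qed

text \<open>The normal form of the elements of the kernel.\<close>

definition shear :: "nat set \<Rightarrow> (nat \<Rightarrow> nat) \<Rightarrow> (nat \<Rightarrow> real \<Rightarrow> complex) \<Rightarrow> (real \<Rightarrow> complex) \<Rightarrow> pt \<Rightarrow> pt" where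
  "shear I e c d p = (fst p + (\<Sum>i\<in>I. c i (height p) * fst (snd p) ^ e i),
     fst (snd p) + d (height p), height p)"

lemma height_shear [simp]: "height (shear I e c d p) = height p"
  by (simp add: shear_def height_def)

lemma shear_equivariant:
  assumes c: "\<And>i. i \<in> I \<Longrightarrow> flat_sol (lam / mu ^ e i) (c i)" and d: "flat_sol mu d"
  shows "equivariant (shear I e c d)"
proof (rule equivariantI[where \<eta> = "\<lambda>x. x"])
  have comp: "smooth_on Rt (\<lambda>p. a (height p))" if "smooth_on UNIV a" for a :: "real \<Rightarrow> complex"
    by (rule smooth_on_compose[OF _ that]) (auto intro!: smooth_on_intros simp: height_def)
  show "smooth_on Rt (shear I e c d)"
    unfolding shear_def[abs_def]
    by (intro smooth_on_Pair smooth_on_add smooth_on_sum smooth_on_mult smooth_on_power comp)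
      (use c d in \<open>auto intro!: smooth_on_intros simp: flat_sol_def height_def\<close>)
  show id0: "shear I e c d p = p" if "p \<in> leaf_t 0" for p
  proof -
    have "(\<Sum>i\<in>I. c i 0 * fst (snd p) ^ e i) = 0"
      by (rule sum.neutral) (use c in \<open>simp add: flat_sol_def\<close>)
    then show ?thesis using leaf_tD(2)[OF that] d by (cases p) (simp add: shear_def flat_sol_def height_def)
  qed
  fix p assume p: "p \<in> Rt"
  show "shear I e c d p \<in> Rt"
  proof (cases "height p = 0")
    case True
    then show ?thesis using id0[of p] p by (simp add: leaf_t_def)
  next
    case False
    then have "height p > 0" using height_nonneg[OF p] by simp
    then show ?thesis by (simp add: shear_def Rt_def)
  qed
  have x: "height p \<ge> 0" by (rule height_nonneg[OF p])
  have "(\<Sum>i\<in>I. c i (\<phi> (height p)) * (mu * fst (snd p)) ^ e i) =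
      lam * (\<Sum>i\<in>I. c i (height p) * fst (snd p) ^ e i)"
    unfolding sum_distrib_left
  proof (rule sum.cong)
    fix i assume "i \<in> I"
    then have "c i (\<phi> (height p)) = lam / mu ^ e i * c i (height p)" using c x by (simp add: flat_sol_def)
    then show "c i (\<phi> (height p)) * (mu * fst (snd p)) ^ e i = lam * (c i (height p) * fst (snd p) ^ e i)"
      by (simp add: power_mult_distrib)
  qed simp
  moreover have "d (\<phi> (height p)) = mu * d (height p)" using d x by (simp add: flat_sol_def)
  ultimately show "shear I e c d (Tz 1 p) = Tz 1 (shear I e c d p)"
    using phz_1[OF x] by (simp add: shear_def Tz_def height_def distrib_left)
next
  fix x :: real
  have "holomorphic2_on (\<lambda>w. (fst w + (\<Sum>i\<in>I. c i x * snd w ^ e i), snd w + d x)) W" for W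
    unfolding holomorphic2_on_def
  proof
    fix w :: "complex \<times> complex"
    let ?D = "\<lambda>v. (fst v + (\<Sum>i\<in>I. c i x * (of_nat (e i) * snd v * snd w ^ (e i - 1))), snd v)"
    have "((\<lambda>w. (fst w + (\<Sum>i\<in>I. c i x * snd w ^ e i), snd w + d x)) has_derivative ?D) (at w)"
      by (auto intro!: derivative_eq_intros)
    moreover have "?D (cscale a v) = cscale a (?D v)" for a v
      by (simp add: cscale_def distrib_left sum_distrib_left mult_ac)
    ultimately show "\<exists>D. ((\<lambda>w. (fst w + (\<Sum>i\<in>I. c i x * snd w ^ e i), snd w + d x)) has_derivative D) (at w) \<and>
        (\<forall>c v. D (cscale c v) = cscale c (D v))" by blast
  qed
  then show "leaf_holomorphic_t (shear I e c d) x"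
    by (simp add: leaf_holomorphic_t_def shear_def proj_C2_def at_level_def height_def)
qed simp

definition kernel_lifts :: "(pt \<Rightarrow> pt) set" where
  "kernel_lifts = {F \<in> lifts. \<forall>p\<in>Rt. height (F p) = height p}"

lemma shear_lift:
  assumes eq: "equivariant (shear I e c d)" "equivariant (shear I e c' d')"
    and inv: "\<And>p. p \<in> Rt \<Longrightarrow> shear I e c' d' (shear I e c d p) = p"
      "\<And>p. p \<in> Rt \<Longrightarrow> shear I e c d (shear I e c' d' p) = p"
  shows "restrict (shear I e c d) Rt \<in> kernel_lifts"
proof -
  have "restrict (shear I e c d) Rt \<in> lifts"
  proof (rule liftsI[OF _ eq(2)])
    show "equivariant (restrict (shear I e c d) Rt)" by (rule equivariant_cong[OF _ eq(1)]) simp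
    show "restrict (shear I e c d) Rt (shear I e c' d' p) = p" if "p \<in> Rt" for p
      using inv(2)[OF that] equivariantD(1)[OF eq(2) that] by simp
  qed (simp_all add: inv(1))
  then show ?thesis by (simp add: kernel_lifts_def)
qed

lemma shear_fst_lift:
  assumes c: "\<And>i. i \<in> I \<Longrightarrow> flat_sol (lam / mu ^ e i) (c i)"
  shows "restrict (shear I e c (\<lambda>x. 0)) Rt \<in> kernel_lifts"
proof (rule shear_lift)
  show "equivariant (shear I e c (\<lambda>x. 0))" by (intro shear_equivariant c flat_sol_zero)
  show "equivariant (shear I e (\<lambda>i x. - c i x) (\<lambda>x. 0))"
    by (intro shear_equivariant flat_sol_minus c flat_sol_zero)
qed (simp_all add: shear_def height_def sum_negf)

lemma shear_snd_lift:
  assumes d: "flat_sol mu d"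
  shows "restrict (shear {} e c d) Rt \<in> kernel_lifts"
proof (rule shear_lift)
  show "equivariant (shear {} e c d)" by (intro shear_equivariant d) simp
  show "equivariant (shear {} e c (\<lambda>x. - d x))" by (intro shear_equivariant flat_sol_minus d) simp
qed (simp_all add: shear_def height_def)

lemma kernel_lifts_multiplicative:
  assumes F: "F \<in> kernel_lifts"
  shows "multiplicative lam (\<lambda>p. fst (F p) - fst p)"
    "multiplicative mu (\<lambda>p. fst (snd (F p)) - fst (snd p))"
proof -
  have FE: "equivariant F" using F lifts_equivariant by (simp add: kernel_lifts_def)
  note FD = equivariantD[OF FE]
  have G: "holomorphic2_on (\<lambda>w. proj_C2 (F (at_level x w))) UNIV" if "x > 0" for x
    using FD(4)[of x] that by (simp add: leaf_holomorphic_t_def leaf_domain)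
  note sl = holomorphic2_slices[OF G, unfolded proj_C2_def at_level_def fst_conv snd_conv]
  show "multiplicative lam (\<lambda>p. fst (F p) - fst p)"
    unfolding multiplicative_def
  proof (intro conjI ballI allI impI)
    show "smooth_on Rt (\<lambda>p. fst (F p) - fst p)" using FD(2) by (intro smooth_on_intros)
    show "fst (F p) - fst p = 0" if "p \<in> leaf_t 0" for p using FD(6)[OF that] by simp
    show "fst (F (Tz 1 p)) - fst (Tz 1 p) = lam * (fst (F p) - fst p)" if "p \<in> Rt" for p
      using FD(5)[OF that] by (simp add: Tz_def right_diff_distrib)
  qed (auto intro!: holomorphic_intros sl)
  show "multiplicative mu (\<lambda>p. fst (snd (F p)) - fst (snd p))"
    unfolding multiplicative_def
  proof (intro conjI ballI allI impI)
    show "smooth_on Rt (\<lambda>p. fst (snd (F p)) - fst (snd p))" using FD(2) by (intro smooth_on_intros)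
    show "fst (snd (F p)) - fst (snd p) = 0" if "p \<in> leaf_t 0" for p using FD(6)[OF that] by simp
    show "fst (snd (F (Tz 1 p))) - fst (snd (Tz 1 p)) = mu * (fst (snd (F p)) - fst (snd p))" if "p \<in> Rt" for p
      using FD(5)[OF that] by (simp add: Tz_def right_diff_distrib)
  qed (auto intro!: holomorphic_intros sl)
qed

lemma Z_sol_coef:
  assumes h: "multiplicative \<kappa> h" and le: "cmod \<kappa> \<le> cmod lam"
  shows "restrict (coef h i) {0<..} \<in> carrier (Z_sol \<phi> (\<kappa> / mu ^ i))"
proof -
  have "smooth_on {0<..} (restrict (coef h i) {0<..})"
    by (rule smooth_on_cong[OF coef_smooth[OF h le]]) simp
  moreover have "\<exists>g. smooth_on {0..} g \<and> flat_at_0 g \<and> (\<forall>x>0. g x = restrict (coef h i) {0<..} x)"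
    if "cmod (\<kappa> / mu ^ i) \<le> 1"
  proof -
    have "cmod mu ^ i > 0" using mu_gt by simp
    then have "cmod \<kappa> \<le> cmod mu ^ i" using that by (simp add: norm_divide norm_power)
    then have "restrict (coef h i) {0<..} x = 0" if "x > 0" for x
      using coef_vanishes[OF h le that] that by simp
    then show ?thesis by (intro exI[of _ "\<lambda>x. 0"]) (simp add: smooth_on_const flat_at_0_def)
  qed
  ultimately show ?thesis
    using coef_equation[OF h le] by (simp add: Z_sol_def phi_pos)
qed

text \<open>The translation in the second coordinate, which is independent of the point of the leaf.\<close>

definition trans :: "(pt \<Rightarrow> pt) \<Rightarrow> real \<Rightarrow> complex" where
  "trans F = (\<lambda>x\<in>{0<..}. fst (snd (F (1, 0, x))))"

lemma trans_kernel_lift: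
  assumes F: "F \<in> kernel_lifts"
  shows "x > 0 \<Longrightarrow> fst (snd (F (z, w, x))) = w + trans F x" "trans F \<in> carrier (Z_sol \<phi> mu)"
proof -
  let ?h = "\<lambda>p. fst (snd (F p)) - fst (snd p)"
  note h = kernel_lifts_multiplicative(2)[OF F]
  have ex: "fst (snd (F (z, w, x))) = w + coef ?h 0 x" if "x > 0" for z w x
    using multiplicative_expansion[OF h lam_ge, of 1, OF _ that, of z w] by (simp add: algebra_simps)
  have tr: "trans F = restrict (coef ?h 0) {0<..}"
    unfolding trans_def by (rule restrict_ext) (simp add: ex)
  show "x > 0 \<Longrightarrow> fst (snd (F (z, w, x))) = w + trans F x" by (simp add: ex tr)
  show "trans F \<in> carrier (Z_sol \<phi> mu)" using Z_sol_coef[OF h lam_ge, of 0] by (simp add: tr)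
qed

lemma kernel_lift_height: "F \<in> kernel_lifts \<Longrightarrow> p \<in> Rt \<Longrightarrow> height (F p) = height p"
  by (simp add: kernel_lifts_def)

lemma kernel_lift_in_lifts: "F \<in> kernel_lifts \<Longrightarrow> F \<in> lifts"
  by (simp add: kernel_lifts_def)

abbreviation "KG \<equiv> K_group lam mu \<phi>"

lemma K_carrier: "carrier KG = desc ` kernel_lifts"
proof -
  have one: "\<one>\<^bsub>centralizer_Diff \<phi>\<^esub> = (\<lambda>x\<in>{0..}. x)" by (simp add: centralizer_eq BijGroup_def)
  have iff: "trv (desc F) = (\<lambda>x\<in>{0..}. x) \<longleftrightarrow> F \<in> kernel_lifts" if F: "F \<in> lifts" for F
  proof
    assume eq: "trv (desc F) = (\<lambda>x\<in>{0..}. x)"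
    have "height (F p) = height p" if "p \<in> Rt" for p
      using fun_cong[OF eq[unfolded transverse_desc[OF F]], of "height p"] height_nonneg[OF that]
        equivariantD(3)[OF lifts_equivariant[OF F] that] by simp
    then show "F \<in> kernel_lifts" using F by (simp add: kernel_lifts_def)
  next
    assume "F \<in> kernel_lifts"
    then show "trv (desc F) = (\<lambda>x\<in>{0..}. x)"
      unfolding transverse_desc[OF F]
      by (intro restrict_ext) (simp add: kernel_lift_height base_in_Rt, simp add: height_def)
  qed
  show ?thesis
  proof (intro equalityI subsetI)
    fix f assume "f \<in> carrier KG"
    then have f: "f \<in> carrier autRH" "trv f = (\<lambda>x\<in>{0..}. x)"
      using one by (simp_all add: K_group_def kernel_def)
    obtain F where F: "F \<in> lifts" "f = desc F" using f(1) by (rule desc_surj)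
    then show "f \<in> desc ` kernel_lifts" using iff[OF F(1)] f(2) by simp
  next
    fix f assume "f \<in> desc ` kernel_lifts"
    then obtain F where F: "F \<in> kernel_lifts" "f = desc F" by blast
    then show "f \<in> carrier KG"
      using iff[OF kernel_lift_in_lifts[OF F(1)]] desc_in_autRH[OF kernel_lift_in_lifts[OF F(1)]] one
      by (simp add: K_group_def kernel_def)
  qed
qed

lemma K_mult:
  assumes "F \<in> kernel_lifts" "G \<in> kernel_lifts"
  shows "desc F \<otimes>\<^bsub>KG\<^esub> desc G = desc (compose Rt F G)"
  using assms autRH_mult[OF desc_in_autRH desc_in_autRH, of F G] desc_compose[of F G]
  by (simp add: K_group_def kernel_lift_in_lifts lifts_equivariant)

lemma K_group_group: "group KG"
  using transverse_extension by (simp add: group_extension_def)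

definition transK :: "(pt set \<Rightarrow> pt set) \<Rightarrow> real \<Rightarrow> complex" where
  "transK f = trans (lift_R lam mu \<phi> f)"

lemma transK_desc: "F \<in> kernel_lifts \<Longrightarrow> transK (desc F) = trans F"
  by (simp add: transK_def lift_R_desc kernel_lift_in_lifts)

lemma transK_epi: "transK \<in> epi KG (Z_sol \<phi> mu)"
proof -
  have "transK \<in> hom KG (Z_sol \<phi> mu)"
  proof (rule homI)
    fix f assume "f \<in> carrier KG"
    then obtain F where F: "F \<in> kernel_lifts" "f = desc F" unfolding K_carrier by blast
    then show "transK f \<in> carrier (Z_sol \<phi> mu)" using trans_kernel_lift(2) transK_desc by simp
  next
    fix f g assume "f \<in> carrier KG" "g \<in> carrier KG"
    then obtain F G where F: "F \<in> kernel_lifts" "f = desc F" and G: "G \<in> kernel_lifts" "g = desc G"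
      unfolding K_carrier by blast
    have FG: "compose Rt F G \<in> kernel_lifts"
      using lifts_compose[OF kernel_lift_in_lifts[OF F(1)] kernel_lift_in_lifts[OF G(1)]]
        equivariantD(1)[OF lifts_equivariant[OF kernel_lift_in_lifts[OF G(1)]]]
        kernel_lift_height[OF F(1)] kernel_lift_height[OF G(1)]
      by (simp add: kernel_lifts_def compose_def)
    have "trans (compose Rt F G) = (\<lambda>x\<in>{0<..}. trans F x + trans G x)"
      unfolding trans_def[of "compose Rt F G"]
    proof (rule restrict_ext)
      fix x :: real assume "x \<in> {0<..}"
      then have x: "x > 0" by simp
      have b: "(1, 0, x) \<in> Rt" using base_in_Rt[of x] x by simp
      obtain z w where Gp: "G (1, 0, x) = (z, w, x)"
        using kernel_lift_height[OF G(1) b] by (cases "G (1, 0, x)") (simp add: height_def)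
      have "w = trans G x" using trans_kernel_lift(1)[OF G(1) x, of 1 0] Gp by simp
      then show "fst (snd (compose Rt F G (1, 0, x))) = trans F x + trans G x"
        using trans_kernel_lift(1)[OF F(1) x, of z w] b Gp by (simp add: compose_def)
    qed
    then show "transK (f \<otimes>\<^bsub>KG\<^esub> g) = transK f \<otimes>\<^bsub>Z_sol \<phi> mu\<^esub> transK g"
      using F G FG by (simp add: K_mult transK_desc Z_sol_def)
  qed
  moreover have "transK ` carrier KG = carrier (Z_sol \<phi> mu)"
  proof (rule equalityI)
    show "transK ` carrier KG \<subseteq> carrier (Z_sol \<phi> mu)"
      using calculation by (rule hom_carrier)
    show "carrier (Z_sol \<phi> mu) \<subseteq> transK ` carrier KG"
    proof
      fix \<beta> assume \<beta>: "\<beta> \<in> carrier (Z_sol \<phi> mu)"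
      let ?F = "restrict (shear {} (\<lambda>i. 0) (\<lambda>i x. 0) (zext \<beta>)) Rt"
      have F: "?F \<in> kernel_lifts"
        using mu_gt by (intro shear_snd_lift flat_sol_zext[OF \<beta>]) simp
      have "trans ?F = (\<lambda>x\<in>{0<..}. \<beta> x)"
        unfolding trans_def
        by (rule restrict_ext) (simp add: base_in_Rt, simp add: shear_def height_def zext_def)
      also have "\<dots> = \<beta>" using \<beta> by (simp add: Z_sol_def extensional_restrict)
      finally have "\<beta> = transK (desc ?F)" using transK_desc[OF F] by simp
      then show "\<beta> \<in> transK ` carrier KG"
        by (rule image_eqI[of _ transK]) (simp only: K_carrier, rule imageI[OF F])
    qed
  qed
  ultimately show ?thesis by (simp add: epi_def)
qed

text \<open>A lift that fixes the second coordinate is determined by its effect on the first, whose Taylor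
  coefficients of order \<open>j\<close> with \<open>\<bar>\<mu>\<bar>\<^sup>j \<ge> \<bar>\<lambda>\<bar>\<close> vanish.\<close>

lemma kernel_lift_eq_shear:
  assumes F: "F \<in> kernel_lifts" and tr: "trans F = (\<lambda>x\<in>{0<..}. 0)"
    and I: "finite I" "inj_on e I" and all: "\<And>j. cmod mu ^ j < cmod lam \<Longrightarrow> j \<in> e ` I"
  shows "F = restrict (shear I e (\<lambda>i. zext (restrict (coef (\<lambda>p. fst (F p) - fst p) (e i)) {0<..})) (\<lambda>x. 0)) Rt"
    (is "F = restrict ?S Rt")
proof (rule extensionalityI[of _ Rt])
  let ?h = "\<lambda>p. fst (F p) - fst p"
  note h = kernel_lifts_multiplicative(1)[OF F]
  show "F \<in> extensional Rt" using lifts_Bij[OF kernel_lift_in_lifts[OF F]] by (simp add: Bij_def)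
  fix p assume p: "p \<in> Rt"
  obtain z w x where pe: "p = (z, w, x)" by (cases p)
  have x: "x \<ge> 0" using height_nonneg[OF p] by (simp add: pe height_def)
  have "F p = ?S p"
  proof (cases "x = 0")
    case True
    then have "F p = p"
      using p equivariantD(6)[OF lifts_equivariant[OF kernel_lift_in_lifts[OF F]], of p]
      by (simp add: leaf_t_def pe height_def)
    then show ?thesis using True by (simp add: shear_def zext_def pe height_def)
  next
    case False
    then have x: "x > 0" using x by simp
    obtain m0 where m0: "cmod lam < cmod mu ^ m0" using real_arch_pow[OF mu_gt] by blast
    \<comment> \<open>An order beyond the listed exponents at which the expansion may be cut off.\<close>
    define m where "m = max m0 (Suc (Max (insert 0 (e ` I))))"
    have "cmod mu ^ m0 \<le> cmod mu ^ m" using mu_gt by (intro power_increasing) (auto simp: m_def)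
    then have m: "cmod lam \<le> cmod mu ^ m" using m0 by simp
    have sub: "e ` I \<subseteq> {..<m}"
    proof
      fix j assume "j \<in> e ` I"
      then have "j \<le> Max (insert 0 (e ` I))" using I(1) by simp
      then show "j \<in> {..<m}" by (simp add: m_def)
    qed
    have "?h (z, w, x) = (\<Sum>i<m. coef ?h i x * w ^ i)"
      by (rule multiplicative_expansion[OF h order_refl m x])
    also have "\<dots> = (\<Sum>j\<in>e ` I. coef ?h j x * w ^ j)"
    proof (rule sum.mono_neutral_right[OF _ sub])
      show "\<forall>j\<in>{..<m} - e ` I. coef ?h j x * w ^ j = 0"
      proof
        fix j assume "j \<in> {..<m} - e ` I"
        then have "cmod lam \<le> cmod mu ^ j" using all[of j] by force
        then show "coef ?h j x * w ^ j = 0" using coef_vanishes[OF h order_refl x] by simp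
      qed
    qed simp
    also have "\<dots> = (\<Sum>i\<in>I. coef ?h (e i) x * w ^ e i)" using sum.reindex[OF I(2)] by simp
    finally have "fst (F p) = z + (\<Sum>i\<in>I. coef ?h (e i) x * w ^ e i)" by (simp add: pe algebra_simps)
    moreover have "fst (snd (F p)) = w" using trans_kernel_lift(1)[OF F x, of z w] tr x by (simp add: pe)
    moreover have "snd (snd (F p)) = x" using kernel_lift_height[OF F p] by (simp add: pe height_def)
    ultimately have "F p = (z + (\<Sum>i\<in>I. coef ?h (e i) x * w ^ e i), w, x)" by (metis prod.collapse)
    then show ?thesis using x by (simp add: shear_def zext_def pe height_def)
  qed
  then show "F p = restrict ?S Rt p" using p by simp
qed simp

text \<open>The map \<open>e\<close> enumerates the exponents of the second coordinate. Those with \<open>\<bar>\<mu>\<bar>\<^sup>j < \<bar>\<lambda>\<bar>\<close> all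
  occur in the normal form; one with \<open>\<bar>\<mu>\<bar>\<^sup>j = \<bar>\<lambda>\<bar>\<close> may be listed as well, as its factor is the
  trivial group.\<close>

theorem kernel_extension:
  fixes e :: "nat \<Rightarrow> nat"
  assumes I: "finite I" "inj_on e I" and le: "\<And>i. i \<in> I \<Longrightarrow> cmod mu ^ e i \<le> cmod lam"
    and all: "\<And>j. cmod mu ^ j < cmod lam \<Longrightarrow> j \<in> e ` I"
    and \<nu>: "\<And>i. i \<in> I \<Longrightarrow> \<nu> i = lam / mu ^ e i"
  shows "\<exists>\<iota> \<pi>. group_extension (product_group I (\<lambda>i. Z_sol \<phi> (\<nu> i))) \<iota> KG \<pi> (Z_sol \<phi> mu)"
proof -
  let ?P = "product_group I (\<lambda>i. Z_sol \<phi> (\<nu> i))" and ?K = KG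
  define E where "E \<beta> = restrict (shear I e (\<lambda>i. zext (\<beta> i)) (\<lambda>x. 0)) Rt" for \<beta>
  have PZ: "\<beta> i \<in> carrier (Z_sol \<phi> (\<nu> i))" if "\<beta> \<in> carrier ?P" "i \<in> I" for \<beta> i
    using that by auto
  have flat: "flat_sol (lam / mu ^ e i) (zext (\<beta> i))" if \<beta>: "\<beta> \<in> carrier ?P" and i: "i \<in> I" for \<beta> i
  proof (rule flat_sol_zext)
    show "\<beta> i \<in> carrier (Z_sol \<phi> (lam / mu ^ e i))" using PZ[OF \<beta> i] \<nu>[OF i] by simp
    have "cmod mu ^ e i > 0" using mu_gt by simp
    then show "1 \<le> cmod (lam / mu ^ e i)" using le[OF i] by (simp add: norm_divide norm_power)
  qed
  have EK: "E \<beta> \<in> kernel_lifts" if "\<beta> \<in> carrier ?P" for \<beta>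
    unfolding E_def by (rule shear_fst_lift) (rule flat[OF that])
  have E1: "fst (E \<beta> (z, w, x)) = z + (\<Sum>i\<in>I. \<beta> i x * w ^ e i)" if "x > 0" for \<beta> z w x
    using that by (simp add: E_def shear_def zext_def height_def Rt_def)
  have Etr: "trans (E \<beta>) = (\<lambda>x\<in>{0<..}. 0)" for \<beta>
    unfolding trans_def by (rule restrict_ext) (simp add: E_def base_in_Rt, simp add: shear_def)
  have hom: "(\<lambda>\<beta>. desc (E \<beta>)) \<in> hom ?P ?K"
  proof (rule homI)
    fix \<beta> assume "\<beta> \<in> carrier ?P"
    then show "desc (E \<beta>) \<in> carrier ?K" unfolding K_carrier by (intro imageI EK)
  next
    fix \<beta> \<gamma> assume \<beta>: "\<beta> \<in> carrier ?P" and \<gamma>: "\<gamma> \<in> carrier ?P"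
    have "E (\<beta> \<otimes>\<^bsub>?P\<^esub> \<gamma>) = compose Rt (E \<beta>) (E \<gamma>)"
      unfolding compose_def E_def[of "\<beta> \<otimes>\<^bsub>?P\<^esub> \<gamma>"]
    proof (rule restrict_ext)
      fix p assume p: "p \<in> Rt"
      have \<gamma>p: "shear I e (\<lambda>i. zext (\<gamma> i)) (\<lambda>x. 0) p \<in> Rt"
        using equivariantD(1)[OF lifts_equivariant[OF kernel_lift_in_lifts[OF EK[OF \<gamma>]]] p] p
        by (simp add: E_def)
      have "(\<Sum>i\<in>I. zext ((\<beta> \<otimes>\<^bsub>?P\<^esub> \<gamma>) i) x * w ^ e i) =
          (\<Sum>i\<in>I. zext (\<beta> i) x * w ^ e i) + (\<Sum>i\<in>I. zext (\<gamma> i) x * w ^ e i)" for x w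
        unfolding sum.distrib[symmetric]
        by (rule sum.cong) (simp_all add: Z_sol_def zext_def distrib_right)
      then show "shear I e (\<lambda>i. zext ((\<beta> \<otimes>\<^bsub>?P\<^esub> \<gamma>) i)) (\<lambda>x. 0) p = E \<beta> (E \<gamma> p)"
        using p \<gamma>p unfolding E_def by (simp only: restrict_apply if_True) (simp add: shear_def height_def)
    qed
    then show "desc (E (\<beta> \<otimes>\<^bsub>?P\<^esub> \<gamma>)) = desc (E \<beta>) \<otimes>\<^bsub>?K\<^esub> desc (E \<gamma>)"
      using K_mult[OF EK[OF \<beta>] EK[OF \<gamma>]] by simp
  qed
  have inj: "inj_on (\<lambda>\<beta>. desc (E \<beta>)) (carrier ?P)"
  proof (rule inj_onI)
    fix \<beta> \<gamma> assume \<beta>: "\<beta> \<in> carrier ?P" and \<gamma>: "\<gamma> \<in> carrier ?P" and "desc (E \<beta>) = desc (E \<gamma>)"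
    then have eq: "E \<beta> = E \<gamma>" using desc_inj EK kernel_lift_in_lifts by metis
    show "\<beta> = \<gamma>"
    proof (rule extensionalityI[of _ I])
      show "\<beta> \<in> extensional I" "\<gamma> \<in> extensional I" using \<beta> \<gamma> by (auto simp: PiE_def)
      fix i assume i: "i \<in> I"
      show "\<beta> i = \<gamma> i"
      proof (rule extensionalityI[of _ "{0<..}"])
        show "\<beta> i \<in> extensional {0<..}" "\<gamma> i \<in> extensional {0<..}"
          using PZ[OF \<beta> i] PZ[OF \<gamma> i] by (simp_all add: Z_sol_def)
        fix x :: real assume "x \<in> {0<..}"
        then have x: "x > 0" by simp
        have "(\<Sum>i\<in>I. \<beta> i x * w ^ e i) = (\<Sum>i\<in>I. \<gamma> i x * w ^ e i)" for w
          using E1[OF x, of \<beta> 1 w] E1[OF x, of \<gamma> 1 w] eq by simp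
        then show "\<beta> i x = \<gamma> i x" by (rule polynomial_coefficients_unique[OF I _ i])
      qed
    qed
  qed
  have image: "(\<lambda>\<beta>. desc (E \<beta>)) ` carrier ?P = kernel ?K (Z_sol \<phi> mu) transK"
  proof (intro equalityI subsetI)
    fix f assume "f \<in> (\<lambda>\<beta>. desc (E \<beta>)) ` carrier ?P"
    then obtain \<beta> where \<beta>: "\<beta> \<in> carrier ?P" "f = desc (E \<beta>)" by blast
    then show "f \<in> kernel ?K (Z_sol \<phi> mu) transK"
      using hom_in_carrier[OF hom \<beta>(1)] transK_desc[OF EK[OF \<beta>(1)]] Etr
      by (simp add: kernel_def Z_sol_def)
  next
    fix f assume "f \<in> kernel ?K (Z_sol \<phi> mu) transK"
    then have f: "f \<in> carrier ?K" "transK f = (\<lambda>x\<in>{0<..}. 0)" by (simp_all add: kernel_def Z_sol_def)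
    then obtain F where F: "F \<in> kernel_lifts" "f = desc F" unfolding K_carrier by blast
    let ?h = "\<lambda>p. fst (F p) - fst p"
    define \<beta> where "\<beta> = (\<lambda>i\<in>I. restrict (coef ?h (e i)) {0<..})"
    have "\<beta> \<in> carrier ?P"
      using Z_sol_coef[OF kernel_lifts_multiplicative(1)[OF F(1)] order_refl] \<nu>
      by (auto simp: \<beta>_def)
    moreover have "f = desc (E \<beta>)"
    proof -
      have "trans F = (\<lambda>x\<in>{0<..}. 0)" using f(2) F transK_desc by simp
      then have "F = restrict (shear I e (\<lambda>i. zext (restrict (coef ?h (e i)) {0<..})) (\<lambda>x. 0)) Rt"
        by (rule kernel_lift_eq_shear[OF F(1) _ I all])
      also have "\<dots> = E \<beta>"
        unfolding E_def by (rule restrict_ext) (simp add: shear_def \<beta>_def)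
      finally show ?thesis using F(2) by simp
    qed
    ultimately show "f \<in> (\<lambda>\<beta>. desc (E \<beta>)) ` carrier ?P"
      by (intro image_eqI[of f "\<lambda>\<beta>. desc (E \<beta>)" \<beta>])
  qed
  have "group_extension ?P (\<lambda>\<beta>. desc (E \<beta>)) ?K transK (Z_sol \<phi> mu)"
    unfolding group_extension_def
    using hom inj image transK_epi K_group_group Z_sol_group by (simp add: mon_def)
  then show ?thesis by blast
qed

end

theorem theorem3p10:
  fixes lam mu :: complex and \<phi> :: "real \<Rightarrow> real"
  assumes "cmod lam \<ge> cmod mu" and "cmod mu > 1" and "lam \<noteq> mu"
    and "\<phi> \<in> carrier Diff_half"
    and "\<forall>x>0. \<phi> x > x"
    and "flat_at_0 (\<lambda>x. \<phi> x - x)"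
  shows "group_extension (K_group lam mu \<phi>) (\<lambda>f. f) (Aut_RH lam mu \<phi>)
           (transverse lam mu \<phi>) (centralizer_Diff \<phi>) \<and>
         (\<forall>p::nat. p \<ge> 2 \<and> lam = mu ^ p \<longrightarrow>
           (\<exists>\<iota> \<pi>. group_extension
              (product_group {1..p} (\<lambda>j. Z_sol \<phi> (mu ^ j))) \<iota>
              (K_group lam mu \<phi>) \<pi> (Z_sol \<phi> mu))) \<and>
         ((\<forall>m::nat. m \<ge> 1 \<longrightarrow> lam \<noteq> mu ^ m) \<longrightarrow>
           (\<exists>\<iota> \<pi>. group_extension
              (product_group {0..nat \<lfloor>ln (cmod lam) / ln (cmod mu)\<rfloor>} (\<lambda>j. Z_sol \<phi> (lam / mu ^ j))) \<iota>
              (K_group lam mu \<phi>) \<pi> (Z_sol \<phi> mu)))"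
proof -
  interpret reeb \<phi> lam mu
    by unfold_locales (use assms in auto)
  show ?thesis
  proof (intro conjI allI impI)
    show "group_extension (K_group lam mu \<phi>) (\<lambda>f. f) (Aut_RH lam mu \<phi>)
           (transverse lam mu \<phi>) (centralizer_Diff \<phi>)"
      by (rule transverse_extension)
  next
    fix p :: nat assume p: "2 \<le> p \<and> lam = mu ^ p"
    show "\<exists>\<iota> \<pi>. group_extension (product_group {1..p} (\<lambda>j. Z_sol \<phi> (mu ^ j))) \<iota>
              (K_group lam mu \<phi>) \<pi> (Z_sol \<phi> mu)"
    \<comment> \<open>The factors are listed by \<open>\<mu>\<^sup>i = \<lambda> / \<mu>\<^sup>p\<^sup>-\<^sup>i\<close>, opposite to the order of the exponents.\<close>
    proof (rule kernel_extension[where e = "\<lambda>i. p - i"])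
      show "inj_on (\<lambda>i. p - i) {1..p}" by (auto simp: inj_on_def)
      show "cmod mu ^ (p - i) \<le> cmod lam" if "i \<in> {1..p}" for i
        using p mu_gt by (simp add: norm_power power_increasing)
      show "j \<in> (\<lambda>i. p - i) ` {1..p}" if "cmod mu ^ j < cmod lam" for j
      proof -
        have "j < p" using that p mu_gt power_less_imp_less_exp[of "cmod mu" j p] by (simp add: norm_power)
        then show ?thesis by (intro image_eqI[of _ _ "p - j"]) auto
      qed
      show "mu ^ i = lam / mu ^ (p - i)" if "i \<in> {1..p}" for i
        using that p by (simp add: power_diff)
    qed simp
  next
    let ?p = "nat \<lfloor>ln (cmod lam) / ln (cmod mu)\<rfloor>"
    have lm: "ln (cmod mu) > 0" using mu_gt by simp
    have ll: "ln (cmod lam) > 0" using lam_gt by simp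
    have lnp: "ln (cmod mu ^ j) = real j * ln (cmod mu)" for j
      using mu_gt by (simp add: ln_realpow)
    have le_iff: "j \<le> ?p \<longleftrightarrow> cmod mu ^ j \<le> cmod lam" for j
    proof -
      have "j \<le> ?p \<longleftrightarrow> real j \<le> ln (cmod lam) / ln (cmod mu)"
        using lm ll by (simp add: le_nat_iff le_floor_iff)
      also have "\<dots> \<longleftrightarrow> real j * ln (cmod mu) \<le> ln (cmod lam)" using lm by (simp add: pos_le_divide_eq)
      also have "\<dots> \<longleftrightarrow> cmod mu ^ j \<le> cmod lam"
        unfolding lnp[symmetric] using mu_gt lam_gt by (intro ln_le_cancel_iff) auto
      finally show ?thesis .
    qed
    show "\<exists>\<iota> \<pi>. group_extension (product_group {0..?p} (\<lambda>j. Z_sol \<phi> (lam / mu ^ j))) \<iota>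
              (K_group lam mu \<phi>) \<pi> (Z_sol \<phi> mu)"
      by (rule kernel_extension[where e = "\<lambda>i. i"]) (use le_iff in auto)
  qed
qed

end
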